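(* Let $g:\mathbb{R}_+\to\mathbb{R}_+$, $\mathbb{R}_+=[0,\infty)$, be a bounded unimodal function such that $x\mapsto -x+g(x)$ is Lipschitz continuous. Suppose that: (a) $-x+g(x)$ has exactly two zeros on $\mathbb{R}_+$, namely $0$ and some $\kappa>0$, and $-x+g(x)>0$ for $x\in(0,\kappa)$; (b) $g$ is differentiable at $0$, and there are $\alpha,\delta,K>0$ such that $|g(y)-g(x)-g'(0)(y-x)|\le K|y-x|(|x|^\alpha+|y|^\alpha)$ for all $x,y\in[0,\delta)$; (c) $g'(0)>1$ and $g(x_2)-g(x_1)\le g'(0)(x_2-x_1)$ for all $x_1<x_2$ in $\mathbb{R}_+$. Then for each $h\ge 0$ and each $c\ge c_*$, where $c_*=c_*(h)$ is defined in the context, the diffusive delayed equation $$\frac{\partial u(t,x)}{\partial t}=\frac{\partial^2u(t,x)}{\partial x^2}-u(t,x)+g(u(t-h,x)),\qquad u\ge 0,$$ has a unique (up to translation) semi-wavefront with speed $c$; that is, a semi-wavefront with speed $c$ exists, and if $\phi,\psi$ are profiles of two semi-wavefronts with speed $c$, then there is $t'\in\mathbb{R}$ such that $\phi(t+t')=\psi(t)$ for all $t\in\mathbb{R}$.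
   Context: Unimodal (hump-shaped) means that there is $x_m>0$ such that $g$ is non-decreasing on $[0,x_m]$ and non-increasing on $[x_m,\infty)$. The derivative $g'(0)$ is understood as the one-sided derivative. A semi-wavefront with speed $c$ is a classical solution of the form $u(t,x)=\phi(x+ct)$ whose profile $\phi$ is positive and bounded on $\mathbb{R}$ and satisfies $\phi(-\infty)=0$; equivalently, $\phi$ is $C^2$, positive and bounded on $\mathbb{R}$, $\phi(-\infty)=0$, and $\phi''(t)-c\phi'(t)-\phi(t)+g(\phi(t-ch))=0$ for all $t\in\mathbb{R}$. For $h\ge0$ let $\chi(z,c)=z^2-cz-1+g'(0)e^{-zch}$. Then $c_*=c_*(h)>0$ denotes the number, which exists since $g'(0)>1$, such that $\chi(\cdot,c)$ has exactly two positive zeros (counting multiplicity) if and only if $c\ge c_*$. *)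

theory Defs
  imports "HOL-Complex_Analysis.Complex_Analysis"
begin

text \<open>
  The nonlinearity \<open>g\<close> is a function on \<open>[0,\<infinity>)\<close>; it is modelled as a function \<open>real \<Rightarrow> real\<close> whose
  values at negative arguments play no role.
\<close>

definition unimodal :: "(real \<Rightarrow> real) \<Rightarrow> bool" where
  "unimodal g \<longleftrightarrow> (\<exists>xm>0. mono_on {0..xm} g \<and> antimono_on {xm..} g)"

text \<open>The parameter \<open>p\<close> of the characteristic function stands for \<open>g'(0)\<close>.\<close>

definition chi :: "real \<Rightarrow> real \<Rightarrow> real \<Rightarrow> complex \<Rightarrow> complex" where
  "chi p h c z = z\<^sup>2 - of_real c * z - 1 + of_real p * exp (- (z * of_real c * of_real h))"

definition positive_zeros :: "(complex \<Rightarrow> complex) \<Rightarrow> real set" where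
  "positive_zeros f = {x. x > 0 \<and> f (of_real x) = 0}"

text \<open>Zeros are counted with multiplicity, the multiplicity being the order of the zero of the
  entire function \<open>chi p h c\<close>.\<close>

definition two_positive_zeros :: "real \<Rightarrow> real \<Rightarrow> real \<Rightarrow> bool" where
  "two_positive_zeros p h c \<longleftrightarrow>
     finite (positive_zeros (chi p h c)) \<and>
     (\<Sum>x\<in>positive_zeros (chi p h c). zorder (chi p h c) (of_real x)) = 2"

definition c_star :: "real \<Rightarrow> real \<Rightarrow> real" where
  "c_star p h = (THE c0. c0 > 0 \<and> (\<forall>c. two_positive_zeros p h c \<longleftrightarrow> c0 \<le> c))"

text \<open>Classical nonnegative solutions, defined for all times, of
  \<open>u\<^sub>t(t,x) = u\<^sub>x\<^sub>x(t,x) - u(t,x) + g(u(t-h,x))\<close>.\<close>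

definition classical_solution ::
    "(real \<Rightarrow> real) \<Rightarrow> real \<Rightarrow> (real \<Rightarrow> real \<Rightarrow> real) \<Rightarrow> bool" where
  "classical_solution g h u \<longleftrightarrow>
     (\<forall>t x. u t x \<ge> 0) \<and>
     (\<exists>ut ux uxx.
        (\<forall>t x. ((\<lambda>s. u s x) has_real_derivative ut t x) (at t)) \<and>
        (\<forall>t x. (u t has_real_derivative ux t x) (at x)) \<and>
        (\<forall>t x. (ux t has_real_derivative uxx t x) (at x)) \<and>
        continuous_on UNIV (\<lambda>(t, x). ut t x) \<and>
        continuous_on UNIV (\<lambda>(t, x). ux t x) \<and>
        continuous_on UNIV (\<lambda>(t, x). uxx t x) \<and>
        (\<forall>t x. ut t x = uxx t x - u t x + g (u (t - h) x)))"

definition semi_wavefront_profile ::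
    "(real \<Rightarrow> real) \<Rightarrow> real \<Rightarrow> real \<Rightarrow> (real \<Rightarrow> real) \<Rightarrow> bool" where
  "semi_wavefront_profile g h c \<phi> \<longleftrightarrow>
     classical_solution g h (\<lambda>t x. \<phi> (x + c * t)) \<and>
     (\<forall>s. \<phi> s > 0) \<and> bounded (range \<phi>) \<and> (\<phi> \<longlongrightarrow> 0) at_bot"

text \<open>The equivalent description by the profile equation.\<close>

lemma semi_wavefront_profile_iff:
  "semi_wavefront_profile g h c \<phi> \<longleftrightarrow>
     (\<forall>s. \<phi> s > 0) \<and> bounded (range \<phi>) \<and> (\<phi> \<longlongrightarrow> 0) at_bot \<and>
     (\<exists>\<phi>1 \<phi>2.
        (\<forall>s. (\<phi> has_real_derivative \<phi>1 s) (at s)) \<and>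
        (\<forall>s. (\<phi>1 has_real_derivative \<phi>2 s) (at s)) \<and>
        continuous_on UNIV \<phi>2 \<and>
        (\<forall>s. \<phi>2 s - c * \<phi>1 s - \<phi> s + g (\<phi> (s - c * h)) = 0))"
  (is "?L \<longleftrightarrow> ?P \<and> ?B \<and> ?T \<and> ?R")
proof
  assume L: ?L
  then obtain ut ux uxx where
    ut: "\<And>t x. ((\<lambda>s. \<phi> (x + c * s)) has_real_derivative ut t x) (at t)" and
    ux: "\<And>t x. ((\<lambda>x. \<phi> (x + c * t)) has_real_derivative ux t x) (at x)" and
    uxx: "\<And>t x. (ux t has_real_derivative uxx t x) (at x)" and
    cont: "continuous_on UNIV (\<lambda>(t, x). uxx t x)" and
    eq: "\<And>t x. ut t x = uxx t x - \<phi> (x + c * t) + g (\<phi> (x + c * (t - h)))"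
    unfolding semi_wavefront_profile_def classical_solution_def by blast
  have d1: "(\<phi> has_real_derivative ux 0 s) (at s)" for s
    using ux[of 0 s] by simp
  have "((\<lambda>r. \<phi> (s + c * r)) has_real_derivative ux 0 s * c) (at 0)" for s
    by (rule DERIV_chain'[where g = \<phi>]) (use d1 in \<open>auto intro!: derivative_eq_intros\<close>)
  then have "ut 0 s = c * ux 0 s" for s
    using ut[of s 0] DERIV_unique by (metis mult.commute)
  then have "uxx 0 s - c * ux 0 s - \<phi> s + g (\<phi> (s - c * h)) = 0" for s
    using eq[of 0 s] by (simp add: algebra_simps)
  moreover have "continuous_on UNIV (uxx 0)"
    using continuous_on_compose2[OF cont, of UNIV "\<lambda>x. (0, x)"]
    by (simp add: continuous_on_Pair)
  ultimately have ?R using d1 uxx by blast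
  then show "?P \<and> ?B \<and> ?T \<and> ?R"
    using L unfolding semi_wavefront_profile_def by blast
next
  assume R: "?P \<and> ?B \<and> ?T \<and> ?R"
  then obtain \<phi>1 \<phi>2 where
    d1: "\<And>s. (\<phi> has_real_derivative \<phi>1 s) (at s)" and
    d2: "\<And>s. (\<phi>1 has_real_derivative \<phi>2 s) (at s)" and
    cont: "continuous_on UNIV \<phi>2" and
    eq: "\<And>s. \<phi>2 s - c * \<phi>1 s - \<phi> s + g (\<phi> (s - c * h)) = 0"
    by blast
  have c1: "continuous_on UNIV \<phi>1"
    by (rule continuous_at_imp_continuous_on) (use d2 DERIV_isCont in blast)
  have lin: "continuous_on UNIV (\<lambda>(t, x). x + c * t)"
    unfolding case_prod_beta by (intro continuous_intros)
  have "((\<lambda>r. \<phi> (x + c * r)) has_real_derivative \<phi>1 (x + c * t) * c) (at t)" for x t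
    by (rule DERIV_chain'[where g = \<phi>]) (use d1 in \<open>auto intro!: derivative_eq_intros\<close>)
  then have a1: "((\<lambda>r. \<phi> (x + c * r)) has_real_derivative c * \<phi>1 (x + c * t)) (at t)" for x t
    by (metis mult.commute)
  have a2: "((\<lambda>x. \<phi> (x + c * t)) has_real_derivative \<phi>1 (x + c * t)) (at x)" for x t
    using d1[of "x + c * t"] DERIV_shift by blast
  have a3: "((\<lambda>x. \<phi>1 (x + c * t)) has_real_derivative \<phi>2 (x + c * t)) (at x)" for x t
    using d2[of "x + c * t"] DERIV_shift by blast
  have k1: "continuous_on UNIV (\<lambda>(t, x). \<phi>1 (x + c * t))"
    using continuous_on_compose2[OF c1 lin] by (simp add: case_prod_beta)
  have k2: "continuous_on UNIV (\<lambda>(t, x). \<phi>2 (x + c * t))"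
    using continuous_on_compose2[OF cont lin] by (simp add: case_prod_beta)
  have k3: "continuous_on UNIV (\<lambda>(t, x). c * \<phi>1 (x + c * t))"
    using continuous_on_mult_left[OF k1, of c] by (simp add: case_prod_beta)
  have e: "c * \<phi>1 (x + c * t) =
      \<phi>2 (x + c * t) - \<phi> (x + c * t) + g (\<phi> (x + c * (t - h)))" for x t
    using eq[of "x + c * t"] by (simp add: algebra_simps)
  have "\<phi> s \<ge> 0" for s
    using R by (simp add: less_imp_le)
  then have "classical_solution g h (\<lambda>t x. \<phi> (x + c * t))"
    unfolding classical_solution_def
    using a1 a2 a3 k1 k2 k3 e
    by (intro conjI allI exI[of _ "\<lambda>t x. c * \<phi>1 (x + c * t)"] exI[of _ "\<lambda>t x. \<phi>1 (x + c * t)"]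
        exI[of _ "\<lambda>t x. \<phi>2 (x + c * t)"]) assumption+
  then show ?L
    using R unfolding semi_wavefront_profile_def by blast
qed

end

theory Submission
  imports Defs "HOL-Real_Asymp.Real_Asymp"
begin

text \<open>
  Let \<open>l\<close> be the smaller positive zero of the characteristic function \<open>cf\<close>, \<open>d = c h\<close> the delay and
  \<open>p = g'(0)\<close>. For a function \<open>w\<close> and \<open>v(t) = w(t) e\<^sup>-\<^sup>l\<^sup>t\<close> put \<open>E = v' - a v - b \<integral> v\<close>, the integral being
  over \<open>[t - d, t]\<close>, with \<open>a = c - 2 l\<close> and \<open>b = p e\<^sup>-\<^sup>l\<^sup>d\<close>. Then \<open>a + b d = - cf'(l) \<ge> 0\<close>, with equality exactly
  at the critical speed, and \<open>E' = e\<^sup>-\<^sup>l\<^sup>t (p w - G)(t - d)\<close> if \<open>w'' - c w' - w + G(t - d) = 0\<close>. If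
  \<open>E \<ge> 0\<close>, then \<open>v\<close> can never fall below its minimum over a window of length \<open>d\<close>; as a bounded \<open>w\<close>
  forces \<open>v \<rightarrow> 0\<close> at \<open>+\<infinity>\<close>, a positive \<open>w\<close> with \<open>E \<ge> 0\<close> is impossible. By sublinearity \<open>E\<close> increases
  along a profile, and its limit at \<open>-\<infinity>\<close> is finite and negative. Two profiles are therefore
  translated so that these limits agree. Their difference then has \<open>E \<rightarrow> 0\<close> at \<open>-\<infinity>\<close>. It cannot have a
  constant sign near \<open>-\<infinity>\<close> by the preceding argument, and it cannot oscillate there without vanishing
  identically, by a maximum principle.

  For existence, a shooting argument on a half-line \<open>[-n, \<infinity>)\<close> yields bounded solutions, a maximum
  principle keeps them between a supersolution and a subsolution with the expected behaviour at
  \<open>-\<infinity>\<close>, and a limit \<open>n \<rightarrow> \<infinity>\<close> gives a profile.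
\<close>

section \<open>The critical speed\<close>

text \<open>As \<open>g\<close> need not be monotone, two solutions of the nonlinear equation obey
  no comparison principle. Every comparison is made with the linear equation of slope
  \<open>p\<close>: one-sidedly through sublinearity, and near 0 up to an error of order
  \<open>1 + \<alpha>\<close>. The functional \<open>E\<close> replaces exact asymptotics of a
  profile, since it reads off the leading coefficient: for v = A it is the constant -(a + b d) A,
  and if a + b d = 0, then for v = - A t it is - A (1 + b d^2 / 2). So one number fixes the
  translation, whether \<open>l\<close> is a simple or a double zero. Uniqueness uses only a + b d
  >= 0, which says that positive constants are subsolutions of v' = a v + b (window integral).
  Against oscillation the weight has an exponent slightly below \<open>l\<close>: profiles divided
  by it tend to 0 at minus infinity, so that a maximum is attained, while the defect, the value of
  \<open>cf\<close> at that exponent, can be made as small as desired.\<close>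

definition cf :: "real \<Rightarrow> real \<Rightarrow> real \<Rightarrow> real \<Rightarrow> real" where
  "cf p d c z = z\<^sup>2 - c * z - 1 + p * exp (- (z * d))"

definition cf' :: "real \<Rightarrow> real \<Rightarrow> real \<Rightarrow> real \<Rightarrow> real" where
  "cf' p d c z = 2 * z - c - p * d * exp (- (z * d))"

lemma DERIV_cf [derivative_intros]:
  "(cf p d c has_real_derivative cf' p d c z) (at z)"
  unfolding cf_def cf'_def
  by (auto intro!: derivative_eq_intros simp: algebra_simps)

lemma isCont_cf: "isCont (cf p d c) z"
  using DERIV_cf DERIV_isCont by blast

text \<open>Strict convexity of \<open>cf\<close> in \<open>z\<close>; for \<open>d = 0\<close> the
  quadratic part alone provides it.\<close>

lemma cf'_strict_mono:
  assumes "p \<ge> 0" "d \<ge> 0" "x < y"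
  shows "cf' p d c x < cf' p d c y"
proof -
  have "exp (- (y * d)) \<le> exp (- (x * d))"
    using assms by (simp add: mult_right_mono)
  then have "p * d * exp (- (y * d)) \<le> p * d * exp (- (x * d))"
    using assms by (simp add: mult_left_mono)
  then show ?thesis
    using assms unfolding cf'_def by linarith
qed

text \<open>Rolle's theorem gives a zero of \<open>cf'\<close> in between, and strict convexity
  fixes the signs at both ends. Hence there are at most two zeros, and a double zero excludes any
  other.\<close>

lemma cf_zeros_deriv_signs:
  assumes "p \<ge> 0" "d \<ge> 0" "x < y" "cf p d c x = 0" "cf p d c y = 0"
  shows "cf' p d c x < 0" "cf' p d c y > 0"
proof -
  obtain \<xi> where \<xi>: "x < \<xi>" "\<xi> < y" "cf p d c y - cf p d c x = (y - x) * cf' p d c \<xi>"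
    using MVT2[OF \<open>x < y\<close>, of "cf p d c" "cf' p d c"] DERIV_cf by blast
  then have "cf' p d c \<xi> = 0"
    using assms by simp
  then show "cf' p d c x < 0" "cf' p d c y > 0"
    using cf'_strict_mono[OF assms(1,2) \<xi>(1), of c] cf'_strict_mono[OF assms(1,2) \<xi>(2), of c]
    by simp_all
qed

text \<open>\<open>l\<close> is the infimum of the closed set where \<open>cf\<close> is
  nonpositive; a positive derivative there would make \<open>cf\<close> negative just to its left.
  This \<open>l\<close> is the exponent used throughout, and the weak inequality for
  \<open>cf'\<close> covers simple and double zeros alike.\<close>

lemma cf_least_zero:
  assumes "p > 1" "z0 > 0" "cf p d c z0 \<le> 0"
  obtains l where "0 < l" "l \<le> z0" "cf p d c l = 0" "\<And>z. 0 \<le> z \<Longrightarrow> z < l \<Longrightarrow> cf p d c z > 0"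
    "cf' p d c l \<le> 0"
proof -
  define A where "A = {z \<in> {0..z0}. cf p d c z \<le> 0}"
  have "closed A"
    unfolding A_def
    by (intro continuous_on_closed_Collect_le continuous_on_const closed_atLeastAtMost
        continuous_at_imp_continuous_on ballI isCont_cf)
  moreover have "A \<noteq> {}" "bdd_below A"
    using assms unfolding A_def by auto
  ultimately have inA: "Inf A \<in> A"
    using closed_contains_Inf by blast
  define l where "l = Inf A"
  have lam: "0 \<le> l" "l \<le> z0" "cf p d c l \<le> 0"
    using inA unfolding A_def l_def by auto
  have pos: "cf p d c z > 0" if "0 \<le> z" "z < l" for z
  proof (rule ccontr)
    assume "\<not> cf p d c z > 0"
    then have "z \<in> A"
      using that lam unfolding A_def by auto
    then have "l \<le> z"
      unfolding l_def using \<open>bdd_below A\<close> by (simp add: cInf_lower)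
    then show False using that by simp
  qed
  have "cf p d c 0 > 0"
    using assms by (simp add: cf_def)
  with lam have "l > 0"
    by (metis less_eq_real_def not_le)
  have ev: "eventually (\<lambda>z. cf p d c z > 0) (at_left l)"
    using eventually_at_left_real[OF \<open>l > 0\<close>] by eventually_elim (use pos in auto)
  have lim: "(cf p d c \<longlongrightarrow> cf p d c l) (at_left l)"
    using isCont_cf[of l p d c] by (simp add: isCont_def filterlim_at_split)
  have "cf p d c l \<ge> 0"
    by (rule tendsto_lowerbound[OF lim]) (use ev in \<open>auto elim: eventually_mono\<close>)
  with lam have z: "cf p d c l = 0" by simp
  have "cf' p d c l \<le> 0"
  proof (rule ccontr)
    assume "\<not> cf' p d c l \<le> 0"
    then obtain e where e: "e > 0" "\<And>h. h > 0 \<Longrightarrow> h < e \<Longrightarrow> cf p d c (l - h) < cf p d c l"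
      using DERIV_pos_inc_left[OF DERIV_cf, of p d c l] by auto
    define h where "h = min (e / 2) l"
    have "h > 0" "h < e" "h \<le> l"
      using e \<open>l > 0\<close> unfolding h_def by auto
    then show False
      using e(2)[of h] pos[of "l - h"] z by simp
  qed
  then show ?thesis
    using that \<open>l > 0\<close> lam z pos by blast
qed

section \<open>Zeros of the characteristic function and their multiplicities\<close>

lemma chi_of_real: "chi p h c (of_real x) = of_real (cf p (c * h) c x)"
  by (simp add: chi_def cf_def exp_of_real[symmetric] mult.assoc)

lemma positive_zeros_chi: "positive_zeros (chi p h c) = {x. x > 0 \<and> cf p (c * h) c x = 0}"
  unfolding positive_zeros_def chi_of_real by simp

lemma chi_analytic: "chi p h c analytic_on A"
  unfolding chi_def by (intro analytic_intros)

lemma deriv_chi: "deriv (chi p h c) = (\<lambda>z. 2 * z - of_real c - of_real (p * (c * h)) * exp (- (z * of_real c * of_real h)))"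
  unfolding chi_def
  by (rule ext, rule DERIV_imp_deriv) (auto intro!: derivative_eq_intros simp: algebra_simps)

lemma deriv2_chi: "deriv (deriv (chi p h c)) = (\<lambda>z. 2 + of_real (p * (c * h)\<^sup>2) * exp (- (z * of_real c * of_real h)))"
  unfolding deriv_chi
  by (rule ext, rule DERIV_imp_deriv)
    (auto intro!: derivative_eq_intros simp: algebra_simps power2_eq_square)

lemma deriv_chi_of_real: "deriv (chi p h c) (of_real x) = of_real (cf' p (c * h) c x)"
  unfolding deriv_chi cf'_def by (simp add: exp_of_real[symmetric] mult.assoc)

text \<open>At real points the second derivative of \<open>chi\<close> is at least 2, so a zero has
  order at most two, and the vanishing of \<open>cf'\<close> decides which.\<close>

lemma zorder_chi:
  assumes "p > 0" "cf p (c * h) c x = 0"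
  shows "zorder (chi p h c) (of_real x) = (if cf' p (c * h) c x = 0 then 2 else 1)"
proof (cases "cf' p (c * h) c x = 0")
  case False
  then have "zorder (chi p h c) (of_real x) = 1"
    using assms by (intro zorder_zero_eqI' chi_analytic) (auto simp: deriv_chi_of_real chi_of_real)
  then show ?thesis using False by simp
next
  case True
  have "deriv (deriv (chi p h c)) (of_real x) = of_real (2 + p * (c * h)\<^sup>2 * exp (- (x * (c * h))))"
    unfolding deriv2_chi by (simp add: exp_of_real[symmetric] mult.assoc)
  moreover have "2 + p * (c * h)\<^sup>2 * exp (- (x * (c * h))) > 0"
    using assms by (intro add_pos_nonneg mult_nonneg_nonneg) auto
  ultimately have "deriv (deriv (chi p h c)) (of_real x) \<noteq> 0"
    by (metis of_real_eq_0_iff less_irrefl)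
  then have "zorder (chi p h c) (of_real x) = 2"
    using assms True
    by (intro zorder_zero_eqI' chi_analytic)
      (auto simp: deriv_chi_of_real chi_of_real numeral_2_eq_2 less_Suc_eq)
  then show ?thesis using True by simp
qed

text \<open>\<open>c_star\<close> is characterised by a property of all real speeds, so nonpositive
  speeds have to be excluded. For them the exponential is at least 1, and \<open>p > 1\<close>
  outweighs the constant -1.\<close>

lemma cf_pos_of_nonpos_speed:
  assumes "p > 1" "h \<ge> 0" "c \<le> 0" "z > 0"
  shows "cf p (c * h) c z > 0"
proof -
  have "- (z * (c * h)) \<ge> 0"
    using assms by (simp add: mult_nonpos_nonneg mult_nonneg_nonpos)
  then have "p * exp (- (z * (c * h))) \<ge> 1 * 1"
    using assms by (intro mult_mono) auto
  moreover have "z\<^sup>2 > 0" "c * z \<le> 0"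
    using assms by (auto simp: mult_nonpos_nonneg)
  ultimately show ?thesis
    unfolding cf_def by linarith
qed

lemma cf_large_pos:
  assumes "p > 0" "c \<ge> 0" "z \<ge> c + 1"
  shows "cf p d c z > 0"
proof -
  have "z * (z - c) \<ge> 1 * 1"
    using assms by (intro mult_mono) auto
  moreover have "p * exp (- (z * d)) > 0" using assms by simp
  ultimately show ?thesis unfolding cf_def by (simp add: power2_eq_square algebra_simps)
qed

text \<open>\<open>cf\<close> is convex and positive at 0 and for large \<open>z\<close>: once it is
  nonpositive somewhere, it has one double zero or two simple ones. The count thus becomes a closed
  condition on speed and exponent, to which compactness applies.\<close>

lemma two_positive_zeros_iff:
  assumes "p > 1" "h \<ge> 0"
  shows "two_positive_zeros p h c \<longleftrightarrow> c > 0 \<and> (\<exists>z>0. cf p (c * h) c z \<le> 0)"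
proof
  assume L: "two_positive_zeros p h c"
  then have "positive_zeros (chi p h c) \<noteq> {}"
    unfolding two_positive_zeros_def by fastforce
  then obtain z where "z > 0" "cf p (c * h) c z = 0"
    unfolding positive_zeros_chi by auto
  moreover from this have "c > 0"
    using cf_pos_of_nonpos_speed[OF assms, of c z] by (metis less_irrefl not_le)
  ultimately show "c > 0 \<and> (\<exists>z>0. cf p (c * h) c z \<le> 0)" by auto
next
  assume R: "c > 0 \<and> (\<exists>z>0. cf p (c * h) c z \<le> 0)"
  define f f' where "f = cf p (c * h) c" and "f' = cf' p (c * h) c"
  have c: "c > 0" "c * h \<ge> 0" "p \<ge> 0" "p > 0" using R assms by auto
  obtain z0 where "z0 > 0" "f z0 \<le> 0" using R unfolding f_def by auto
  then obtain l where l: "0 < l" "f l = 0" "f' l \<le> 0" "\<And>z. 0 \<le> z \<Longrightarrow> z < l \<Longrightarrow> f z > 0"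
    using cf_least_zero[OF assms(1)] unfolding f_def f'_def by blast
  have signs: "f' x < 0 \<and> f' y > 0" if "x < y" "f x = 0" "f y = 0" for x y
    using cf_zeros_deriv_signs[OF c(3,2)] that unfolding f_def f'_def by auto
  have zo: "zorder (chi p h c) (of_real x) = (if f' x = 0 then 2 else 1)" if "f x = 0" for x
    using zorder_chi[OF c(4)] that unfolding f_def f'_def by simp
  show "two_positive_zeros p h c"
  proof (cases "f' l = 0")
    case True
    have "x = l" if "f x = 0" "x > 0" for x
      using signs[of x l] signs[of l x] l(2) that True by (cases x l rule: linorder_cases) auto
    then have "positive_zeros (chi p h c) = {l}"
      unfolding positive_zeros_chi f_def[symmetric] using l(1,2) by blast
    then show ?thesis
      unfolding two_positive_zeros_def using zo[OF l(2)] True by simp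
  next
    case False
    then have "f' l < 0" using l by simp
    then obtain e where e: "e > 0" "\<And>h. h > 0 \<Longrightarrow> h < e \<Longrightarrow> f (l + h) < f l"
      using DERIV_neg_dec_right[OF DERIV_cf, of p "c * h" c l] unfolding f_def f'_def by auto
    define y where "y = l + e / 2"
    have y: "y > l" "f y < 0" using e(1) e(2)[of "e / 2"] l unfolding y_def by auto
    have "\<not> y \<ge> c + 1"
      using cf_large_pos[OF c(4), of c y "c * h"] y c unfolding f_def by auto
    then have "\<exists>m\<ge>y. m \<le> c + 1 \<and> f m = 0"
      using y cf_large_pos[OF c(4), of c "c + 1" "c * h"] c unfolding f_def
      by (intro IVT) (auto simp: isCont_cf)
    then obtain m where m: "m \<ge> y" "f m = 0" by auto
    have lm: "l < m" using m y by simp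
    have s: "f' l < 0" "f' m > 0" using signs[OF lm l(2) m(2)] by auto
    have "x = l \<or> x = m" if "f x = 0" for x
    proof -
      consider "x < l" | "x = l" | "l < x" "x < m" | "x = m" | "m < x" by linarith
      then show ?thesis
        using signs[of x l] signs[of l x] signs[of x m] signs[of m x] s l(2) m(2) that by cases auto
    qed
    then have "positive_zeros (chi p h c) = {l, m}"
      unfolding positive_zeros_chi f_def[symmetric] using l(1,2) m(2) lm by auto
    then show ?thesis
      unfolding two_positive_zeros_def using zo[OF l(2)] zo[OF m(2)] s lm by simp
  qed
qed

lemma cf_antimono_speed:
  assumes "p \<ge> 0" "h \<ge> 0" "z > 0" "c \<le> c'"
  shows "cf p (c' * h) c' z \<le> cf p (c * h) c z"
proof -
  have "exp (- (z * (c' * h))) \<le> exp (- (z * (c * h)))"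
    using assms by (simp add: mult_left_mono mult_right_mono)
  then have "p * exp (- (z * (c' * h))) \<le> p * exp (- (z * (c * h)))"
    using assms by (simp add: mult_left_mono)
  moreover have "c * z \<le> c' * z" using assms by simp
  ultimately show ?thesis unfolding cf_def by linarith
qed

text \<open>The definite description in \<open>c_star\<close> denotes something only if the
  admissible speeds form a closed half-line. They are closed upwards because \<open>cf\<close>
  decreases in the speed, and a least one exists by compactness.\<close>

lemma c_star_le_imp:
  assumes "p > 1" "h \<ge> 0" "c \<ge> c_star p h"
  shows "c > 0 \<and> (\<exists>z>0. cf p (c * h) c z \<le> 0)"
proof -
  define C where "C = {c. c > 0 \<and> (\<exists>z>0. cf p (c * h) c z \<le> 0)}"
  \<comment> \<open>The box loses nothing: the speed \<open>p\<close> is admissible with exponent 1,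
    and at a speed below \<open>p\<close> every exponent with nonpositive value lies below
    \<open>p + 1\<close>. Exponent 0 belongs to the box, but its value there is
    \<open>p - 1 > 0\<close>.\<close>
  define K where "K = {x \<in> {0..p} \<times> {0..p+1}. cf p (fst x * h) (fst x) (snd x) \<le> 0}"
  have "compact K"
  proof -
    have "closed K" unfolding K_def cf_def
      by (intro continuous_on_closed_Collect_le continuous_intros closed_Times)
    moreover have "bounded K"
      by (rule bounded_subset[OF bounded_Times[of "{0..p}" "{0..p+1}"]]) (auto simp: K_def)
    ultimately show ?thesis by (simp add: compact_eq_bounded_closed)
  qed
  have pC: "cf p (p * h) p 1 \<le> 0"
  proof -
    have "p * exp (- (1 * (p * h))) \<le> p * 1" using assms by (intro mult_left_mono) auto
    then show ?thesis unfolding cf_def by simp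
  qed
  have comp: "compact (fst ` K)"
    using \<open>compact K\<close> by (intro compact_continuous_image continuous_intros)
  have "(p, 1) \<in> K" using pC assms unfolding K_def by auto
  then have "fst ` K \<noteq> {}" by blast
  then obtain c0 where c0: "c0 \<in> fst ` K" "\<And>x. x \<in> fst ` K \<Longrightarrow> c0 \<le> x"
    using compact_attains_inf[OF comp] by blast
  then obtain z0 where z0: "(c0, z0) \<in> K" by auto
  have z0': "z0 \<ge> 0" "cf p (c0 * h) c0 z0 \<le> 0" "c0 \<ge> 0"
    using z0 unfolding K_def by auto
  then have "z0 \<noteq> 0" using assms by (auto simp: cf_def)
  then have "z0 > 0" using z0' by simp
  then have "c0 > 0"
    using z0' cf_pos_of_nonpos_speed[OF assms(1,2), of c0 z0] by (metis not_le)
  have C_iff: "x \<in> C \<longleftrightarrow> c0 \<le> x" for x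
  proof
    assume "c0 \<le> x"
    then have "cf p (x * h) x z0 \<le> 0"
      using cf_antimono_speed[of p h z0 c0 x] assms \<open>z0 > 0\<close> z0' by auto
    then show "x \<in> C" unfolding C_def using \<open>c0 > 0\<close> \<open>c0 \<le> x\<close> \<open>z0 > 0\<close> by auto
  next
    assume "x \<in> C"
    then obtain z where z: "x > 0" "z > 0" "cf p (x * h) x z \<le> 0" unfolding C_def by auto
    show "c0 \<le> x"
    proof (cases "x \<le> p")
      case True
      have "z < x + 1"
        using cf_large_pos[of p x z "x * h"] z assms by (metis not_le less_imp_le less_trans zero_less_one)
      then have "(x, z) \<in> K" using z True unfolding K_def by auto
      then show ?thesis using c0(2)[of x] by (metis fst_conv imageI)
    next
      case False
      have "c0 \<le> p" using z0 unfolding K_def by auto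
      then show ?thesis using False by simp
    qed
  qed
  have iff: "two_positive_zeros p h x \<longleftrightarrow> c0 \<le> x" for x
    using two_positive_zeros_iff[OF assms(1,2), of x] C_iff[of x] unfolding C_def by simp
  have "c_star p h = c0"
    unfolding c_star_def
  proof (rule the_equality)
    fix y assume y: "y > 0 \<and> (\<forall>c. two_positive_zeros p h c = (y \<le> c))"
    then show "y = c0" using iff by (metis order_antisym order_refl)
  qed (use iff \<open>c0 > 0\<close> in auto)
  then show ?thesis
    using C_iff[of c] assms unfolding C_def by simp
qed

section \<open>Delayed differential inequalities\<close>

lemma antiderivative_exists:
  fixes v :: "real \<Rightarrow> real"
  assumes "continuous_on UNIV v"
  obtains V where "\<And>t. (V has_real_derivative v t) (at t)"
proof -
  have "\<exists>F. \<forall>x::real. (-\<infinity>::ereal) < x \<longrightarrow> x < (\<infinity>::ereal) \<longrightarrow> (F has_vector_derivative v x) (at x)"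
    using assms by (intro einterval_antiderivative) (auto simp: continuous_on_eq_continuous_at)
  then obtain V where "\<And>x. (V has_vector_derivative v x) (at x)" by auto
  then show ?thesis
    by (intro that[of V]) (simp add: has_real_derivative_iff_has_vector_derivative)
qed

lemma window_integral_eq:
  fixes v :: "real \<Rightarrow> real"
  assumes "\<And>t. (V has_real_derivative v t) (at t)" "d \<ge> 0"
  shows "integral {t - d..t} v = V t - V (t - d)"
  by (rule integral_unique, rule fundamental_theorem_of_calculus)
    (use assms in \<open>auto simp: has_real_derivative_iff_has_vector_derivative[symmetric]
       intro: has_field_derivative_at_within\<close>)

lemma DERIV_window_integral:
  fixes v :: "real \<Rightarrow> real"
  assumes "continuous_on UNIV v" "d \<ge> 0"
  shows "((\<lambda>t. integral {t - d..t} v) has_real_derivative v t - v (t - d)) (at t)"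
proof -
  obtain V where V: "\<And>t. (V has_real_derivative v t) (at t)"
    using antiderivative_exists[OF assms(1)] by blast
  have "((\<lambda>t. V (t - d)) has_real_derivative v (t - d) * (1 - 0)) (at t)"
    by (rule DERIV_chain'[where g = V]) (use V in \<open>auto intro!: derivative_eq_intros\<close>)
  then have "((\<lambda>t. V t - V (t - d)) has_real_derivative v t - v (t - d)) (at t)"
    using DERIV_diff[OF V[of t]] by simp
  then show ?thesis
    using window_integral_eq[OF V assms(2)] by simp
qed

lemma window_integrable:
  fixes v :: "real \<Rightarrow> real"
  assumes "continuous_on UNIV v"
  shows "v integrable_on {a..b}"
  using assms continuous_on_subset integrable_continuous_real by blast

lemma DERIV_mono_on:
  fixes f :: "real \<Rightarrow> real"
  assumes "a \<le> b" "\<And>t. a \<le> t \<Longrightarrow> t \<le> b \<Longrightarrow> (f has_real_derivative f' t) (at t)"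
    "\<And>t. a \<le> t \<Longrightarrow> t \<le> b \<Longrightarrow> f' t \<ge> 0"
  shows "f a \<le> f b"
  by (rule DERIV_nonneg_imp_nondecreasing[OF assms(1)]) (use assms in blast)

lemma DERIV_mono_on_open:
  fixes f :: "real \<Rightarrow> real"
  assumes "a \<le> b" "continuous_on UNIV f"
    "\<And>t. a < t \<Longrightarrow> t < b \<Longrightarrow> (f has_real_derivative f' t) (at t)"
    "\<And>t. a < t \<Longrightarrow> t < b \<Longrightarrow> f' t \<ge> 0"
  shows "f a \<le> f b"
proof (rule DERIV_nonneg_imp_increasing_open[OF assms(1)])
  show "continuous_on {a..b} f" using continuous_on_subset[OF assms(2)] by simp
qed (use assms(3,4) in blast)

text \<open>Up to a first zero the window integral is nonnegative, so \<open>z\<close> times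
  \<open>exp (- (a * t))\<close> would be nondecreasing from a positive value. The inequality is
  demanded only while \<open>z\<close> has stayed nonnegative, because in \<open>E_persist\<close>
  it is itself derived from that sign.\<close>

lemma delay_inequality_positive:
  fixes z z' :: "real \<Rightarrow> real"
  assumes cont: "continuous_on UNIV z" and "d \<ge> 0" "b \<ge> 0"
    and der: "\<And>t. t0 \<le> t \<Longrightarrow> t \<le> t1 \<Longrightarrow> (z has_real_derivative z' t) (at t)"
    and init: "\<And>s. t0 - d \<le> s \<Longrightarrow> s \<le> t0 \<Longrightarrow> z s > 0"
    and ineq: "\<And>t. t0 \<le> t \<Longrightarrow> t \<le> t1 \<Longrightarrow> (\<And>s. t0 - d \<le> s \<Longrightarrow> s \<le> t \<Longrightarrow> z s \<ge> 0) \<Longrightarrow>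
      z' t \<ge> a * z t + b * integral {t - d..t} z"
    and t: "t0 \<le> t" "t \<le> t1"
  shows "z t > 0"
proof (rule ccontr)
  assume "\<not> z t > 0"
  define A where "A = {s \<in> {t0..t}. z s \<le> 0}"
  have "closed A" unfolding A_def
    by (intro continuous_on_closed_Collect_le continuous_on_const closed_atLeastAtMost
        continuous_on_subset[OF cont]) auto
  moreover have "A \<noteq> {}" "bdd_below A"
    using t \<open>\<not> z t > 0\<close> unfolding A_def by auto
  ultimately have "Inf A \<in> A" using closed_contains_Inf by blast
  define t2 where "t2 = Inf A"
  have t2: "t0 \<le> t2" "t2 \<le> t" "z t2 \<le> 0"
    using \<open>Inf A \<in> A\<close> unfolding A_def t2_def by auto
  have pos: "z s > 0" if "t0 - d \<le> s" "s < t2" for s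
  proof (cases "s \<le> t0")
    case False
    show ?thesis
    proof (rule ccontr)
      assume "\<not> z s > 0"
      then have "s \<in> A" using False that t2 unfolding A_def by auto
      then have "t2 \<le> s" unfolding t2_def using \<open>bdd_below A\<close> by (simp add: cInf_lower)
      then show False using that by simp
    qed
  qed (use init that in auto)
  have z0: "z t0 > 0" using init \<open>d \<ge> 0\<close> by simp
  then have "t0 < t2" using t2 by (metis less_eq_real_def not_le)
  define f where "f = (\<lambda>s. z s * exp (- (a * s)))"
  have "f t0 \<le> f t2"
  proof (rule DERIV_nonneg_imp_increasing_open[OF less_imp_le[OF \<open>t0 < t2\<close>]])
    fix s assume s: "t0 < s" "s < t2"
    have "z' s \<ge> a * z s + b * integral {s - d..s} z"
      by (rule ineq) (use s t2 t pos in \<open>auto simp: less_imp_le\<close>)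
    moreover have "integral {s - d..s} z \<ge> 0"
      by (rule integral_nonneg[OF window_integrable[OF cont]])
        (use s pos in \<open>auto simp: less_imp_le\<close>)
    ultimately have "z' s - a * z s \<ge> 0" using \<open>b \<ge> 0\<close>
      by (smt (verit) mult_nonneg_nonneg)
    moreover have "(f has_real_derivative (z' s - a * z s) * exp (- (a * s))) (at s)"
      unfolding f_def using s t2 t
      by (auto intro!: derivative_eq_intros der simp: algebra_simps)
    ultimately show "\<exists>y. (f has_real_derivative y) (at s) \<and> 0 \<le> y"
      by (meson exp_ge_zero mult_nonneg_nonneg)
  next
    show "continuous_on {t0..t2} f" unfolding f_def
      by (intro continuous_intros continuous_on_subset[OF cont]) auto
  qed
  moreover have "f t0 > 0" "f t2 \<le> 0"
    using z0 t2 unfolding f_def by (auto simp: mult_le_0_iff)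
  ultimately show False by simp
qed

text \<open>The second-order operator is split as \<open>(D - z1) (D - z2)\<close> and each first-order factor is
  integrated backwards from \<open>t0\<close>.\<close>

lemma backward_second_order_bound:
  fixes y y1 y2 :: "real \<Rightarrow> real"
  assumes d1: "\<And>t. l < t \<Longrightarrow> t \<le> t0 \<Longrightarrow> (y has_real_derivative y1 t) (at t)"
    and d2: "\<And>t. l < t \<Longrightarrow> t \<le> t0 \<Longrightarrow> (y1 has_real_derivative y2 t) (at t)"
    and ineq: "\<And>t. l < t \<Longrightarrow> t \<le> t0 \<Longrightarrow> y2 t - (z1 + z2) * y1 t + z1 * z2 * y t \<le> k"
    and "y t0 = 0" "y1 t0 = 0" "z1 < 0" "0 < z2" "k \<ge> 0"
    and t: "l < t" "t \<le> t0"
  shows "y t \<le> k / (- (z1 * z2)) * exp (- z1 * (t0 - t))"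
proof -
  define u where "u = (\<lambda>t. y1 t - z1 * y t)"
  have u: "u s \<ge> - k / z2" if s: "l < s" "s \<le> t0" for s
  proof -
    have "- ((u s + k / z2) * exp (- (z2 * s))) \<le> - ((u t0 + k / z2) * exp (- (z2 * t0)))"
    proof (rule DERIV_mono_on[OF s(2)])
      fix r assume r: "s \<le> r" "r \<le> t0"
      show "((\<lambda>s. - ((u s + k / z2) * exp (- (z2 * s)))) has_real_derivative
          (k - (y2 r - (z1 + z2) * y1 r + z1 * z2 * y r)) * exp (- (z2 * r))) (at r)"
        unfolding u_def using r s \<open>0 < z2\<close>
        by (auto intro!: derivative_eq_intros d1 d2 simp: field_simps)
      show "(k - (y2 r - (z1 + z2) * y1 r + z1 * z2 * y r)) * exp (- (z2 * r)) \<ge> 0"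
        using ineq[of r] r s by (simp add: mult_nonneg_nonneg)
    qed
    moreover have "u t0 = 0" using assms unfolding u_def by simp
    moreover have "k / z2 * exp (- (z2 * t0)) \<ge> 0" using assms by simp
    ultimately have "(u s + k / z2) * exp (- (z2 * s)) \<ge> 0" by simp
    then have "u s + k / z2 \<ge> 0" by (simp add: zero_le_mult_iff)
    then show ?thesis by simp
  qed
  define q where "q = k / (- (z1 * z2))"
  have "z1 * z2 < 0" using assms by (simp add: mult_neg_pos)
  then have q: "q \<ge> 0" "z1 * q = - k / z2"
    using assms unfolding q_def by (auto simp: divide_nonneg_neg)
  have "(y t + q) * exp (- (z1 * t)) \<le> (y t0 + q) * exp (- (z1 * t0))"
  proof (rule DERIV_mono_on[OF t(2)])
    fix r assume r: "t \<le> r" "r \<le> t0"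
    show "((\<lambda>t. (y t + q) * exp (- (z1 * t))) has_real_derivative
        (u r - z1 * q) * exp (- (z1 * r))) (at r)"
      unfolding u_def using r t
      by (auto intro!: derivative_eq_intros d1 simp: algebra_simps)
    show "(u r - z1 * q) * exp (- (z1 * r)) \<ge> 0"
      using u[of r] q r t by simp
  qed
  then have "(y t + q) * exp (- (z1 * t)) * exp (z1 * t) \<le> q * exp (- (z1 * t0)) * exp (z1 * t)"
    using \<open>y t0 = 0\<close> by (simp add: mult_right_mono)
  then have "y t + q \<le> q * exp (- z1 * (t0 - t))"
    by (simp add: mult.assoc exp_add[symmetric] algebra_simps)
  then show ?thesis using q unfolding q_def by simp
qed

text \<open>The operator annihilates constants, so an interior maximum is not absurd at once. The
  delayed term has the positive coefficient \<open>- (z1 * z2)\<close>, so \<open>v (t - d)\<close>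
  may be replaced by the maximum; the backward bound with \<open>k = 0\<close> then propagates a
  positive maximum to the left down to \<open>l\<close>, where \<open>v\<close> is
  nonpositive.\<close>

lemma delayed_max_principle:
  fixes v v1 v2 :: "real \<Rightarrow> real"
  assumes cont: "continuous_on UNIV v" and "d \<ge> 0" "z1 < 0" "0 < z2" "l < r"
    and d1: "\<And>t. l < t \<Longrightarrow> t < r \<Longrightarrow> (v has_real_derivative v1 t) (at t)"
    and d2: "\<And>t. l < t \<Longrightarrow> t < r \<Longrightarrow> (v1 has_real_derivative v2 t) (at t)"
    and ineq: "\<And>t. l < t \<Longrightarrow> t < r \<Longrightarrow>
      v2 t - (z1 + z2) * v1 t + z1 * z2 * v t - z1 * z2 * v (t - d) \<ge> 0"
    and left: "\<And>t. t \<le> l \<Longrightarrow> v t \<le> 0" and right: "v r \<le> 0" and t: "t \<le> r"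
  shows "v t \<le> 0"
proof (rule ccontr)
  assume neg: "\<not> v t \<le> 0"
  then have "l < t" using left[of t] by linarith
  obtain t0 where t0: "t0 \<in> {l..r}" "\<And>s. s \<in> {l..r} \<Longrightarrow> v s \<le> v t0"
    using continuous_attains_sup[of "{l..r}" v] continuous_on_subset[OF cont] \<open>l < r\<close> by auto
  define X where "X = v t0"
  have "X > 0" using t0(2)[of t] neg t \<open>l < t\<close> unfolding X_def by auto
  then have "l < t0" "t0 < r"
    using t0(1) left[of l] right unfolding X_def by (auto simp: less_le)
  have le: "v s \<le> X" if "s \<le> r" for s
    using t0(2)[of s] left[of s] \<open>X > 0\<close> that unfolding X_def by (cases "s \<le> l") auto
  have v1: "v1 t0 = 0"
    using DERIV_local_max[OF d1[OF \<open>l < t0\<close> \<open>t0 < r\<close>], of "min (t0 - l) (r - t0)"] t0(2)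
      \<open>l < t0\<close> \<open>t0 < r\<close> by (auto simp: abs_less_iff)
  have b: "z1 * z2 < 0" using assms by (simp add: mult_neg_pos)
  have eqX: "v s = X" if s: "l < s" "s \<le> t0" for s
  proof -
    have "X - v s \<le> 0 / (- (z1 * z2)) * exp (- z1 * (t0 - s))"
    proof (rule backward_second_order_bound[where l = l and y = "\<lambda>s. X - v s" and
          ?y1.0 = "\<lambda>s. - v1 s" and ?y2.0 = "\<lambda>s. - v2 s"])
      fix r assume r: "l < r" "r \<le> t0"
      show "((\<lambda>s. X - v s) has_real_derivative - v1 r) (at r)"
        using r \<open>t0 < _\<close> by (auto intro!: derivative_eq_intros d1)
      show "((\<lambda>s. - v1 s) has_real_derivative - v2 r) (at r)"
        using r \<open>t0 < _\<close> by (auto intro!: derivative_eq_intros d2)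
      have "- (z1 * z2) * v (r - d) \<le> - (z1 * z2) * X"
        using b le[of "r - d"] \<open>d \<ge> 0\<close> r \<open>t0 < _\<close> by (intro mult_left_mono) auto
      then show "- v2 r - (z1 + z2) * - v1 r + z1 * z2 * (X - v r) \<le> 0"
        using ineq[of r] r \<open>t0 < _\<close> by (simp add: algebra_simps)
    qed (use assms v1 s in \<open>auto simp: X_def\<close>)
    then show ?thesis using le[of s] s \<open>t0 < r\<close> by simp
  qed
  have "(v \<longlongrightarrow> v l) (at_right l)"
    using cont by (simp add: continuous_on_eq_continuous_at isCont_def filterlim_at_split)
  moreover have "eventually (\<lambda>s. v s = X) (at_right l)"
    using eventually_at_right_real[OF \<open>l < t0\<close>] by eventually_elim (use eqX in auto)
  ultimately have "((\<lambda>_. X) \<longlongrightarrow> v l) (at_right l)"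
    by (rule Lim_transform_eventually)
  then have "v l = X" by (simp add: tendsto_const_iff)
  then show False using left[of l] \<open>X > 0\<close> by simp
qed

text \<open>Adding \<open>C / k * exp (k * t)\<close> makes \<open>E\<close> nondecreasing without
  changing its limit at minus infinity.\<close>

lemma exponential_lower_bound:
  fixes E E' :: "real \<Rightarrow> real"
  assumes der: "\<And>t. t \<le> T \<Longrightarrow> (E has_real_derivative E' t) (at t)"
    and ineq: "\<And>t. t \<le> T \<Longrightarrow> E' t \<ge> - C * exp (k * t)"
    and lim: "(E \<longlongrightarrow> e) at_bot" and "k > 0" "t \<le> T"
  shows "E t \<ge> e - C / k * exp (k * t)"
proof -
  define f where "f = (\<lambda>t. E t + C / k * exp (k * t))"
  have mono: "f s \<le> f t" if "s \<le> t" for s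
  proof (rule DERIV_mono_on[OF that])
    fix r assume r: "s \<le> r" "r \<le> t"
    show "(f has_real_derivative E' r + C * exp (k * r)) (at r)"
      unfolding f_def using r assms by (auto intro!: derivative_eq_intros der)
    show "E' r + C * exp (k * r) \<ge> 0" using ineq[of r] r assms by linarith
  qed
  have "((\<lambda>t. exp (k * t)) \<longlongrightarrow> 0) at_bot"
    using \<open>k > 0\<close> by real_asymp
  then have "(f \<longlongrightarrow> e + C / k * 0) at_bot"
    unfolding f_def by (intro tendsto_intros lim)
  then have "e + C / k * 0 \<le> f t"
    by (rule tendsto_upperbound) (use mono in \<open>auto simp: eventually_at_bot_linorder\<close>)
  then show ?thesis unfolding f_def by simp
qed

section \<open>Decay of profiles\<close>

text \<open>\<open>L\<close> is a Lipschitz constant of \<open>g\<close> itself, and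
  \<open>d\<close> stands for the product of speed and delay. The weak inequality
  \<open>cf'_l\<close> keeps the critical and the supercritical case together. \<open>M\<close> is
  normalised to be at least 1, so that \<open>ln M\<close> is nonnegative.\<close>

locale delayed_wave =
  fixes g :: "real \<Rightarrow> real" and p c d l M L \<alpha> \<delta> K :: real
  assumes p_gt_1: "p > 1" and c_pos: "c > 0" and d_nonneg: "d \<ge> 0"
    and g_0: "g 0 = 0" and g_nonneg: "\<And>x. x \<ge> 0 \<Longrightarrow> g x \<ge> 0"
    and g_le: "\<And>x. x \<ge> 0 \<Longrightarrow> g x \<le> M" and M_ge_1: "M \<ge> 1"
    and g_lipschitz: "\<And>x y. x \<ge> 0 \<Longrightarrow> y \<ge> 0 \<Longrightarrow> \<bar>g x - g y\<bar> \<le> L * \<bar>x - y\<bar>" and L_nonneg: "L \<ge> 0"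
    and g_sublinear: "\<And>x y. 0 \<le> x \<Longrightarrow> x \<le> y \<Longrightarrow> g y - g x \<le> p * (y - x)"
    and \<alpha>_pos: "\<alpha> > 0" and \<delta>_pos: "\<delta> > 0" and K_pos: "K > 0"
    and g_smooth: "\<And>x y. 0 \<le> x \<Longrightarrow> x < \<delta> \<Longrightarrow> 0 \<le> y \<Longrightarrow> y < \<delta> \<Longrightarrow>
      \<bar>g y - g x - p * (y - x)\<bar> \<le> K * \<bar>y - x\<bar> * (x powr \<alpha> + y powr \<alpha>)"
    and l_pos: "l > 0" and cf_l: "cf p d c l = 0" and cf'_l: "cf' p d c l \<le> 0"
    and cf_pos: "\<And>z. 0 \<le> z \<Longrightarrow> z < l \<Longrightarrow> cf p d c z > 0"
begin

text \<open>\<open>\<nu>\<close> and \<open>\<mu>\<close> are the characteristic exponents of the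
  local part w'' - c w' - w.\<close>

definition \<nu> where "\<nu> = (c + sqrt (c\<^sup>2 + 4)) / 2"
definition \<mu> where "\<mu> = (c - sqrt (c\<^sup>2 + 4)) / 2"

lemma \<mu>_\<nu>_sum: "\<mu> + \<nu> = c" and \<mu>_\<nu>_prod: "\<mu> * \<nu> = - 1"
  unfolding \<mu>_def \<nu>_def by (simp_all add: field_simps power2_eq_square[symmetric] flip: power2_eq_square)

lemma \<nu>_pos: "\<nu> > 0"
  unfolding \<nu>_def using c_pos by (simp add: add_pos_nonneg)

lemma \<mu>_neg: "\<mu> < 0"
  using \<mu>_\<nu>_prod \<nu>_pos by (metis less_minus_one_simps(1) mult_less_0_iff not_less_iff_gr_or_eq)

lemma quadratic_factor: "z\<^sup>2 - c * z - 1 = (z - \<mu>) * (z - \<nu>)"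
proof -
  have "(z - \<mu>) * (z - \<nu>) = z\<^sup>2 - (\<mu> + \<nu>) * z + \<mu> * \<nu>"
    by (simp add: algebra_simps power2_eq_square)
  then show ?thesis by (simp add: \<mu>_\<nu>_sum \<mu>_\<nu>_prod)
qed

lemma l_less_\<nu>: "l < \<nu>"
proof -
  have "l\<^sup>2 - c * l - 1 < 0"
    using cf_l p_gt_1 unfolding cf_def by (smt (verit) exp_gt_zero mult_pos_pos)
  then have "(l - \<mu>) * (l - \<nu>) < 0" by (simp add: quadratic_factor)
  moreover have "l - \<mu> > 0" using l_pos \<mu>_neg by simp
  ultimately show ?thesis by (simp add: mult_less_0_iff)
qed

text \<open>Continuity of \<open>\<phi>2\<close> is left to the equation, and for a positive
  function an upper bound amounts to boundedness.\<close>

definition profile where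
  "profile \<phi> \<phi>1 \<phi>2 \<longleftrightarrow> (\<forall>t. \<phi> t > 0) \<and> (\<exists>B. \<forall>t. \<phi> t \<le> B) \<and> (\<phi> \<longlongrightarrow> 0) at_bot \<and>
    (\<forall>t. (\<phi> has_real_derivative \<phi>1 t) (at t)) \<and> (\<forall>t. (\<phi>1 has_real_derivative \<phi>2 t) (at t)) \<and>
    (\<forall>t. \<phi>2 t - c * \<phi>1 t - \<phi> t + g (\<phi> (t - d)) = 0)"

text \<open>In terms of \<open>v(t) = w(t) e\<^sup>-\<^sup>\<gamma>\<^sup>t\<close> this is
  \<open>v' - (c - 2\<gamma>) v - q e\<^sup>-\<^sup>\<gamma>\<^sup>d \<integral> v\<close>, the integral being taken over a window of length \<open>d\<close>. It is a first
  integral, for \<open>cf q d c \<gamma> = 0\<close>, of the equation \<open>w'' - c w' - w + q w(t - d) = 0\<close>.\<close>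

definition E where
  "E \<gamma> q w w1 t = (w1 t - (c - \<gamma>) * w t) * exp (- (\<gamma> * t)) -
     q * exp (- (\<gamma> * d)) * integral {t - d..t} (\<lambda>s. w s * exp (- (\<gamma> * s)))"

lemma continuous_of_DERIV:
  fixes w :: "real \<Rightarrow> real"
  assumes "\<And>t. (w has_real_derivative w1 t) (at t)"
  shows "continuous_on UNIV w"
  using assms DERIV_isCont by (blast intro: continuous_at_imp_continuous_on)

lemma DERIV_E:
  assumes w: "\<And>t. (w has_real_derivative w1 t) (at t)" and "(w1 has_real_derivative w2) (at t)"
  shows "(E \<gamma> q w w1 has_real_derivative
    (w2 - c * w1 t - w t + q * w (t - d)) * exp (- (\<gamma> * t)) -
    cf q d c \<gamma> * (w t * exp (- (\<gamma> * t)))) (at t)"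
proof -
  have cont: "continuous_on UNIV (\<lambda>s. w s * exp (- (\<gamma> * s)))"
    by (intro continuous_intros continuous_of_DERIV[OF w])
  define W where "W = (\<lambda>t. integral {t - d..t} (\<lambda>s. w s * exp (- (\<gamma> * s))))"
  have W: "(W has_real_derivative w t * exp (- (\<gamma> * t)) - w (t - d) * exp (- (\<gamma> * (t - d)))) (at t)"
    unfolding W_def by (rule DERIV_window_integral[OF cont d_nonneg])
  have "E \<gamma> q w w1 = (\<lambda>t. (w1 t - (c - \<gamma>) * w t) * exp (- (\<gamma> * t)) - q * exp (- (\<gamma> * d)) * W t)"
    unfolding E_def W_def ..
  then have "(E \<gamma> q w w1 has_real_derivative
    ((w2 - (c - \<gamma>) * w1 t) * exp (- (\<gamma> * t)) + (w1 t - (c - \<gamma>) * w t) * (- \<gamma> * exp (- (\<gamma> * t)))) -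
     q * exp (- (\<gamma> * d)) * (w t * exp (- (\<gamma> * t)) - w (t - d) * exp (- (\<gamma> * (t - d))))) (at t)"
    by (auto intro!: derivative_eq_intros W assms)
  moreover define X Y Z where "X = exp (- (\<gamma> * d))" "Y = exp (- (\<gamma> * t))" "Z = exp (- (\<gamma> * (t - d)))"
  have "X * Z = Y"
    unfolding X_Y_Z_def by (simp add: exp_add[symmetric] algebra_simps)
  then have "(w2 - (c - \<gamma>) * w1 t) * Y + (w1 t - (c - \<gamma>) * w t) * (- \<gamma> * Y) -
      q * X * (w t * Y - w (t - d) * Z) =
    (w2 - c * w1 t - w t + q * w (t - d)) * Y - (\<gamma>\<^sup>2 - c * \<gamma> - 1 + q * X) * (w t * Y)"
    by (simp add: algebra_simps power2_eq_square)
  ultimately show ?thesis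
    unfolding cf_def X_Y_Z_def by simp
qed

text \<open>The condition on \<open>cf'\<close> says that a constant \<open>m \<ge> 0\<close> is a
  subsolution, so the weighted function minus \<open>m\<close> inherits its delay inequality from
  \<open>E \<ge> 0\<close>. This converts a sign of \<open>E\<close> into a lasting lower
  bound.\<close>

lemma E_persist:
  assumes w: "\<And>t. (w has_real_derivative w1 t) (at t)"
    and "q \<ge> 0" "cf' q d c \<gamma> \<le> 0" "m \<ge> 0"
    and window: "\<And>s. t0 - d \<le> s \<Longrightarrow> s \<le> t0 \<Longrightarrow> w s * exp (- (\<gamma> * s)) > m"
    and E: "\<And>t. t0 \<le> t \<Longrightarrow> t \<le> t1 \<Longrightarrow> (\<And>s. t0 - d \<le> s \<Longrightarrow> s \<le> t \<Longrightarrow> w s \<ge> 0) \<Longrightarrow> E \<gamma> q w w1 t \<ge> 0"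
    and t: "t0 \<le> t" "t \<le> t1"
  shows "w t * exp (- (\<gamma> * t)) > m"
proof -
  have cont: "continuous_on UNIV (\<lambda>s. w s * exp (- (\<gamma> * s)))"
    by (intro continuous_intros continuous_of_DERIV[OF w])
  have "0 < w t * exp (- (\<gamma> * t)) - m"
  proof (rule delay_inequality_positive[where d = d and b = "q * exp (- (\<gamma> * d))" and a = "c - 2 * \<gamma>"
      and z = "\<lambda>t. w t * exp (- (\<gamma> * t)) - m" and ?z' = "\<lambda>t. (w1 t - \<gamma> * w t) * exp (- (\<gamma> * t))"])
    show "continuous_on UNIV (\<lambda>t. w t * exp (- (\<gamma> * t)) - m)"
      by (intro continuous_intros cont)
    show "((\<lambda>t. w t * exp (- (\<gamma> * t)) - m) has_real_derivative (w1 s - \<gamma> * w s) * exp (- (\<gamma> * s))) (at s)" for s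
      by (auto intro!: derivative_eq_intros w simp: algebra_simps)
    fix s assume s: "t0 \<le> s" "s \<le> t1"
      and pos: "\<And>r. t0 - d \<le> r \<Longrightarrow> r \<le> s \<Longrightarrow> 0 \<le> w r * exp (- (\<gamma> * r)) - m"
    have "w r \<ge> 0" if "t0 - d \<le> r" "r \<le> s" for r
      using pos[OF that] \<open>m \<ge> 0\<close>
      by (smt (verit) exp_gt_zero mult_neg_pos)
    then have ge: "E \<gamma> q w w1 s \<ge> 0" using E s by blast
    have int: "integral {s - d..s} (\<lambda>t. w t * exp (- (\<gamma> * t)) - m) =
        integral {s - d..s} (\<lambda>t. w t * exp (- (\<gamma> * t))) - m * d"
      using d_nonneg by (subst integral_diff) (auto intro: window_integrable cont)
    have "m * (c - 2 * \<gamma> + q * exp (- (\<gamma> * d)) * d) \<ge> 0"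
      using assms unfolding cf'_def by (intro mult_nonneg_nonneg) (auto simp: algebra_simps)
    with ge show "(w1 s - \<gamma> * w s) * exp (- (\<gamma> * s)) \<ge> (c - 2 * \<gamma>) * (w s * exp (- (\<gamma> * s)) - m) +
        q * exp (- (\<gamma> * d)) * integral {s - d..s} (\<lambda>t. w t * exp (- (\<gamma> * t)) - m)"
      unfolding E_def int by (simp add: algebra_simps)
  qed (use assms d_nonneg window t in auto)
  then show ?thesis by simp
qed

lemma g_near_0_ge:
  assumes "\<xi> > 0"
  obtains \<rho> where "\<rho> > 0" "\<And>y. 0 \<le> y \<Longrightarrow> y \<le> \<rho> \<Longrightarrow> g y \<ge> (p - \<xi>) * y"
proof
  define \<rho> where "\<rho> = min (\<delta> / 2) ((\<xi> / K) powr (1 / \<alpha>))"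
  show "\<rho> > 0" unfolding \<rho>_def using \<delta>_pos K_pos assms by simp
  fix y assume y: "0 \<le> y" "y \<le> \<rho>"
  have "y powr \<alpha> \<le> ((\<xi> / K) powr (1 / \<alpha>)) powr \<alpha>"
    using y \<alpha>_pos unfolding \<rho>_def by (intro powr_mono2) auto
  also have "\<dots> = \<xi> / K" using assms K_pos \<alpha>_pos by (simp add: powr_powr)
  finally have "K * y * y powr \<alpha> \<le> K * y * (\<xi> / K)" using y K_pos by (intro mult_left_mono) auto
  moreover have "\<bar>g y - g 0 - p * (y - 0)\<bar> \<le> K * \<bar>y - 0\<bar> * (0 powr \<alpha> + y powr \<alpha>)"
    using y \<delta>_pos unfolding \<rho>_def by (intro g_smooth) auto
  ultimately show "g y \<ge> (p - \<xi>) * y"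
    using y g_0 K_pos by (simp add: algebra_simps abs_le_iff)
qed

lemma g_le_linear: "x \<ge> 0 \<Longrightarrow> g x \<le> p * x"
  using g_sublinear[of 0 x] g_0 by simp

context
  fixes \<phi> \<phi>1 \<phi>2 :: "real \<Rightarrow> real"
  assumes profile: "profile \<phi> \<phi>1 \<phi>2"
begin

lemma profile_pos: "\<phi> t > 0"
  and DERIV_profile: "(\<phi> has_real_derivative \<phi>1 t) (at t)"
  and DERIV_profile1: "(\<phi>1 has_real_derivative \<phi>2 t) (at t)"
  and profile_eq: "\<phi>2 t = c * \<phi>1 t + \<phi> t - g (\<phi> (t - d))"
  and profile_tendsto: "(\<phi> \<longlongrightarrow> 0) at_bot"
  using profile unfolding profile_def by (auto simp: algebra_simps)

lemma profile_small:
  assumes "\<rho> > 0"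
  obtains T where "T \<le> 0" "\<And>t. t \<le> T \<Longrightarrow> \<phi> t < \<rho>"
proof -
  have "eventually (\<lambda>t. \<phi> t < \<rho>) at_bot"
    using profile_tendsto assms by (rule order_tendstoD(2))
  then obtain T where "\<And>t. t \<le> T \<Longrightarrow> \<phi> t < \<rho>"
    unfolding eventually_at_bot_linorder by blast
  then show ?thesis by (intro that[of "min T 0"]) auto
qed

text \<open>A positive excess \<open>\<phi>' - \<nu> \<phi>\<close> would grow backwards in time and force \<open>\<phi>\<close> to become negative.\<close>

lemma profile_deriv_le: "\<phi>1 t \<le> \<nu> * \<phi> t"
proof (rule ccontr)
  assume neg: "\<not> \<phi>1 t \<le> \<nu> * \<phi> t"
  define u where "u = (\<lambda>s. \<phi>1 s - \<nu> * \<phi> s)"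
  have ut: "u t > 0" using neg unfolding u_def by simp
  have u: "u s \<ge> u t" if "s \<le> t" for s
  proof -
    have "- (u s * exp (- (\<mu> * s))) \<le> - (u t * exp (- (\<mu> * t)))"
    proof (rule DERIV_mono_on[OF that])
      fix r
      have "\<phi>2 r - \<nu> * \<phi>1 r - \<mu> * (\<phi>1 r - \<nu> * \<phi> r) = (c - (\<mu> + \<nu>)) * \<phi>1 r + (1 + \<mu> * \<nu>) * \<phi> r - g (\<phi> (r - d))"
        unfolding profile_eq by (simp add: algebra_simps)
      then have "\<phi>2 r - \<nu> * \<phi>1 r - \<mu> * (\<phi>1 r - \<nu> * \<phi> r) = - g (\<phi> (r - d))"
        by (simp add: \<mu>_\<nu>_sum \<mu>_\<nu>_prod)
      moreover have "((\<lambda>s. - (u s * exp (- (\<mu> * s)))) has_real_derivative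
          - (\<phi>2 r - \<nu> * \<phi>1 r - \<mu> * (\<phi>1 r - \<nu> * \<phi> r)) * exp (- (\<mu> * r))) (at r)"
        unfolding u_def
        by (auto intro!: derivative_eq_intros DERIV_profile DERIV_profile1 simp: algebra_simps)
      ultimately show "((\<lambda>s. - (u s * exp (- (\<mu> * s)))) has_real_derivative
          g (\<phi> (r - d)) * exp (- (\<mu> * r))) (at r)" by simp
      show "g (\<phi> (r - d)) * exp (- (\<mu> * r)) \<ge> 0"
        using g_nonneg profile_pos by (simp add: less_imp_le)
    qed
    then have "u t * exp (- (\<mu> * t)) * exp (\<mu> * s) \<le> u s * exp (- (\<mu> * s)) * exp (\<mu> * s)"
      by (intro mult_right_mono) auto
    then have "u t * exp (\<mu> * (s - t)) \<le> u s"
      by (simp add: mult.assoc exp_add[symmetric] algebra_simps)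
    moreover have "exp (\<mu> * (s - t)) \<ge> 1"
      using that \<mu>_neg by (simp add: mult_nonpos_nonpos)
    then have "u t * 1 \<le> u t * exp (\<mu> * (s - t))"
      using ut by (intro mult_left_mono) auto
    ultimately show ?thesis by simp
  qed
  \<comment> \<open>Going backwards, the slope of \<open>\<phi>\<close> stays at least
    \<open>u t\<close>, so a step of this length brings \<open>\<phi>\<close> down to 0.\<close>
  define N where "N = \<phi> t / u t"
  have "N > 0" unfolding N_def using ut profile_pos by simp
  have "\<phi> (t - N) - u t * (t - N) \<le> \<phi> t - u t * t"
  proof (rule DERIV_mono_on[where f = "\<lambda>s. \<phi> s - u t * s"])
    fix r assume r: "t - N \<le> r" "r \<le> t"
    show "((\<lambda>s. \<phi> s - u t * s) has_real_derivative \<phi>1 r - u t) (at r)"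
      by (auto intro!: derivative_eq_intros DERIV_profile)
    have "\<nu> * \<phi> r \<ge> 0" using \<nu>_pos profile_pos[of r] by (simp add: less_imp_le)
    then show "\<phi>1 r - u t \<ge> 0" using u[of r] r unfolding u_def by simp
  qed (use \<open>N > 0\<close> in simp)
  moreover have "u t * N = \<phi> t" using ut unfolding N_def by simp
  ultimately have "\<phi> (t - N) \<le> 0" by (simp add: algebra_simps)
  then show False using profile_pos[of "t - N"] by simp
qed

text \<open>By \<open>profile_deriv_le\<close> the product of \<open>\<phi>\<close> and
  \<open>exp (- (\<nu> * t))\<close> is nonincreasing. Profiles need not be monotone; this is what
  bounds them below on a whole window by the value at its right end.\<close>

lemma profile_harnack:
  assumes "s \<le> t"
  shows "\<phi> t \<le> exp (\<nu> * (t - s)) * \<phi> s"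
proof -
  have "- (\<phi> s * exp (- (\<nu> * s))) \<le> - (\<phi> t * exp (- (\<nu> * t)))"
  proof (rule DERIV_mono_on[OF assms])
    fix r
    show "((\<lambda>s. - (\<phi> s * exp (- (\<nu> * s)))) has_real_derivative
        (\<nu> * \<phi> r - \<phi>1 r) * exp (- (\<nu> * r))) (at r)"
      by (auto intro!: derivative_eq_intros DERIV_profile simp: algebra_simps)
    show "(\<nu> * \<phi> r - \<phi>1 r) * exp (- (\<nu> * r)) \<ge> 0"
      using profile_deriv_le[of r] by simp
  qed
  then have "\<phi> t * exp (- (\<nu> * t)) * exp (\<nu> * t) \<le> \<phi> s * exp (- (\<nu> * s)) * exp (\<nu> * t)"
    by (intro mult_right_mono) auto
  then show ?thesis by (simp add: mult.assoc exp_add[symmetric] algebra_simps)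
qed

lemma profile_window_lower:
  assumes "\<gamma> \<ge> 0" "t - r \<le> s" "s \<le> t"
  shows "exp (- (\<nu> * r)) * (\<phi> t * exp (- (\<gamma> * t))) \<le> \<phi> s * exp (- (\<gamma> * s))"
proof -
  have "exp (\<nu> * (t - s)) \<le> exp (\<nu> * r)" using assms \<nu>_pos by simp
  then have "\<phi> t \<le> exp (\<nu> * r) * \<phi> s"
    using profile_harnack[OF assms(3)] profile_pos[of s]
    by (meson less_imp_le mult_right_mono order_trans)
  then have "exp (- (\<nu> * r)) * \<phi> t \<le> exp (- (\<nu> * r)) * (exp (\<nu> * r) * \<phi> s)"
    by (intro mult_left_mono) auto
  then have "exp (- (\<nu> * r)) * \<phi> t \<le> \<phi> s"
    by (simp add: mult.assoc[symmetric] exp_add[symmetric])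
  moreover have "exp (- (\<gamma> * t)) \<le> exp (- (\<gamma> * s))" using assms by (simp add: mult_left_mono)
  ultimately have "exp (- (\<nu> * r)) * \<phi> t * exp (- (\<gamma> * t)) \<le> \<phi> s * exp (- (\<gamma> * s))"
    using profile_pos[of s] by (intro mult_mono) auto
  then show ?thesis by (simp add: mult.assoc)
qed

text \<open>For a slightly smaller slope \<open>q < p\<close> the functional \<open>E\<close> decreases near \<open>-\<infinity>\<close>. Either it is
  nonnegative far to the left, and then \<open>\<phi>(t) e\<^sup>-\<^sup>\<gamma>\<^sup>t\<close> cannot decrease much from there on, or it is
  bounded, and then \<open>\<phi>(t) e\<^sup>-\<^sup>\<gamma>\<^sup>t\<close> is integrable.\<close>

lemma profile_decay:
  assumes \<gamma>: "0 < \<gamma>" "\<gamma> < l"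
  obtains C T where "C > 0" "T \<le> 0" "\<And>t. t \<le> T \<Longrightarrow> \<phi> t \<le> C * exp (\<gamma> * t)"
proof -
  have cf: "cf p d c \<gamma> > 0" using cf_pos \<gamma> by simp
  have cf': "cf' p d c \<gamma> < 0"
    using cf'_strict_mono[of p d \<gamma> l c] p_gt_1 d_nonneg \<gamma> cf'_l by simp
  \<comment> \<open>\<open>\<xi>\<close> has to be so small that the slope \<open>p - \<xi>\<close>
    preserves the signs of \<open>cf\<close> and \<open>cf'\<close> at \<open>\<gamma>\<close>.
    Dividing by \<open>d + 1\<close> instead of \<open>d\<close> covers
    \<open>d = 0\<close>.\<close>
  have "- cf' p d c \<gamma> / (d + 1) > 0" using cf' d_nonneg by (intro divide_pos_pos) auto
  then obtain \<xi> where \<xi>: "\<xi> > 0" "\<xi> \<le> p / 2" "\<xi> \<le> cf p d c \<gamma> / 2" "\<xi> \<le> - cf' p d c \<gamma> / (d + 1)"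
    using p_gt_1 cf
      that[of "min (p / 2) (min (cf p d c \<gamma> / 2) (- cf' p d c \<gamma> / (d + 1)))"]
    by (simp only: min_less_iff_conj min.cobounded1 min.cobounded2 min.coboundedI2) auto
  define q where "q = p - \<xi>"
  have q: "q \<ge> 0" unfolding q_def using \<xi> p_gt_1 by simp
  have e1: "exp (- (\<gamma> * d)) \<le> 1" using \<gamma> d_nonneg by simp
  have "\<xi> * exp (- (\<gamma> * d)) \<le> \<xi>" using e1 \<xi> by (simp add: mult_left_le)
  moreover have "cf q d c \<gamma> = cf p d c \<gamma> - \<xi> * exp (- (\<gamma> * d))"
    unfolding q_def cf_def by (simp add: algebra_simps)
  ultimately have cfq: "cf q d c \<gamma> > 0" using \<xi>(3) cf by linarith
  have "\<xi> * (d * exp (- (\<gamma> * d))) \<le> \<xi> * ((d + 1) * 1)"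
    using e1 \<xi> d_nonneg by (intro mult_left_mono mult_mono) auto
  also have "\<dots> \<le> - cf' p d c \<gamma>"
    using \<xi>(4) d_nonneg by (simp add: field_simps)
  finally have cfq': "cf' q d c \<gamma> \<le> 0"
    unfolding q_def cf'_def by (simp add: algebra_simps)
  obtain \<rho> where \<rho>: "\<rho> > 0" "\<And>y. 0 \<le> y \<Longrightarrow> y \<le> \<rho> \<Longrightarrow> g y \<ge> q * y"
    using g_near_0_ge[OF \<xi>(1)] unfolding q_def by blast
  obtain T where T: "T \<le> 0" "\<And>t. t \<le> T \<Longrightarrow> \<phi> t < \<rho>"
    using profile_small[OF \<rho>(1)] by blast
  define v where "v = (\<lambda>t. \<phi> t * exp (- (\<gamma> * t)))"
  define F where "F = E \<gamma> q \<phi> \<phi>1"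
  define F' where "F' = (\<lambda>t. (q * \<phi> (t - d) - g (\<phi> (t - d))) * exp (- (\<gamma> * t)) - cf q d c \<gamma> * v t)"
  have v_pos: "v t > 0" for t unfolding v_def using profile_pos by simp
  have F: "(F has_real_derivative F' t) (at t)" for t
    unfolding F_def F'_def v_def
    using DERIV_E[OF DERIV_profile DERIV_profile1, of \<gamma> q t] by (simp add: profile_eq)
  have F'_le: "F' t \<le> - (cf q d c \<gamma> * v t)" if "t \<le> T" for t
  proof -
    have "q * \<phi> (t - d) - g (\<phi> (t - d)) \<le> 0"
      using \<rho>(2)[of "\<phi> (t - d)"] T(2)[of "t - d"] profile_pos[of "t - d"] that d_nonneg by auto
    then show ?thesis unfolding F'_def by (simp add: mult_nonpos_nonneg)
  qed
  have F_anti: "F t \<le> F s" if "s \<le> t" "t \<le> T" for s t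
  proof -
    have "- F s \<le> - F t"
    proof (rule DERIV_mono_on[OF that(1)])
      fix r assume "s \<le> r" "r \<le> t"
      show "((\<lambda>t. - F t) has_real_derivative - F' r) (at r)" by (intro derivative_intros F)
      have "cf q d c \<gamma> * v r \<ge> 0" using cfq v_pos[of r] by simp
      then show "- F' r \<ge> 0" using F'_le[of r] \<open>r \<le> t\<close> that by simp
    qed
    then show ?thesis by simp
  qed
  have "\<exists>C>0. \<exists>T1\<le>0. \<forall>t\<le>T1. v t \<le> C"
  proof (cases "\<exists>t1\<le>T. F t1 \<ge> 0")
    case True
    then obtain t1 where t1: "t1 \<le> T" "F t1 \<ge> 0" by blast
    \<comment> \<open>Persistence from an arbitrary \<open>t0\<close> up to the fixed
      \<open>t1\<close>, read backwards: the value at \<open>t1\<close> bounds all earlier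
      ones.\<close>
    have "v t0 \<le> 2 * exp (\<nu> * d) * v t1" if "t0 \<le> t1" for t0
    proof -
      define m where "m = exp (- (\<nu> * d)) * v t0 / 2"
      have "m > 0" unfolding m_def using v_pos by simp
      have "\<phi> t1 * exp (- (\<gamma> * t1)) > m"
      proof (rule E_persist[OF DERIV_profile q cfq', where ?t0.0 = t0 and ?t1.0 = t1])
        fix s assume "t0 - d \<le> s" "s \<le> t0"
        then have "exp (- (\<nu> * d)) * v t0 \<le> \<phi> s * exp (- (\<gamma> * s))"
          unfolding v_def using \<gamma> by (intro profile_window_lower) auto
        then show "m < \<phi> s * exp (- (\<gamma> * s))" using \<open>m > 0\<close> unfolding m_def by simp
      next
        fix t assume "t0 \<le> t" "t \<le> t1"
        then show "E \<gamma> q \<phi> \<phi>1 t \<ge> 0" using F_anti[of t t1] t1 unfolding F_def by simp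
      qed (use \<open>m > 0\<close> that in auto)
      then have "exp (- (\<nu> * d)) * v t0 \<le> 2 * v t1" unfolding m_def v_def by simp
      then have "exp (\<nu> * d) * (exp (- (\<nu> * d)) * v t0) \<le> exp (\<nu> * d) * (2 * v t1)"
        by (intro mult_left_mono) auto
      moreover have "exp (\<nu> * d) * (exp (- (\<nu> * d)) * v t0) = v t0"
        by (simp add: mult.assoc[symmetric] exp_add[symmetric])
      ultimately show ?thesis by linarith
    qed
    then show ?thesis
      using v_pos[of t1] t1 T(1)
      by (intro exI[of _ "2 * exp (\<nu> * d) * v t1"] conjI exI[of _ t1]) auto
  next
    case False
    \<comment> \<open>On a unit interval \<open>F\<close> drops by at most \<open>- F T\<close>. The
      drop is at least a multiple of \<open>v\<close> at an intermediate point, which dominates a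
      multiple of \<open>v t\<close> by \<open>profile_window_lower\<close>.\<close>
    have "v t \<le> - F T / (cf q d c \<gamma> * exp (- \<nu>))" if "t \<le> T" for t
    proof -
      obtain \<tau> where \<tau>: "t - 1 < \<tau>" "\<tau> < t" "F t - F (t - 1) = (t - (t - 1)) * F' \<tau>"
        using MVT2[of "t - 1" t F F'] F by auto
      have "exp (- \<nu>) * v t \<le> v \<tau>"
        using profile_window_lower[of \<gamma> t 1 \<tau>] \<tau> \<gamma> unfolding v_def by simp
      then have "cf q d c \<gamma> * (exp (- \<nu>) * v t) \<le> cf q d c \<gamma> * v \<tau>"
        using cfq by (intro mult_left_mono) auto
      also have "\<dots> \<le> - F' \<tau>" using F'_le[of \<tau>] \<tau> that by simp
      also have "\<dots> = F (t - 1) - F t" using \<tau>(3) by simp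
      also have "\<dots> \<le> - F T"
        using False F_anti[of t T] that by (smt (verit))
      finally show ?thesis using cfq by (simp add: field_simps)
    qed
    moreover have "- F T / (cf q d c \<gamma> * exp (- \<nu>)) > 0"
      using False cfq by (smt (verit) divide_pos_pos exp_gt_zero mult_pos_pos)
    ultimately show ?thesis using T(1) by blast
  qed
  then obtain C T1 where C: "C > 0" "T1 \<le> 0" "\<And>t. t \<le> T1 \<Longrightarrow> v t \<le> C" by blast
  show ?thesis
  proof (rule that[OF C(1,2)])
    fix t assume "t \<le> T1"
    then have "v t * exp (\<gamma> * t) \<le> C * exp (\<gamma> * t)" using C by (intro mult_right_mono) auto
    then show "\<phi> t \<le> C * exp (\<gamma> * t)"
      unfolding v_def by (simp add: mult.assoc exp_add[symmetric])
  qed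
qed

lemma DERIV_E_profile:
  "(E l p \<phi> \<phi>1 has_real_derivative (p * \<phi> (t - d) - g (\<phi> (t - d))) * exp (- (l * t))) (at t)"
  using DERIV_E[OF DERIV_profile DERIV_profile1, of l p t] by (simp add: profile_eq cf_l)

lemma E_profile_mono: "s \<le> t \<Longrightarrow> E l p \<phi> \<phi>1 s \<le> E l p \<phi> \<phi>1 t"
  by (rule DERIV_mono_on[OF _ DERIV_E_profile])
    (use g_le_linear profile_pos in \<open>auto intro!: mult_nonneg_nonneg simp: less_imp_le\<close>)

text \<open>\<open>E\<close> is monotone along a profile, so for the limit only a lower bound is at
  stake. The derivative is a defect of order \<open>1 + \<alpha>\<close> in \<open>\<phi>\<close>,
  and it is integrable at minus infinity against \<open>exp (- (l * t))\<close> once the decay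
  exponent is close enough to \<open>l\<close>.\<close>

lemma E_profile_limit:
  obtains e where "(E l p \<phi> \<phi>1 \<longlongrightarrow> e) at_bot" "e < 0"
proof -
  define F where "F = E l p \<phi> \<phi>1"
  \<comment> \<open>Chosen so that \<open>\<gamma> < l\<close> while
    \<open>(1 + \<alpha>) * \<gamma>\<close> exceeds \<open>l\<close> by
    \<open>l * \<alpha> / 2\<close>.\<close>
  define \<gamma> where "\<gamma> = l * (1 + \<alpha> / 2) / (1 + \<alpha>)"
  define \<eta> where "\<eta> = l * \<alpha> / 2"
  have \<eta>: "\<eta> > 0" "(1 + \<alpha>) * \<gamma> - l = \<eta>"
    unfolding \<gamma>_def \<eta>_def using l_pos \<alpha>_pos by (auto simp: field_simps)
  have \<gamma>: "0 < \<gamma>" "\<gamma> < l"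
    unfolding \<gamma>_def using l_pos \<alpha>_pos by (auto simp: field_simps add_pos_pos)
  obtain C T1 where C: "C > 0" "T1 \<le> 0" "\<And>t. t \<le> T1 \<Longrightarrow> \<phi> t \<le> C * exp (\<gamma> * t)"
    using profile_decay[OF \<gamma>] by blast
  obtain T2 where T2: "\<And>t. t \<le> T2 \<Longrightarrow> \<phi> t < \<delta>" using profile_small[OF \<delta>_pos] by blast
  define T where "T = min T1 T2"
  define D where "D = K * C powr (1 + \<alpha>)"
  have F'_le: "(p * \<phi> (t - d) - g (\<phi> (t - d))) * exp (- (l * t)) \<le> D * exp (\<eta> * t)" if "t \<le> T" for t
  proof -
    define y where "y = \<phi> (t - d)"
    have y: "0 < y" "y < \<delta>" "y \<le> C * exp (\<gamma> * (t - d))"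
      using profile_pos T2[of "t - d"] C(3)[of "t - d"] that d_nonneg unfolding y_def T_def by auto
    have "C * exp (\<gamma> * (t - d)) \<le> C * exp (\<gamma> * t)"
      using C(1) \<gamma> d_nonneg by (simp add: mult_left_mono)
    then have "y \<le> C * exp (\<gamma> * t)" using y by simp
    then have "y powr (1 + \<alpha>) \<le> (C * exp (\<gamma> * t)) powr (1 + \<alpha>)"
      using y \<alpha>_pos by (intro powr_mono2) auto
    also have "\<dots> = C powr (1 + \<alpha>) * exp ((1 + \<alpha>) * \<gamma> * t)"
      using C(1) by (simp add: powr_def ln_mult exp_add[symmetric] algebra_simps)
    finally have "K * y powr (1 + \<alpha>) \<le> D * exp ((1 + \<alpha>) * \<gamma> * t)"
      using K_pos unfolding D_def by (simp add: mult.assoc)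
    moreover have "\<bar>g y - g 0 - p * (y - 0)\<bar> \<le> K * \<bar>y - 0\<bar> * (0 powr \<alpha> + y powr \<alpha>)"
      using y \<delta>_pos by (intro g_smooth) auto
    then have "p * y - g y \<le> K * y powr (1 + \<alpha>)"
      using y g_0 by (simp add: powr_add abs_le_iff algebra_simps)
    ultimately have "(p * y - g y) * exp (- (l * t)) \<le> D * exp ((1 + \<alpha>) * \<gamma> * t) * exp (- (l * t))"
      by (intro mult_right_mono) auto
    also have "\<dots> = D * exp (((1 + \<alpha>) * \<gamma> - l) * t)"
      by (simp add: mult.assoc exp_add[symmetric] algebra_simps)
    finally show ?thesis unfolding y_def \<eta>(2) .
  qed
  have "F t \<ge> F T - D / \<eta> * exp (\<eta> * T)" for t
  proof (cases "t \<le> T")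
    case True
    have "D / \<eta> * exp (\<eta> * t) - F t \<le> D / \<eta> * exp (\<eta> * T) - F T"
    proof (rule DERIV_mono_on[OF True])
      fix r assume r: "t \<le> r" "r \<le> T"
      show "((\<lambda>t. D / \<eta> * exp (\<eta> * t) - F t) has_real_derivative D * exp (\<eta> * r) -
          (p * \<phi> (r - d) - g (\<phi> (r - d))) * exp (- (l * r))) (at r)"
        unfolding F_def using \<eta>(1) by (auto intro!: derivative_eq_intros DERIV_E_profile)
      show "D * exp (\<eta> * r) - (p * \<phi> (r - d) - g (\<phi> (r - d))) * exp (- (l * r)) \<ge> 0"
        using F'_le[OF r(2)] by simp
    qed
    moreover have "D / \<eta> * exp (\<eta> * t) \<ge> 0" unfolding D_def using \<eta> K_pos by simp
    ultimately show ?thesis by simp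
  next
    case False
    have "D / \<eta> * exp (\<eta> * T) \<ge> 0" unfolding D_def using \<eta> K_pos by simp
    moreover have "F T \<le> F t" unfolding F_def using False by (intro E_profile_mono) simp
    ultimately show ?thesis by simp
  qed
  then have bdd: "bdd_below (range F)" by (intro bdd_belowI) auto
  define e where "e = Inf (range F)"
  have e_le: "e \<le> F t" for t unfolding e_def using bdd by (simp add: cInf_lower)
  have lim: "(F \<longlongrightarrow> e) at_bot"
  proof (rule decreasing_tendsto)
    fix x assume "e < x"
    then obtain t where t: "F t < x"
      using bdd cInf_less_iff[of "range F" x] unfolding e_def by auto
    have "F s < x" if "s \<le> t" for s
      using E_profile_mono[OF that] t unfolding F_def by simp
    then show "eventually (\<lambda>t. F t < x) at_bot" unfolding eventually_at_bot_linorder by blast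
  qed (use e_le in simp)
  have "e < 0"
  proof (rule ccontr)
    assume "\<not> e < 0"
    then have F_nonneg: "F t \<ge> 0" for t using e_le[of t] by simp
    \<comment> \<open>A nonnegative limit makes \<open>E\<close> nonnegative everywhere, and
      persistence makes \<open>\<phi>\<close> grow like \<open>exp (l * t)\<close>. Halving the
      bound from \<open>profile_window_lower\<close> yields the strict inequality required on the
      initial window.\<close>
    define m where "m = exp (- (\<nu> * d)) * \<phi> 0 / 2"
    have "m > 0" unfolding m_def using profile_pos by simp
    have "\<phi> t * exp (- (l * t)) > m" if "t \<ge> 0" for t
    proof (rule E_persist[OF DERIV_profile _ cf'_l, where ?t0.0 = 0 and ?t1.0 = t])
      fix s :: real assume "0 - d \<le> s" "s \<le> 0"
      then have "exp (- (\<nu> * d)) * (\<phi> 0 * exp (- (l * 0))) \<le> \<phi> s * exp (- (l * s))"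
        using l_pos by (intro profile_window_lower) auto
      then show "m < \<phi> s * exp (- (l * s))" using \<open>m > 0\<close> unfolding m_def by simp
    qed (use \<open>m > 0\<close> p_gt_1 that F_nonneg in \<open>auto simp: F_def\<close>)
    moreover obtain B where B: "\<And>t. \<phi> t \<le> B" using profile unfolding profile_def by blast
    ultimately have ge: "B * exp (- (l * t)) \<ge> m" if "t \<ge> 0" for t
      using that by (smt (verit) exp_ge_zero mult_right_mono)
    have "((\<lambda>t. B * exp (- (l * t))) \<longlongrightarrow> B * 0) at_top"
      using l_pos by (intro tendsto_mult tendsto_const) real_asymp
    then have "m \<le> B * 0"
      by (rule tendsto_lowerbound) (use ge in \<open>auto simp: eventually_at_top_linorder\<close>)
    then show False using \<open>m > 0\<close> by simp
  qed
  then show ?thesis using lim that unfolding F_def by blast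
qed

end

end

section \<open>Uniqueness\<close>

lemma attains_sup_at_bot:
  fixes f :: "real \<Rightarrow> real"
  assumes cont: "continuous_on UNIV f" and lim: "(f \<longlongrightarrow> 0) at_bot" and "s \<le> T" "f s > 0"
  obtains t where "t \<le> T" "\<And>r. r \<le> T \<Longrightarrow> f r \<le> f t"
proof -
  have "eventually (\<lambda>t. f t < f s) at_bot" using order_tendstoD(2)[OF lim \<open>f s > 0\<close>] .
  then obtain S where S: "\<And>t. t \<le> S \<Longrightarrow> f t < f s" unfolding eventually_at_bot_linorder by blast
  have "S < s" using S[of s] by force
  then have "{S..T} \<noteq> {}" using \<open>s \<le> T\<close> by simp
  then obtain t where t: "t \<in> {S..T}" "\<And>r. r \<in> {S..T} \<Longrightarrow> f r \<le> f t"
    using continuous_attains_sup[of "{S..T}" f] continuous_on_subset[OF cont] by auto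
  show ?thesis
  proof (rule that[of t])
    fix r assume "r \<le> T"
    then show "f r \<le> f t"
      using t(2)[of r] t(2)[of s] S[of r] \<open>S < s\<close> \<open>s \<le> T\<close> by (cases "r \<le> S") auto
  qed (use t in simp)
qed

context delayed_wave
begin

lemma E_diff:
  assumes "\<And>t. (w has_real_derivative w1 t) (at t)" "\<And>t. (u has_real_derivative u1 t) (at t)"
  shows "E \<gamma> q (\<lambda>t. w t - u t) (\<lambda>t. w1 t - u1 t) t = E \<gamma> q w w1 t - E \<gamma> q u u1 t"
proof -
  have "(\<lambda>s. f s * exp (- (\<gamma> * s))) integrable_on {t - d..t}"
    if "\<And>t. (f has_real_derivative f1 t) (at t)" for f f1
    by (intro window_integrable continuous_intros continuous_of_DERIV[OF that])
  then have "integral {t - d..t} (\<lambda>s. w s * exp (- (\<gamma> * s)) - u s * exp (- (\<gamma> * s))) =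
      integral {t - d..t} (\<lambda>s. w s * exp (- (\<gamma> * s))) - integral {t - d..t} (\<lambda>s. u s * exp (- (\<gamma> * s)))"
    using assms by (intro integral_diff) blast+
  then show ?thesis unfolding E_def by (simp add: left_diff_distrib right_diff_distrib)
qed

text \<open>The factor \<open>exp (\<gamma> * \<tau>)\<close> takes every positive value, so any two
  negative limits of \<open>E\<close> at minus infinity can be matched by a translation.\<close>

lemma E_shift:
  assumes w: "\<And>t. (w has_real_derivative w1 t) (at t)"
  shows "E \<gamma> q (\<lambda>t. w (t + \<tau>)) (\<lambda>t. w1 (t + \<tau>)) t = exp (\<gamma> * \<tau>) * E \<gamma> q w w1 (t + \<tau>)"
proof -
  have e: "exp (\<gamma> * \<tau>) * exp (- (\<gamma> * (s + \<tau>))) = exp (- (\<gamma> * s))" for s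
    by (simp add: exp_add[symmetric] algebra_simps)
  have "continuous_on UNIV (\<lambda>s. w s * exp (- (\<gamma> * s)))"
    by (intro continuous_intros continuous_of_DERIV[OF w])
  then obtain V where V: "\<And>t. (V has_real_derivative w t * exp (- (\<gamma> * t))) (at t)"
    using antiderivative_exists by blast
  have "((\<lambda>t. exp (\<gamma> * \<tau>) * V (t + \<tau>)) has_real_derivative w (t + \<tau>) * exp (- (\<gamma> * t))) (at t)" for t
  proof -
    have "((\<lambda>t. V (t + \<tau>)) has_real_derivative w (t + \<tau>) * exp (- (\<gamma> * (t + \<tau>)))) (at t)"
      using V[of "t + \<tau>"] DERIV_shift by blast
    from DERIV_cmult[OF this, of "exp (\<gamma> * \<tau>)"] show ?thesis
      using e[of t] by (metis mult.left_commute)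
  qed
  from window_integral_eq[OF this d_nonneg]
  have "integral {t - d..t} (\<lambda>s. w (s + \<tau>) * exp (- (\<gamma> * s))) =
      exp (\<gamma> * \<tau>) * (V (t + \<tau>) - V (t + \<tau> - d))"
    by (simp add: right_diff_distrib diff_add_eq)
  also have "\<dots> = exp (\<gamma> * \<tau>) * integral {t + \<tau> - d..t + \<tau>} (\<lambda>s. w s * exp (- (\<gamma> * s)))"
    using window_integral_eq[OF V d_nonneg, of "t + \<tau>"] by simp
  finally show ?thesis
    unfolding E_def e[of t, symmetric] by (simp add: algebra_simps)
qed

lemma profile_shift:
  assumes "profile \<phi> \<phi>1 \<phi>2"
  shows "profile (\<lambda>t. \<phi> (t + \<tau>)) (\<lambda>t. \<phi>1 (t + \<tau>)) (\<lambda>t. \<phi>2 (t + \<tau>))"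
proof -
  have "filterlim (\<lambda>t::real. t + \<tau>) at_bot at_bot" by real_asymp
  then have "((\<lambda>t. \<phi> (t + \<tau>)) \<longlongrightarrow> 0) at_bot"
    by (rule filterlim_compose[rotated]) (use assms in \<open>simp add: profile_def\<close>)
  moreover have "\<phi>2 (t + \<tau>) - c * \<phi>1 (t + \<tau>) - \<phi> (t + \<tau>) + g (\<phi> (t - d + \<tau>)) = 0" for t
    using assms unfolding profile_def by (metis diff_add_eq)
  moreover have "((\<lambda>t. \<phi> (t + \<tau>)) has_real_derivative \<phi>1 (t + \<tau>)) (at t)"
    "((\<lambda>t. \<phi>1 (t + \<tau>)) has_real_derivative \<phi>2 (t + \<tau>)) (at t)" for t
    using assms unfolding profile_def by (simp_all add: DERIV_shift[symmetric])
  moreover have "\<exists>B. \<forall>t. \<phi> (t + \<tau>) \<le> B"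
    using assms unfolding profile_def by blast
  ultimately show ?thesis
    using assms unfolding profile_def by blast
qed

abbreviation Ed where
  "Ed \<phi> \<phi>1 \<psi> \<psi>1 \<equiv> E l p (\<lambda>t. \<phi> t - \<psi> t) (\<lambda>t. \<phi>1 t - \<psi>1 t)"

text \<open>Sublinearity makes \<open>E\<close> of the difference nondecreasing only as long as the
  profiles are ordered, which is known up to \<open>T\<close>. The order continues because
  \<open>E_persist\<close> asks for \<open>E \<ge> 0\<close> only while the difference has stayed
  nonnegative. The difference then grows like \<open>exp (l * t)\<close>, against
  boundedness.\<close>

lemma profile_ordered_absurd:
  assumes \<phi>: "profile \<phi> \<phi>1 \<phi>2" and \<psi>: "profile \<psi> \<psi>1 \<psi>2"
    and lim: "(Ed \<phi> \<phi>1 \<psi> \<psi>1 \<longlongrightarrow> 0) at_bot"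
    and less: "\<And>t. t \<le> T \<Longrightarrow> \<psi> t < \<phi> t"
  shows False
proof -
  define w w1 where "w = (\<lambda>t. \<phi> t - \<psi> t)" "w1 = (\<lambda>t. \<phi>1 t - \<psi>1 t)"
  have w: "(w has_real_derivative w1 t) (at t)" for t
    unfolding w_w1_def by (intro derivative_intros DERIV_profile[OF \<phi>] DERIV_profile[OF \<psi>])
  have w1: "(w1 has_real_derivative \<phi>2 t - \<psi>2 t) (at t)" for t
    unfolding w_w1_def by (intro derivative_intros DERIV_profile1[OF \<phi>] DERIV_profile1[OF \<psi>])
  have E': "(E l p w w1 has_real_derivative
      (p * w (t - d) - (g (\<phi> (t - d)) - g (\<psi> (t - d)))) * exp (- (l * t))) (at t)" for t
    using DERIV_E[OF w w1, of l p t]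
    by (simp add: cf_l profile_eq[OF \<phi>] profile_eq[OF \<psi>] w_w1_def algebra_simps)
  have cont: "continuous_on UNIV (\<lambda>s. w s * exp (- (l * s)))"
    by (intro continuous_intros continuous_of_DERIV[OF w])
  obtain s0 where s0: "s0 \<in> {T - d..T}"
    "\<And>s. s \<in> {T - d..T} \<Longrightarrow> w s0 * exp (- (l * s0)) \<le> w s * exp (- (l * s))"
    using continuous_attains_inf[of "{T - d..T}" "\<lambda>s. w s * exp (- (l * s))"]
      continuous_on_subset[OF cont] d_nonneg by auto
  define m where "m = w s0 * exp (- (l * s0)) / 2"
  have "m > 0" unfolding m_def using less[of s0] s0(1) unfolding w_w1_def by simp
  have "w t * exp (- (l * t)) > m" if "t \<ge> T" for t
  proof (rule E_persist[OF w _ cf'_l, where ?t0.0 = T and ?t1.0 = t])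
    fix s assume "T - d \<le> s" "s \<le> T"
    then show "m < w s * exp (- (l * s))" using s0(2)[of s] \<open>m > 0\<close> unfolding m_def by simp
  next
    fix r assume r: "T \<le> r" "r \<le> t" and pos: "\<And>s. T - d \<le> s \<Longrightarrow> s \<le> r \<Longrightarrow> 0 \<le> w s"
    have w_nonneg: "w s \<ge> 0" if "s \<le> r" for s
      using pos[of s] less[of s] that d_nonneg unfolding w_w1_def by (cases "s \<le> T") auto
    \<comment> \<open>\<open>exponential_lower_bound\<close> with \<open>C = 0\<close>, where it is
      plain monotonicity; the rate 1 is arbitrary.\<close>
    have "E l p w w1 r \<ge> 0 - 0 / 1 * exp (1 * r)"
    proof (rule exponential_lower_bound[where T = r, OF E'])
      fix s assume "s \<le> r"
      then have "w (s - d) \<ge> 0" using w_nonneg d_nonneg by simp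
      then have "g (\<phi> (s - d)) - g (\<psi> (s - d)) \<le> p * w (s - d)"
        unfolding w_w1_def using profile_pos[OF \<psi>, of "s - d"] by (intro g_sublinear) auto
      then show "(p * w (s - d) - (g (\<phi> (s - d)) - g (\<psi> (s - d)))) * exp (- (l * s)) \<ge> - 0 * exp (1 * s)"
        by simp
    qed (use lim in \<open>auto simp: w_w1_def\<close>)
    then show "E l p w w1 r \<ge> 0" by simp
  qed (use \<open>m > 0\<close> p_gt_1 that in auto)
  moreover obtain B where B: "\<And>t. \<phi> t \<le> B" using \<phi> unfolding profile_def by blast
  moreover have "w t \<le> B" for t using B[of t] profile_pos[OF \<psi>, of t] unfolding w_w1_def by simp
  ultimately have ge: "B * exp (- (l * t)) \<ge> m" if "t \<ge> T" for t
    using that by (smt (verit) exp_ge_zero mult_right_mono)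
  have "((\<lambda>t. B * exp (- (l * t))) \<longlongrightarrow> B * 0) at_top"
    using l_pos by (intro tendsto_mult tendsto_const) real_asymp
  then have "m \<le> B * 0"
    by (rule tendsto_lowerbound) (use ge in \<open>auto simp: eventually_at_top_linorder\<close>)
  then show False using \<open>m > 0\<close> by simp
qed

text \<open>At a maximum of \<open>\<bar>w\<bar> e\<^sup>-\<^sup>(\<^sup>l\<^sup>-\<^sup>\<epsilon>\<^sup>)\<^sup>t\<close> the function stays almost maximal on a whole window
  before \<open>t0\<close>; from there \<open>w e\<^sup>-\<^sup>l\<^sup>t\<close> is kept away from \<open>0\<close> by the barrier
  \<open>V / 2 - D V e\<^sup>\<eta>\<^sup>t\<close>.\<close>

lemma no_positive_weighted_max:
  assumes w: "\<And>t. (w has_real_derivative w1 t) (at t)"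
    and w1: "\<And>t. (w1 has_real_derivative w2 t) (at t)"
    and eq: "\<And>t. w2 t = c * w1 t + w t - G t"
    and "T \<le> 0" "w T = 0"
    and G1: "\<And>t. t \<le> T \<Longrightarrow> G t \<le> p * max (w (t - d)) 0"
    and G2: "\<And>t. t \<le> T \<Longrightarrow> \<bar>p * w (t - d) - G t\<bar> \<le> K1 * exp (\<eta> * t) * \<bar>w (t - d)\<bar>"
    and lim: "(E l p w w1 \<longlongrightarrow> 0) at_bot"
    and \<epsilon>: "0 < \<epsilon>" "\<epsilon> \<le> \<eta> / 2" "\<epsilon> < l" and "K1 \<ge> 0"
    and D: "D * cf p d c (l + \<eta>) = 2 * K1" "\<bar>D\<bar> * exp (\<eta> * T) \<le> 1 / 8"
    and cond: "4 * exp ((l - \<mu>) * d) * cf p d c (l - \<epsilon>) \<le> - ((l - \<epsilon> - \<mu>) * (l - \<epsilon> - \<nu>))"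
    and t0: "t0 < T" "w t0 > 0"
    and max: "\<And>t. t \<le> T \<Longrightarrow> \<bar>w t\<bar> * exp (- ((l - \<epsilon>) * t)) \<le> w t0 * exp (- ((l - \<epsilon>) * t0))"
  shows False
proof -
  define \<gamma> where "\<gamma> = l - \<epsilon>"
  define x where "x = (\<lambda>t. w t * exp (- (\<gamma> * t)))"
  define x1 where "x1 = (\<lambda>t. (w1 t - \<gamma> * w t) * exp (- (\<gamma> * t)))"
  define x2 where "x2 = (\<lambda>t. (w2 t - 2 * \<gamma> * w1 t + \<gamma>\<^sup>2 * w t) * exp (- (\<gamma> * t)))"
  define X where "X = x t0"
  define X0 where "X0 = cf p d c \<gamma>"
  define \<beta> where "\<beta> = - ((\<gamma> - \<mu>) * (\<gamma> - \<nu>))"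
  have \<eta>: "\<eta> > 0" using \<epsilon> by simp
  have \<gamma>: "0 < \<gamma>" "\<gamma> < l" unfolding \<gamma>_def using \<epsilon> by auto
  have "X0 > 0" unfolding X0_def using cf_pos \<gamma> by simp
  have "X > 0" unfolding X_def x_def using t0 by simp
  have z: "\<mu> - \<gamma> < 0" "0 < \<nu> - \<gamma>" using \<mu>_neg \<gamma> l_less_\<nu> by auto
  have \<beta>_pos: "\<beta> > 0"
    unfolding \<beta>_def using z by (simp add: mult_pos_neg)
  have \<beta>_eq: "\<beta> = p * exp (- (\<gamma> * d)) - X0"
    unfolding \<beta>_def X0_def cf_def quadratic_factor by simp
  have x: "(x has_real_derivative x1 t) (at t)" for t
    unfolding x_def x1_def by (auto intro!: derivative_eq_intros w simp: algebra_simps)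
  have x1: "(x1 has_real_derivative x2 t) (at t)" for t
    unfolding x1_def x2_def
    by (auto intro!: derivative_eq_intros w w1 simp: algebra_simps power2_eq_square)
  have absx: "\<bar>x t\<bar> \<le> X" if "t \<le> T" for t
    using max[OF that] unfolding X_def x_def \<gamma>_def by (simp add: abs_mult)
  have "x1 t0 = 0"
    using DERIV_local_max[OF x, of "T - t0" t0] absx t0 unfolding X_def by (force simp: abs_less_iff abs_le_iff)
  \<comment> \<open>The delayed term is at most \<open>(\<beta> + X0) * X\<close>, so
    \<open>X - x\<close> satisfies the local inequality with right-hand side \<open>X0 * X\<close>,
    where \<open>X0\<close> is the small value of \<open>cf\<close> at \<open>\<gamma>\<close>. At
    \<open>t0\<close> both \<open>X - x\<close> and its derivative vanish, and by
    \<open>cond\<close> the backward bound loses at most a quarter of \<open>X\<close> over one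
    window.\<close>
  have near: "x t \<ge> 3 / 4 * X" if t: "t0 - d \<le> t" "t \<le> t0" for t
  proof -
    have "X - x t \<le> X0 * X / (- ((\<mu> - \<gamma>) * (\<nu> - \<gamma>))) * exp (- (\<mu> - \<gamma>) * (t0 - t))"
    proof (rule backward_second_order_bound[where l = "t - 1" and y = "\<lambda>s. X - x s" and
          ?y1.0 = "\<lambda>s. - x1 s" and ?y2.0 = "\<lambda>s. - x2 s"])
      fix r assume r: "t - 1 < r" "r \<le> t0"
      show "((\<lambda>s. X - x s) has_real_derivative - x1 r) (at r)"
        by (auto intro!: derivative_eq_intros x)
      show "((\<lambda>s. - x1 s) has_real_derivative - x2 r) (at r)"
        by (auto intro!: derivative_eq_intros x1)
      have e: "exp (- (\<gamma> * d)) * exp (- (\<gamma> * (r - d))) = exp (- (\<gamma> * r))"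
        by (simp add: exp_add[symmetric] algebra_simps)
      have "max (w (r - d)) 0 * exp (- (\<gamma> * (r - d))) \<le> X"
        using absx[of "r - d"] r t0 d_nonneg \<open>X > 0\<close> unfolding x_def by (auto simp: max_def)
      then have "p * exp (- (\<gamma> * d)) * (max (w (r - d)) 0 * exp (- (\<gamma> * (r - d)))) \<le> p * exp (- (\<gamma> * d)) * X"
        using p_gt_1 by (intro mult_left_mono) auto
      then have "p * max (w (r - d)) 0 * exp (- (\<gamma> * r)) \<le> p * exp (- (\<gamma> * d)) * X"
        unfolding e[symmetric] by (simp add: algebra_simps)
      moreover have "G r * exp (- (\<gamma> * r)) \<le> p * max (w (r - d)) 0 * exp (- (\<gamma> * r))"
        using G1[of r] r t0 by (intro mult_right_mono) auto
      ultimately have G: "G r * exp (- (\<gamma> * r)) \<le> (\<beta> + X0) * X"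
        using \<beta>_eq by (metis add_diff_cancel_right' diff_add_cancel order_trans)
      have "- x2 r - (\<mu> - \<gamma> + (\<nu> - \<gamma>)) * - x1 r + (\<mu> - \<gamma>) * (\<nu> - \<gamma>) * (X - x r) =
        (\<mu> - \<gamma>) * (\<nu> - \<gamma>) * X - (x2 r - (\<mu> + \<nu> - 2 * \<gamma>) * x1 r + (\<gamma>\<^sup>2 - (\<mu> + \<nu>) * \<gamma> + \<mu> * \<nu>) * x r)"
        by (simp add: algebra_simps power2_eq_square)
      also have "x2 r - (\<mu> + \<nu> - 2 * \<gamma>) * x1 r + (\<gamma>\<^sup>2 - (\<mu> + \<nu>) * \<gamma> + \<mu> * \<nu>) * x r = - G r * exp (- (\<gamma> * r))"
        unfolding x_def x1_def x2_def \<mu>_\<nu>_sum \<mu>_\<nu>_prod eq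
        by (simp add: algebra_simps power2_eq_square)
      also have "(\<mu> - \<gamma>) * (\<nu> - \<gamma>) * X - - G r * exp (- (\<gamma> * r)) = G r * exp (- (\<gamma> * r)) - \<beta> * X"
        unfolding \<beta>_def by (simp add: algebra_simps)
      also have "\<dots> \<le> X0 * X" using G by (simp add: algebra_simps)
      finally show "- x2 r - (\<mu> - \<gamma> + (\<nu> - \<gamma>)) * - x1 r + (\<mu> - \<gamma>) * (\<nu> - \<gamma>) * (X - x r) \<le> X0 * X" .
    qed (use z \<open>x1 t0 = 0\<close> \<open>X0 > 0\<close> \<open>X > 0\<close> t in \<open>auto simp: X_def\<close>)
    also have "- ((\<mu> - \<gamma>) * (\<nu> - \<gamma>)) = \<beta>" unfolding \<beta>_def by (simp add: algebra_simps)
    also have "X0 * X / \<beta> * exp (- (\<mu> - \<gamma>) * (t0 - t)) \<le> X0 * X / \<beta> * exp ((l - \<mu>) * d)"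
    proof -
      have "- (\<mu> - \<gamma>) * (t0 - t) \<le> (l - \<mu>) * d"
        using t \<gamma> z by (intro mult_mono) auto
      then show ?thesis using \<open>X0 > 0\<close> \<open>X > 0\<close> \<beta>_pos by (intro mult_left_mono) auto
    qed
    also have "\<dots> = (exp ((l - \<mu>) * d) * X0) / \<beta> * X" by simp
    also have "\<dots> \<le> 1 / 4 * X"
      using cond \<beta>_pos \<open>X > 0\<close> unfolding \<gamma>_def[symmetric] X0_def[symmetric] \<beta>_def[symmetric]
      by (intro mult_right_mono) (auto simp: divide_le_eq)
    finally show ?thesis by simp
  qed
  define V where "V = X * exp (- (\<epsilon> * t0))"
  have "V > 0" unfolding V_def using \<open>X > 0\<close> by simp
  define v where "v = (\<lambda>t. w t * exp (- (l * t)))"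
  have v_eq: "v t = x t * exp (- (\<epsilon> * t))" for t
    unfolding v_def x_def \<gamma>_def by (simp add: mult.assoc exp_add[symmetric] algebra_simps)
  have v_near: "v t \<ge> 3 / 4 * V" if t: "t0 - d \<le> t" "t \<le> t0" for t
  proof -
    have "exp (- (\<epsilon> * t0)) \<le> exp (- (\<epsilon> * t))" using t \<epsilon> by simp
    then have "3 / 4 * X * exp (- (\<epsilon> * t0)) \<le> x t * exp (- (\<epsilon> * t))"
      using near[OF t] \<open>X > 0\<close> by (intro mult_mono) auto
    then show ?thesis unfolding v_eq V_def by simp
  qed
  \<comment> \<open>Bounding \<open>w\<close> through \<open>X\<close> gives the exponent
    \<open>\<eta> - \<epsilon>\<close>. For \<open>t \<ge> t0\<close> the surplus
    \<open>exp (- (\<epsilon> * t))\<close> is at most its value at \<open>t0\<close>, which is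
    contained in \<open>V\<close>; \<open>\<epsilon> \<le> \<eta> / 2\<close> accounts for the
    factor 2.\<close>
  have E_ge: "E l p w w1 t \<ge> - (2 * K1 / \<eta>) * V * exp (\<eta> * t)" if t: "t0 \<le> t" "t \<le> T" for t
  proof -
    have E': "(E l p w w1 has_real_derivative (p * w (s - d) - G s) * exp (- (l * s))) (at s)" for s
      using DERIV_E[OF w w1, of l p s] by (simp add: cf_l eq)
    have "E l p w w1 t \<ge> 0 - K1 * X / (\<eta> - \<epsilon>) * exp ((\<eta> - \<epsilon>) * t)"
    proof (rule exponential_lower_bound[OF E' _ lim _ t(2)])
      fix s assume s: "s \<le> T"
      have "\<bar>w (s - d)\<bar> = \<bar>x (s - d)\<bar> * exp (\<gamma> * (s - d))"
        unfolding x_def by (simp add: abs_mult mult.assoc exp_add[symmetric])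
      also have "\<dots> \<le> X * exp (\<gamma> * s)"
        using absx[of "s - d"] s d_nonneg \<gamma> \<open>X > 0\<close> by (intro mult_mono) auto
      finally have "K1 * exp (\<eta> * s) * \<bar>w (s - d)\<bar> \<le> K1 * exp (\<eta> * s) * (X * exp (\<gamma> * s))"
        using \<open>K1 \<ge> 0\<close> by (intro mult_left_mono) auto
      then have "- (p * w (s - d) - G s) \<le> K1 * exp (\<eta> * s) * (X * exp (\<gamma> * s))"
        using G2[OF s] by linarith
      then have "- (p * w (s - d) - G s) * exp (- (l * s)) \<le> K1 * exp (\<eta> * s) * (X * exp (\<gamma> * s)) * exp (- (l * s))"
        by (intro mult_right_mono) auto
      also have "\<dots> = K1 * X * exp ((\<eta> - \<epsilon>) * s)"
        unfolding \<gamma>_def by (simp add: mult.assoc mult.left_commute exp_add[symmetric] algebra_simps)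
      finally show "(p * w (s - d) - G s) * exp (- (l * s)) \<ge> - (K1 * X) * exp ((\<eta> - \<epsilon>) * s)"
        unfolding mult_minus_left by linarith
    qed (use \<epsilon> \<eta> in auto)
    moreover have "K1 * X / (\<eta> - \<epsilon>) * exp ((\<eta> - \<epsilon>) * t) \<le> (2 * K1 / \<eta>) * V * exp (\<eta> * t)"
    proof -
      have "K1 * X / (\<eta> - \<epsilon>) \<le> K1 * X / (\<eta> / 2)"
        using \<epsilon> \<eta> \<open>K1 \<ge> 0\<close> \<open>X > 0\<close> by (intro divide_left_mono mult_pos_pos) auto
      then have "K1 * X / (\<eta> - \<epsilon>) * exp ((\<eta> - \<epsilon>) * t) \<le> K1 * X / (\<eta> / 2) * exp ((\<eta> - \<epsilon>) * t)"
        by (intro mult_right_mono) auto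
      also have "\<dots> = (2 * K1 / \<eta>) * (X * exp (- (\<epsilon> * t))) * exp (\<eta> * t)"
        by (simp add: mult.assoc exp_add[symmetric] algebra_simps)
      also have "\<dots> \<le> (2 * K1 / \<eta>) * V * exp (\<eta> * t)"
        unfolding V_def using t \<epsilon> \<eta> \<open>K1 \<ge> 0\<close> \<open>X > 0\<close>
        by (intro mult_right_mono mult_left_mono) auto
      finally show ?thesis .
    qed
    ultimately show ?thesis by simp
  qed
  have D_bound: "\<bar>D * exp (\<eta> * t)\<bar> \<le> 1 / 8" if "t \<le> T" for t
  proof -
    have "\<bar>D\<bar> * exp (\<eta> * t) \<le> \<bar>D\<bar> * exp (\<eta> * T)" using that \<eta> by (intro mult_left_mono) auto
    then show ?thesis using D(2) by (simp add: abs_mult)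
  qed
  define b where "b = p * exp (- (l * d))"
  \<comment> \<open>The exponential term absorbs the error in \<open>E_ge\<close>: with
    \<open>D * cf p d c (l + \<eta>) = 2 * K1\<close> the two cancel exactly. \<open>D\<close> may
    have either sign. On the window before \<open>t0\<close> the function \<open>zz\<close> is at
    least \<open>V / 8\<close>, whereas \<open>v T = 0\<close> makes \<open>zz T\<close>
    negative.\<close>
  define zz where "zz = (\<lambda>t. v t - V / 2 + D * V * exp (\<eta> * t))"
  have "zz T > 0"
  proof (rule delay_inequality_positive[where z = zz and t = T and d = d and b = b and a = "c - 2 * l" and ?t0.0 = t0 and ?t1.0 = T
        and ?z' = "\<lambda>t. (w1 t - l * w t) * exp (- (l * t)) + D * V * (\<eta> * exp (\<eta> * t))"])
    show "continuous_on UNIV zz" unfolding zz_def v_def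
      by (intro continuous_intros continuous_of_DERIV[OF w])
    show "(zz has_real_derivative (w1 t - l * w t) * exp (- (l * t)) + D * V * (\<eta> * exp (\<eta> * t))) (at t)" for t
      unfolding zz_def v_def by (auto intro!: derivative_eq_intros w simp: algebra_simps)
    fix s assume s: "t0 - d \<le> s" "s \<le> t0"
    have "V * (D * exp (\<eta> * s)) \<ge> V * (- 1 / 8)"
      using D_bound[of s] s t0 \<open>V > 0\<close> by (intro mult_left_mono) (auto simp: abs_le_iff)
    then show "zz s > 0" using v_near[OF s] \<open>V > 0\<close> unfolding zz_def by (simp add: algebra_simps)
  next
    fix t assume t: "t0 \<le> t" "t \<le> T"
    have cont: "continuous_on UNIV v" unfolding v_def
      by (intro continuous_intros continuous_of_DERIV[OF w])
    obtain A where A: "\<And>t. (A has_real_derivative v t) (at t)" using antiderivative_exists[OF cont] by blast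
    have "((\<lambda>t. A t - V / 2 * t + D * V / \<eta> * exp (\<eta> * t)) has_real_derivative zz t) (at t)" for t
      unfolding zz_def using \<eta> by (auto intro!: derivative_eq_intros A)
    from window_integral_eq[OF this d_nonneg, of t]
    have "integral {t - d..t} zz = integral {t - d..t} v - V / 2 * d + D * V / \<eta> * (exp (\<eta> * t) - exp (\<eta> * (t - d)))"
      using window_integral_eq[OF A d_nonneg, of t]
      by (simp add: algebra_simps add_divide_distrib diff_divide_distrib)
    also have "exp (\<eta> * (t - d)) = exp (\<eta> * t) * exp (- (\<eta> * d))"
      by (simp add: exp_add[symmetric] algebra_simps)
    finally have int: "integral {t - d..t} zz = integral {t - d..t} v - V / 2 * d +
        D * V / \<eta> * (exp (\<eta> * t) - exp (\<eta> * t) * exp (- (\<eta> * d)))" .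
    have El: "E l p w w1 t = (w1 t - l * w t) * exp (- (l * t)) - (c - 2 * l) * v t - b * integral {t - d..t} v"
      unfolding E_def v_def b_def by (simp add: algebra_simps)
    have cfe: "cf p d c (l + \<eta>) = \<eta>\<^sup>2 - (c - 2 * l) * \<eta> - b * (1 - exp (- (\<eta> * d)))"
    proof -
      have "exp (- ((l + \<eta>) * d)) = exp (- (l * d)) * exp (- (\<eta> * d))"
        by (simp add: exp_add[symmetric] algebra_simps)
      then have "cf p d c (l + \<eta>) = cf p d c l + \<eta>\<^sup>2 - (c - 2 * l) * \<eta> - b * (1 - exp (- (\<eta> * d)))"
        unfolding cf_def b_def by (simp add: algebra_simps power2_eq_square)
      then show ?thesis using cf_l by simp
    qed
    have "V / 2 * (c - 2 * l + b * d) \<ge> 0"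
      using cf'_l \<open>V > 0\<close> unfolding cf'_def b_def by (intro mult_nonneg_nonneg) (auto simp: algebra_simps)
    moreover have "D * (\<eta>\<^sup>2 - (c - 2 * l) * \<eta> - b * (1 - exp (- (\<eta> * d)))) / \<eta> = 2 * K1 / \<eta>"
      using D(1) unfolding cfe by simp
    then have "(2 * K1 / \<eta>) * V * exp (\<eta> * t) =
        D * (\<eta>\<^sup>2 - (c - 2 * l) * \<eta> - b * (1 - exp (- (\<eta> * d)))) / \<eta> * V * exp (\<eta> * t)"
      by (simp only:)
    then have "(2 * K1 / \<eta>) * V * exp (\<eta> * t) =
        D * V * (\<eta> * exp (\<eta> * t)) - (c - 2 * l) * (D * V * exp (\<eta> * t)) -
        b * (D * V / \<eta> * (exp (\<eta> * t) - exp (\<eta> * t) * exp (- (\<eta> * d))))"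
      using \<eta> by (simp only:) (simp add: field_simps power2_eq_square)
    moreover have zz_t: "zz t = v t - V / 2 + D * V * exp (\<eta> * t)" unfolding zz_def ..
    ultimately show "(w1 t - l * w t) * exp (- (l * t)) + D * V * (\<eta> * exp (\<eta> * t)) \<ge>
        (c - 2 * l) * zz t + b * integral {t - d..t} zz"
      using E_ge[OF t] unfolding int El zz_t by (simp add: algebra_simps)
  qed (use d_nonneg p_gt_1 t0 in \<open>auto simp: b_def\<close>)
  moreover have "V * (D * exp (\<eta> * T)) \<le> V * (1 / 8)"
    using D_bound[of T] \<open>V > 0\<close> by (intro mult_left_mono) (auto simp: abs_le_iff)
  moreover have "v T = 0" unfolding v_def using \<open>w T = 0\<close> by simp
  ultimately show False using \<open>V > 0\<close> unfolding zz_def by (simp add: algebra_simps)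
qed


text \<open>Far to the left the difference of the nonlinear terms deviates from \<open>p\<close>
  times the delayed difference of the profiles by at most \<open>p\<close> times its absolute value.
  Hence it is not positive where that difference is negative, although \<open>g\<close> need not be
  monotone; elsewhere sublinearity gives the upper bound.\<close>

lemma profile_no_positive_weighted_max:
  assumes \<phi>: "profile \<phi> \<phi>1 \<phi>2" and \<psi>: "profile \<psi> \<psi>1 \<psi>2"
    and lim: "(Ed \<phi> \<phi>1 \<psi> \<psi>1 \<longlongrightarrow> 0) at_bot"
    and small: "\<And>t. t \<le> T \<Longrightarrow> \<phi> t < \<delta>" "\<And>t. t \<le> T \<Longrightarrow> \<psi> t < \<delta>"
    and decay: "\<And>t. t \<le> T \<Longrightarrow> \<phi> t \<le> C * exp (l / 2 * t)" "\<And>t. t \<le> T \<Longrightarrow> \<psi> t \<le> C * exp (l / 2 * t)"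
    and C: "C > 0" and K1: "K1 = 2 * K * C powr \<alpha>" "K1 * exp (\<eta> * T) \<le> p"
    and T: "T \<le> 0" "\<phi> T = \<psi> T"
    and \<epsilon>: "0 < \<epsilon>" "\<epsilon> \<le> \<eta> / 2" "\<epsilon> < l" and \<eta>: "\<eta> \<le> \<alpha> * l / 2"
    and D: "D * cf p d c (l + \<eta>) = 2 * K1" "\<bar>D\<bar> * exp (\<eta> * T) \<le> 1 / 8"
    and cond: "4 * exp ((l - \<mu>) * d) * cf p d c (l - \<epsilon>) \<le> - ((l - \<epsilon> - \<mu>) * (l - \<epsilon> - \<nu>))"
    and t0: "t0 \<le> T" "\<phi> t0 > \<psi> t0"
    and max: "\<And>t. t \<le> T \<Longrightarrow> \<bar>\<phi> t - \<psi> t\<bar> * exp (- ((l - \<epsilon>) * t)) \<le> (\<phi> t0 - \<psi> t0) * exp (- ((l - \<epsilon>) * t0))"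
  shows False
proof (rule no_positive_weighted_max[where w = "\<lambda>t. \<phi> t - \<psi> t" and ?w1.0 = "\<lambda>t. \<phi>1 t - \<psi>1 t" and
      ?w2.0 = "\<lambda>t. \<phi>2 t - \<psi>2 t" and G = "\<lambda>t. g (\<phi> (t - d)) - g (\<psi> (t - d))", OF _ _ _ T(1) _ _ _ lim \<epsilon> _ D cond])
  have "0 < \<eta>" using \<epsilon> by simp
  have K1_pos: "K1 \<ge> 0" using K1 K_pos by simp
  fix t
  show "((\<lambda>t. \<phi> t - \<psi> t) has_real_derivative \<phi>1 t - \<psi>1 t) (at t)"
    by (intro derivative_intros DERIV_profile[OF \<phi>] DERIV_profile[OF \<psi>])
  show "((\<lambda>t. \<phi>1 t - \<psi>1 t) has_real_derivative \<phi>2 t - \<psi>2 t) (at t)"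
    by (intro derivative_intros DERIV_profile1[OF \<phi>] DERIV_profile1[OF \<psi>])
  show "\<phi>2 t - \<psi>2 t = c * (\<phi>1 t - \<psi>1 t) + (\<phi> t - \<psi> t) - (g (\<phi> (t - d)) - g (\<psi> (t - d)))"
    by (simp add: profile_eq[OF \<phi>] profile_eq[OF \<psi>] algebra_simps)
  show "K1 \<ge> 0" by (rule K1_pos)
  show "\<phi> T - \<psi> T = 0" "0 < \<phi> t0 - \<psi> t0" using T t0 by simp_all
  show "t0 < T" using T t0 by (metis less_eq_real_def less_irrefl)
  show "\<bar>\<phi> t - \<psi> t\<bar> * exp (- ((l - \<epsilon>) * t)) \<le> (\<phi> t0 - \<psi> t0) * exp (- ((l - \<epsilon>) * t0))" if "t \<le> T"
    using max[OF that] .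
  show bound: "\<bar>p * (\<phi> (t - d) - \<psi> (t - d)) - (g (\<phi> (t - d)) - g (\<psi> (t - d)))\<bar> \<le>
      K1 * exp (\<eta> * t) * \<bar>\<phi> (t - d) - \<psi> (t - d)\<bar>" if "t \<le> T"
  proof -
    define s where "s = t - d"
    have s: "s \<le> T" "s \<le> t" "s \<le> 0" using that d_nonneg T unfolding s_def by auto
    have pw: "y powr \<alpha> \<le> C powr \<alpha> * exp (\<eta> * t)" if y: "0 < y" "y \<le> C * exp (l / 2 * s)" for y
    proof -
      have "y powr \<alpha> \<le> (C * exp (l / 2 * s)) powr \<alpha>" using y \<alpha>_pos by (intro powr_mono2) auto
      moreover have "(C * exp (l / 2 * s)) powr \<alpha> = C powr \<alpha> * exp (\<alpha> * l / 2 * s)"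
        using C by (simp add: powr_def ln_mult exp_add[symmetric] algebra_simps)
      moreover have "\<alpha> * l / 2 * s \<le> \<eta> * s" using \<eta> s by (intro mult_right_mono_neg) auto
      moreover have "\<eta> * s \<le> \<eta> * t" using s \<open>0 < \<eta>\<close> by simp
      ultimately have "exp (\<alpha> * l / 2 * s) \<le> exp (\<eta> * t)" by simp
      then have "C powr \<alpha> * exp (\<alpha> * l / 2 * s) \<le> C powr \<alpha> * exp (\<eta> * t)"
        by (intro mult_left_mono) auto
      with \<open>y powr \<alpha> \<le> _\<close> \<open>_ powr \<alpha> = _\<close> show ?thesis by simp
    qed
    have "\<bar>g (\<phi> s) - g (\<psi> s) - p * (\<phi> s - \<psi> s)\<bar> \<le> K * \<bar>\<phi> s - \<psi> s\<bar> * (\<psi> s powr \<alpha> + \<phi> s powr \<alpha>)"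
      using small s profile_pos[OF \<phi>, of s] profile_pos[OF \<psi>, of s] by (intro g_smooth) auto
    also have "\<dots> \<le> K * \<bar>\<phi> s - \<psi> s\<bar> * (2 * (C powr \<alpha> * exp (\<eta> * t)))"
      using K_pos pw[of "\<phi> s"] pw[of "\<psi> s"] decay[of s] s profile_pos[OF \<phi>, of s] profile_pos[OF \<psi>, of s]
      by (intro mult_left_mono) auto
    also have "\<dots> = K1 * exp (\<eta> * t) * \<bar>\<phi> s - \<psi> s\<bar>" using K1 by simp
    finally show ?thesis unfolding s_def by (simp add: abs_minus_commute)
  qed
  show "g (\<phi> (t - d)) - g (\<psi> (t - d)) \<le> p * max (\<phi> (t - d) - \<psi> (t - d)) 0" if t: "t \<le> T"
  proof (cases "\<phi> (t - d) \<ge> \<psi> (t - d)")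
    case True
    then show ?thesis using g_sublinear[of "\<psi> (t - d)" "\<phi> (t - d)"] profile_pos[OF \<psi>, of "t - d"] by simp
  next
    case False
    have "K1 * exp (\<eta> * t) \<le> K1 * exp (\<eta> * T)" using t \<open>0 < \<eta>\<close> K1_pos by (intro mult_left_mono) auto
    then have "K1 * exp (\<eta> * t) \<le> p" using K1 by simp
    then have "K1 * exp (\<eta> * t) * \<bar>\<phi> (t - d) - \<psi> (t - d)\<bar> \<le> p * \<bar>\<phi> (t - d) - \<psi> (t - d)\<bar>"
      by (intro mult_right_mono) auto
    with False bound[OF t] show ?thesis by (simp add: algebra_simps abs_if split: if_splits)
  qed
qed

lemma profile_weighted_tendsto:
  assumes \<phi>: "profile \<phi> \<phi>1 \<phi>2" and "0 < \<gamma>" "\<gamma> < l"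
  shows "((\<lambda>t. \<phi> t * exp (- (\<gamma> * t))) \<longlongrightarrow> 0) at_bot"
proof -
  define \<rho> where "\<rho> = (\<gamma> + l) / 2"
  have \<rho>: "\<gamma> < \<rho>" "0 < \<rho>" "\<rho> < l" unfolding \<rho>_def using assms by auto
  obtain C T where C: "C > 0" "\<And>t. t \<le> T \<Longrightarrow> \<phi> t \<le> C * exp (\<rho> * t)"
    using profile_decay[OF \<phi> \<rho>(2,3)] by metis
  have "((\<lambda>t. C * exp ((\<rho> - \<gamma>) * t)) \<longlongrightarrow> C * 0) at_bot"
    using \<rho> by (intro tendsto_mult tendsto_const) real_asymp
  then have lim: "((\<lambda>t. C * exp ((\<rho> - \<gamma>) * t)) \<longlongrightarrow> 0) at_bot" by simp
  show ?thesis
  proof (rule tendsto_sandwich[OF _ _ tendsto_const lim])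
    show "eventually (\<lambda>t. \<phi> t * exp (- (\<gamma> * t)) \<le> C * exp ((\<rho> - \<gamma>) * t)) at_bot"
      unfolding eventually_at_bot_linorder
    proof (intro exI allI impI)
      fix t assume "t \<le> T"
      then have "\<phi> t * exp (- (\<gamma> * t)) \<le> C * exp (\<rho> * t) * exp (- (\<gamma> * t))"
        using C by (intro mult_right_mono) auto
      then show "\<phi> t * exp (- (\<gamma> * t)) \<le> C * exp ((\<rho> - \<gamma>) * t)"
        by (simp add: mult.assoc exp_add[symmetric] algebra_simps)
    qed
  qed (use profile_pos[OF \<phi>] in \<open>auto simp: less_imp_le\<close>)
qed

lemma Ed_tendsto_swap:
  assumes \<phi>: "profile \<phi> \<phi>1 \<phi>2" and \<psi>: "profile \<psi> \<psi>1 \<psi>2"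
    and lim: "(Ed \<phi> \<phi>1 \<psi> \<psi>1 \<longlongrightarrow> 0) at_bot"
  shows "(Ed \<psi> \<psi>1 \<phi> \<phi>1 \<longlongrightarrow> 0) at_bot"
proof -
  have "Ed \<psi> \<psi>1 \<phi> \<phi>1 = (\<lambda>t. - Ed \<phi> \<phi>1 \<psi> \<psi>1 t)"
    using DERIV_profile[OF \<phi>] DERIV_profile[OF \<psi>] by (simp add: E_diff fun_eq_iff)
  then show ?thesis using tendsto_minus[OF lim] by simp
qed

text \<open>This excludes oscillation: if the profiles met at \<open>T\<close> and differed further
  left, their weighted distance would attain a positive maximum, in one of the two orders.\<close>

lemma profile_left_uniqueness:
  assumes \<phi>: "profile \<phi> \<phi>1 \<phi>2" and \<psi>: "profile \<psi> \<psi>1 \<psi>2"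
    and lim: "(Ed \<phi> \<phi>1 \<psi> \<psi>1 \<longlongrightarrow> 0) at_bot"
  obtains T1 where "\<And>T t. T \<le> T1 \<Longrightarrow> \<phi> T = \<psi> T \<Longrightarrow> t \<le> T \<Longrightarrow> \<phi> t = \<psi> t"
proof -
  have l2: "0 < l / 2" "l / 2 < l" using l_pos by auto
  obtain Ca Ta where Ca: "Ca > 0" "\<And>t. t \<le> Ta \<Longrightarrow> \<phi> t \<le> Ca * exp (l / 2 * t)"
    using profile_decay[OF \<phi> l2] by metis
  obtain Cb Tb where Cb: "Cb > 0" "\<And>t. t \<le> Tb \<Longrightarrow> \<psi> t \<le> Cb * exp (l / 2 * t)"
    using profile_decay[OF \<psi> l2] by metis
  obtain Tc where Tc: "\<And>t. t \<le> Tc \<Longrightarrow> \<phi> t < \<delta>" using profile_small[OF \<phi> \<delta>_pos] by metis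
  obtain Td where Td: "\<And>t. t \<le> Td \<Longrightarrow> \<psi> t < \<delta>" using profile_small[OF \<psi> \<delta>_pos] by metis
  define C where "C = max Ca Cb"
  have C: "C > 0" "Ca \<le> C" "Cb \<le> C" unfolding C_def using Ca by auto
  define K1 where "K1 = 2 * K * C powr \<alpha>"
  define y0 where "y0 = \<alpha> * l / 2"
  have y0: "y0 > 0" unfolding y0_def using \<alpha>_pos l_pos by simp
  \<comment> \<open>\<open>D\<close> requires a nonzero divisor. As \<open>l\<close> is already a
    zero and \<open>cf\<close> has at most two, one of \<open>y0\<close> and \<open>y0 / 2\<close>
    works. The exponent \<open>y0\<close> is what decay at rate \<open>l / 2\<close> gives to the
    power \<open>\<alpha>\<close> of a profile.\<close>
  obtain \<eta> where \<eta>: "0 < \<eta>" "\<eta> \<le> y0" "cf p d c (l + \<eta>) \<noteq> 0"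
  proof (cases "cf p d c (l + y0) = 0")
    case True
    have "cf p d c (l + y0 / 2) \<noteq> 0"
    proof
      assume z: "cf p d c (l + y0 / 2) = 0"
      have "cf' p d c (l + y0 / 2) > 0"
        by (rule cf_zeros_deriv_signs(2)[OF _ d_nonneg _ cf_l z]) (use p_gt_1 y0 in auto)
      moreover have "cf' p d c (l + y0 / 2) < 0"
        by (rule cf_zeros_deriv_signs(1)[OF _ d_nonneg _ z True]) (use p_gt_1 y0 in auto)
      ultimately show False by simp
    qed
    then show ?thesis using that[of "y0 / 2"] y0 by simp
  qed (use that[of y0] y0 in simp)
  define D where "D = 2 * K1 / cf p d c (l + \<eta>)"
  have D: "D * cf p d c (l + \<eta>) = 2 * K1" unfolding D_def using \<eta> by simp
  \<comment> \<open>At \<open>\<epsilon> = 0\<close> the left side of \<open>cond\<close> vanishes,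
    because \<open>l\<close> is a zero of \<open>cf\<close>, and the right side is positive;
    continuity does the rest.\<close>
  obtain \<epsilon> where \<epsilon>: "0 < \<epsilon>" "\<epsilon> < min (\<eta> / 2) l"
    and cond: "4 * exp ((l - \<mu>) * d) * cf p d c (l - \<epsilon>) < - ((l - \<epsilon> - \<mu>) * (l - \<epsilon> - \<nu>))"
  proof -
    define f where "f = (\<lambda>\<epsilon>. - ((l - \<epsilon> - \<mu>) * (l - \<epsilon> - \<nu>)) - 4 * exp ((l - \<mu>) * d) * cf p d c (l - \<epsilon>))"
    have "(f \<longlongrightarrow> - ((l - 0 - \<mu>) * (l - 0 - \<nu>)) - 4 * exp ((l - \<mu>) * d) * cf p d c (l - 0)) (at_right 0)"
      unfolding f_def by (intro tendsto_intros isCont_tendsto_compose[OF isCont_cf])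
    moreover have "- ((l - 0 - \<mu>) * (l - 0 - \<nu>)) - 4 * exp ((l - \<mu>) * d) * cf p d c (l - 0) > 0"
      using l_less_\<nu> l_pos \<mu>_neg by (simp add: cf_l mult_pos_neg)
    ultimately have "eventually (\<lambda>\<epsilon>. f \<epsilon> > 0) (at_right 0)" by (rule order_tendstoD)
    moreover have "eventually (\<lambda>\<epsilon>. \<epsilon> \<in> {0<..<min (\<eta> / 2) l}) (at_right 0)"
      using \<eta> l_pos by (intro eventually_at_right_real) simp
    ultimately have "eventually (\<lambda>\<epsilon>. f \<epsilon> > 0 \<and> \<epsilon> \<in> {0<..<min (\<eta> / 2) l}) (at_right 0)"
      by eventually_elim simp
    then obtain \<epsilon> where "f \<epsilon> > 0 \<and> \<epsilon> \<in> {0<..<min (\<eta> / 2) l}"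
      using eventually_happens'[OF trivial_limit_at_right_real] by blast
    then show ?thesis using that[of \<epsilon>] unfolding f_def by auto
  qed
  have exp0: "((\<lambda>t. B * exp (\<eta> * t)) \<longlongrightarrow> B * 0) at_bot" for B :: real
    using \<eta>(1) by (intro tendsto_mult tendsto_const) real_asymp
  have "eventually (\<lambda>t. K1 * exp (\<eta> * t) < p) at_bot"
    using exp0[of K1] by (rule order_tendstoD(2)) (use p_gt_1 in simp)
  moreover have "eventually (\<lambda>t. \<bar>D\<bar> * exp (\<eta> * t) < 1 / 8) at_bot"
    using exp0[of "\<bar>D\<bar>"] by (rule order_tendstoD(2)) simp
  ultimately have "eventually (\<lambda>t. K1 * exp (\<eta> * t) < p \<and> \<bar>D\<bar> * exp (\<eta> * t) < 1 / 8) at_bot"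
    by eventually_elim simp
  then obtain Te where Te: "\<And>t. t \<le> Te \<Longrightarrow> K1 * exp (\<eta> * t) < p \<and> \<bar>D\<bar> * exp (\<eta> * t) < 1 / 8"
    unfolding eventually_at_bot_linorder by blast
  define T1 where "T1 = min (min (min Ta Tb) (min Tc Td)) (min Te 0)"
  have \<phi>_le: "\<phi> t \<le> C * exp (l / 2 * t)" if "t \<le> T1" for t
  proof -
    have "Ca * exp (l / 2 * t) \<le> C * exp (l / 2 * t)" using C by (intro mult_right_mono) auto
    moreover have "t \<le> Ta" using that unfolding T1_def by simp
    ultimately show ?thesis using Ca(2)[of t] by linarith
  qed
  have \<psi>_le: "\<psi> t \<le> C * exp (l / 2 * t)" if "t \<le> T1" for t
  proof -
    have "Cb * exp (l / 2 * t) \<le> C * exp (l / 2 * t)" using C by (intro mult_right_mono) auto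
    moreover have "t \<le> Tb" using that unfolding T1_def by simp
    ultimately show ?thesis using Cb(2)[of t] by linarith
  qed
  have small: "\<phi> t < \<delta>" "\<psi> t < \<delta>" if "t \<le> T1" for t
    using Tc[of t] Td[of t] that unfolding T1_def by auto
  have lim': "(Ed \<psi> \<psi>1 \<phi> \<phi>1 \<longlongrightarrow> 0) at_bot" by (rule Ed_tendsto_swap[OF \<phi> \<psi> lim])
  have "\<phi> t = \<psi> t" if T: "T \<le> T1" "\<phi> T = \<psi> T" "t \<le> T" for T t
  proof (rule ccontr)
    assume "\<phi> t \<noteq> \<psi> t"
    define f where "f = (\<lambda>t. \<bar>\<phi> t - \<psi> t\<bar> * exp (- ((l - \<epsilon>) * t)))"
    have "continuous_on UNIV f" unfolding f_def
      by (intro continuous_intros continuous_of_DERIV[OF DERIV_profile[OF \<phi>]]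
          continuous_of_DERIV[OF DERIV_profile[OF \<psi>]])
    moreover have "(f \<longlongrightarrow> 0) at_bot"
    proof -
      have "((\<lambda>t. \<phi> t * exp (- ((l - \<epsilon>) * t)) - \<psi> t * exp (- ((l - \<epsilon>) * t))) \<longlongrightarrow> 0 - 0) at_bot"
        using \<epsilon> by (intro tendsto_diff profile_weighted_tendsto[OF \<phi>] profile_weighted_tendsto[OF \<psi>]) auto
      from tendsto_rabs[OF this] show ?thesis
        unfolding f_def by (simp add: left_diff_distrib[symmetric] abs_mult)
    qed
    moreover have "f t > 0" unfolding f_def using \<open>\<phi> t \<noteq> \<psi> t\<close> by simp
    ultimately obtain t0 where t0: "t0 \<le> T" "\<And>r. r \<le> T \<Longrightarrow> f r \<le> f t0"
      using attains_sup_at_bot[of f t T] T(3) by metis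
    have "f t0 > 0" using t0(2)[OF T(3)] \<open>f t > 0\<close> by simp
    \<comment> \<open>Formulated for arbitrary profiles so that it applies to both orders of the
      pair.\<close>
    have sign: "\<not> \<phi>' t0 > \<psi>' t0"
      if \<phi>': "profile \<phi>' \<phi>1' \<phi>2'" and \<psi>': "profile \<psi>' \<psi>1' \<psi>2'"
        and lim': "(Ed \<phi>' \<phi>1' \<psi>' \<psi>1' \<longlongrightarrow> 0) at_bot"
        and le: "\<And>s. s \<le> T1 \<Longrightarrow> \<phi>' s < \<delta> \<and> \<phi>' s \<le> C * exp (l / 2 * s)"
          "\<And>s. s \<le> T1 \<Longrightarrow> \<psi>' s < \<delta> \<and> \<psi>' s \<le> C * exp (l / 2 * s)"
        and f: "\<And>s. f s = \<bar>\<phi>' s - \<psi>' s\<bar> * exp (- ((l - \<epsilon>) * s))" and eq: "\<phi>' T = \<psi>' T"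
      for \<phi>' \<phi>1' \<phi>2' \<psi>' \<psi>1' \<psi>2'
    proof
      assume pos: "\<phi>' t0 > \<psi>' t0"
      show False
      proof (rule profile_no_positive_weighted_max[OF \<phi>' \<psi>' lim', where T = T and C = C and \<epsilon> = \<epsilon>
            and \<eta> = \<eta> and D = D and ?t0.0 = t0 and ?K1.0 = K1])
        fix s assume "s \<le> T"
        then have "s \<le> T1" using T(1) by simp
        then show "\<phi>' s < \<delta>" "\<psi>' s < \<delta>" "\<phi>' s \<le> C * exp (l / 2 * s)" "\<psi>' s \<le> C * exp (l / 2 * s)"
          using le by blast+
        show "\<bar>\<phi>' s - \<psi>' s\<bar> * exp (- ((l - \<epsilon>) * s)) \<le> (\<phi>' t0 - \<psi>' t0) * exp (- ((l - \<epsilon>) * t0))"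
          using t0(2)[OF \<open>s \<le> T\<close>] pos unfolding f by simp
      qed (use Te[of T] T(1) \<epsilon> \<eta> D cond C t0 pos eq in \<open>auto simp: T1_def K1_def y0_def\<close>)
    qed
    have "\<not> \<phi> t0 > \<psi> t0"
      by (rule sign[OF \<phi> \<psi> lim _ _ _ T(2)]) (use small \<phi>_le \<psi>_le in \<open>blast, blast, simp add: f_def\<close>)
    moreover have "\<not> \<psi> t0 > \<phi> t0"
      by (rule sign[OF \<psi> \<phi> lim' _ _ _ T(2)[symmetric]]) 
        (use small \<phi>_le \<psi>_le in \<open>blast, blast, simp add: f_def abs_minus_commute\<close>)
    ultimately show False using \<open>f t0 > 0\<close> unfolding f_def by simp
  qed
  then show ?thesis using that by blast
qed

text \<open>On a short interval the maximum of \<open>\<bar>w'\<bar>\<close> bounds \<open>w\<close>, hence \<open>w''\<close>, hence at most half of itself.\<close>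

lemma profile_continuation:
  assumes \<phi>: "profile \<phi> \<phi>1 \<phi>2" and \<psi>: "profile \<psi> \<psi>1 \<psi>2"
    and eq: "\<And>t. t \<le> T \<Longrightarrow> \<phi> t = \<psi> t"
  shows "\<phi> t = \<psi> t"
proof -
  define w w1 w2 where "w = (\<lambda>t. \<phi> t - \<psi> t)" "w1 = (\<lambda>t. \<phi>1 t - \<psi>1 t)" "w2 = (\<lambda>t. \<phi>2 t - \<psi>2 t)"
  have w: "(w has_real_derivative w1 t) (at t)" for t
    unfolding w_w1_w2_def by (intro derivative_intros DERIV_profile[OF \<phi>] DERIV_profile[OF \<psi>])
  have w1: "(w1 has_real_derivative w2 t) (at t)" for t
    unfolding w_w1_w2_def by (intro derivative_intros DERIV_profile1[OF \<phi>] DERIV_profile1[OF \<psi>])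
  define H where "H = c + 1 + L"
  have "H \<ge> 1" unfolding H_def using c_pos L_nonneg by simp
  define r where "r = 1 / (2 * H)"
  have r: "0 < r" "r \<le> 1" "r * H = 1 / 2" unfolding r_def using \<open>H \<ge> 1\<close> by (auto simp: field_simps)
  have w2_le: "\<bar>w2 t\<bar> \<le> c * \<bar>w1 t\<bar> + \<bar>w t\<bar> + L * \<bar>w (t - d)\<bar>" for t
  proof -
    have "w2 t = c * w1 t + w t - (g (\<phi> (t - d)) - g (\<psi> (t - d)))"
      unfolding w_w1_w2_def by (simp add: profile_eq[OF \<phi>] profile_eq[OF \<psi>] algebra_simps)
    moreover have "\<bar>g (\<phi> (t - d)) - g (\<psi> (t - d))\<bar> \<le> L * \<bar>w (t - d)\<bar>"
      unfolding w_w1_w2_def using profile_pos[OF \<phi>] profile_pos[OF \<psi>]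
      by (intro g_lipschitz) (auto simp: less_imp_le)
    moreover have "\<bar>c * w1 t\<bar> = c * \<bar>w1 t\<bar>" using c_pos by (simp add: abs_mult)
    ultimately show ?thesis by linarith
  qed
  have step: "w t = 0" if zero: "\<And>t. t \<le> s \<Longrightarrow> w t = 0" and t: "t \<le> s + r / 2" for s t
  proof -
    \<comment> \<open>\<open>a\<close> lies inside the region where \<open>w\<close> vanishes, so
      its derivative vanishes there too; an interval of length \<open>r\<close> from
      \<open>a\<close> still reaches \<open>r / 2\<close> beyond \<open>s\<close>.\<close>
    define a where "a = s - r / 2"
    have "w1 a = 0"
    proof -
      have "((\<lambda>_. 0) has_real_derivative w1 a) (at a)"
        by (rule has_field_derivative_transform_within_open[OF w, where S = "{..<s}"])
          (use zero r in \<open>auto simp: a_def\<close>)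
      then show ?thesis using DERIV_unique DERIV_const by blast
    qed
    have "continuous_on {a..a + r} (\<lambda>t. \<bar>w1 t\<bar>)"
      by (intro continuous_on_rabs continuous_on_subset[OF continuous_of_DERIV[OF w1]]) simp
    then obtain \<tau> where \<tau>: "\<tau> \<in> {a..a + r}" "\<And>t. t \<in> {a..a + r} \<Longrightarrow> \<bar>w1 t\<bar> \<le> \<bar>w1 \<tau>\<bar>"
      using continuous_attains_sup[of "{a..a + r}" "\<lambda>t. \<bar>w1 t\<bar>"] r by auto
    define m where "m = \<bar>w1 \<tau>\<bar>"
    have wm: "\<bar>w t\<bar> \<le> r * m" if "t \<le> a + r" for t
    proof (cases "t \<le> a")
      case True
      then have "w t = 0" using zero r unfolding a_def by auto
      then show ?thesis using r unfolding m_def by simp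
    next
      case False
      obtain \<xi> where \<xi>: "a < \<xi>" "\<xi> < t" "w t - w a = (t - a) * w1 \<xi>"
        using MVT2[of a t w w1] w False by auto
      moreover have "w a = 0" using zero r unfolding a_def by auto
      ultimately have "\<bar>w t\<bar> = (t - a) * \<bar>w1 \<xi>\<bar>" using False by (simp add: abs_mult)
      also have "\<dots> \<le> r * m" using \<tau>(2)[of \<xi>] \<xi> that False r unfolding m_def by (intro mult_mono) auto
      finally show ?thesis .
    qed
    have m_le: "m \<le> m / 2"
    proof (cases "\<tau> = a")
      case True
      then show ?thesis using \<open>w1 a = 0\<close> unfolding m_def by simp
    next
      case False
      then have "a < \<tau>" using \<tau>(1) by simp
      then obtain \<xi> where \<xi>: "a < \<xi>" "\<xi> < \<tau>" "w1 \<tau> - w1 a = (\<tau> - a) * w2 \<xi>"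
        using MVT2[of a \<tau> w1 w2] w1 by auto
      have "r * m \<le> m" using r unfolding m_def by (simp add: mult_left_le_one_le)
      have "\<bar>w2 \<xi>\<bar> \<le> c * \<bar>w1 \<xi>\<bar> + \<bar>w \<xi>\<bar> + L * \<bar>w (\<xi> - d)\<bar>" by (rule w2_le)
      also have "\<dots> \<le> c * m + m + L * m"
      proof (intro add_mono mult_left_mono)
        show "\<bar>w1 \<xi>\<bar> \<le> m" using \<tau>(2)[of \<xi>] \<xi> \<tau>(1) unfolding m_def by simp
        show "\<bar>w \<xi>\<bar> \<le> m" using wm[of \<xi>] \<xi> \<tau>(1) \<open>r * m \<le> m\<close> by simp
        show "\<bar>w (\<xi> - d)\<bar> \<le> m" using wm[of "\<xi> - d"] \<xi> \<tau>(1) \<open>r * m \<le> m\<close> d_nonneg by simp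
      qed (use c_pos L_nonneg in auto)
      also have "\<dots> = H * m" unfolding H_def by (simp add: algebra_simps)
      finally have "\<bar>w2 \<xi>\<bar> \<le> H * m" .
      then have "(\<tau> - a) * \<bar>w2 \<xi>\<bar> \<le> r * (H * m)"
        using \<tau>(1) \<open>a < \<tau>\<close> r by (intro mult_mono) auto
      moreover have "m = (\<tau> - a) * \<bar>w2 \<xi>\<bar>"
        using \<xi>(3) \<open>w1 a = 0\<close> \<open>a < \<tau>\<close> unfolding m_def by (simp add: abs_mult)
      ultimately show ?thesis using r(3) by (metis mult.assoc mult.commute mult_1 times_divide_eq_right)
    qed
    then have "m = 0" unfolding m_def by simp
    then show ?thesis using wm[of t] t unfolding a_def by simp
  qed
  have "w t = 0" if "t \<le> T + of_nat n * (r / 2)" for n t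
    using that
  proof (induction n arbitrary: t)
    case 0
    then show ?case using eq[of t] unfolding w_w1_w2_def by simp
  next
    case (Suc n)
    show ?case
      by (rule step[of "T + of_nat n * (r / 2)"]) (use Suc in \<open>auto simp: algebra_simps add_divide_distrib\<close>)
  qed
  moreover obtain n where "of_nat n * (r / 2) > t - T"
    using reals_Archimedean3[of "r / 2"] r by (meson half_gt_zero)
  ultimately have "w t = 0" by (metis add.commute diff_less_eq less_imp_le)
  then show ?thesis unfolding w_w1_w2_def by simp
qed

lemma profile_uniqueness:
  assumes \<phi>: "profile \<phi> \<phi>1 \<phi>2" and \<psi>: "profile \<psi> \<psi>1 \<psi>2"
  shows "\<exists>\<tau>. \<forall>t. \<phi> (t + \<tau>) = \<psi> t"
proof -
  obtain e where e: "(E l p \<phi> \<phi>1 \<longlongrightarrow> e) at_bot" "e < 0" using E_profile_limit[OF \<phi>] by blast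
  obtain f where f: "(E l p \<psi> \<psi>1 \<longlongrightarrow> f) at_bot" "f < 0" using E_profile_limit[OF \<psi>] by blast
  define \<tau> where "\<tau> = ln (f / e) / l"
  have "f / e > 0" using e f by (simp add: divide_neg_neg)
  then have \<tau>: "exp (l * \<tau>) * e = f" unfolding \<tau>_def using l_pos e by simp
  define w w1 w2 where "w = (\<lambda>t. \<phi> (t + \<tau>))" "w1 = (\<lambda>t. \<phi>1 (t + \<tau>))" "w2 = (\<lambda>t. \<phi>2 (t + \<tau>))"
  have w: "profile w w1 w2" unfolding w_w1_w2_def by (rule profile_shift[OF \<phi>])
  have "filterlim (\<lambda>t::real. t + \<tau>) at_bot at_bot" by real_asymp
  then have "((\<lambda>t. E l p \<phi> \<phi>1 (t + \<tau>)) \<longlongrightarrow> e) at_bot"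
    by (rule filterlim_compose[OF e(1)])
  then have "((\<lambda>t. exp (l * \<tau>) * E l p \<phi> \<phi>1 (t + \<tau>)) \<longlongrightarrow> exp (l * \<tau>) * e) at_bot"
    by (intro tendsto_intros)
  then have limw: "(E l p w w1 \<longlongrightarrow> f) at_bot"
    unfolding w_w1_w2_def \<tau> E_shift[OF DERIV_profile[OF \<phi>], symmetric] by simp
  have lim: "(Ed w w1 \<psi> \<psi>1 \<longlongrightarrow> 0) at_bot"
    using tendsto_diff[OF limw f(1)]
    unfolding E_diff[OF DERIV_profile[OF w] DERIV_profile[OF \<psi>], symmetric] by simp
  have lim': "(Ed \<psi> \<psi>1 w w1 \<longlongrightarrow> 0) at_bot" by (rule Ed_tendsto_swap[OF w \<psi> lim])
  obtain T1 where T1: "\<And>T t. T \<le> T1 \<Longrightarrow> w T = \<psi> T \<Longrightarrow> t \<le> T \<Longrightarrow> w t = \<psi> t"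
    using profile_left_uniqueness[OF w \<psi> lim] by blast
  have "\<exists>T\<le>T1. w T = \<psi> T"
  proof (rule ccontr)
    assume "\<not> (\<exists>T\<le>T1. w T = \<psi> T)"
    then have ne: "w t - \<psi> t \<noteq> 0" if "t \<le> T1" for t using that by auto
    have cont: "isCont (\<lambda>t. w t - \<psi> t) t" for t
      using DERIV_isCont[OF DERIV_profile[OF w]] DERIV_isCont[OF DERIV_profile[OF \<psi>]]
      by (intro continuous_intros)
    have same: "\<not> ((w t - \<psi> t \<le> 0 \<and> 0 \<le> w T1 - \<psi> T1) \<or> (0 \<le> w t - \<psi> t \<and> w T1 - \<psi> T1 \<le> 0))" if "t \<le> T1" for t
    proof
      assume "(w t - \<psi> t \<le> 0 \<and> 0 \<le> w T1 - \<psi> T1) \<or> (0 \<le> w t - \<psi> t \<and> w T1 - \<psi> T1 \<le> 0)"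
      then have "\<exists>x\<ge>t. x \<le> T1 \<and> w x - \<psi> x = 0"
        using IVT[of "\<lambda>t. w t - \<psi> t" t 0 T1] IVT2[of "\<lambda>t. w t - \<psi> t" T1 0 t] cont that by blast
      then show False using ne by auto
    qed
    show False
    proof (cases "w T1 > \<psi> T1")
      case True
      show False by (rule profile_ordered_absurd[OF w \<psi> lim, of T1]) (use same True in force)
    next
      case False
      show False by (rule profile_ordered_absurd[OF \<psi> w lim', of T1]) (use same False in force)
    qed
  qed
  then obtain T where "T \<le> T1" "w T = \<psi> T" by blast
  then have "w t = \<psi> t" for t
    using profile_continuation[OF w \<psi>, of T] T1 by blast
  then show ?thesis unfolding w_w1_w2_def by blast
qed

end

section \<open>Initial value problems with delay\<close>

text \<open>The weight grows at twice the rate \<open>B\<close>, so integrating it gains the factor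
  1/2.\<close>

lemma integral_exp_bound:
  fixes f :: "real \<Rightarrow> 'a::euclidean_space"
  assumes cont: "continuous_on UNIV f" and "t0 \<le> t" "B > 0" "D \<ge> 0"
    and le: "\<And>s. t0 \<le> s \<Longrightarrow> s \<le> t \<Longrightarrow> norm (f s) \<le> B * D * exp (2 * B * (s - t0))"
  shows "norm (integral {t0..t} f) \<le> D / 2 * exp (2 * B * (t - t0))"
proof -
  have int: "((\<lambda>s. B * D * exp (2 * B * (s - t0))) has_integral
      D / 2 * exp (2 * B * (t - t0)) - D / 2 * exp (2 * B * (t0 - t0))) {t0..t}"
    using \<open>B > 0\<close>
    by (intro fundamental_theorem_of_calculus \<open>t0 \<le> t\<close>)
      (auto intro!: derivative_eq_intros simp: has_real_derivative_iff_has_vector_derivative[symmetric])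
  have "norm (integral {t0..t} f) \<le> integral {t0..t} (\<lambda>s. B * D * exp (2 * B * (s - t0)))"
  proof (rule integral_norm_bound_integral)
    show "f integrable_on {t0..t}"
      using cont continuous_on_subset integrable_continuous_interval by blast
    show "(\<lambda>s. B * D * exp (2 * B * (s - t0))) integrable_on {t0..t}"
      using int by blast
  qed (use le in auto)
  also have "\<dots> = D / 2 * exp (2 * B * (t - t0)) - D / 2"
    using integral_unique[OF int] by simp
  finally show ?thesis using \<open>D \<ge> 0\<close> by simp
qed

text \<open>The Lipschitz condition makes \<open>N\<close> causal, and its exponential weight makes the Picard map
  contract by the factor \<open>1 / 2\<close>.\<close>

locale causal_functional =
  fixes N :: "(real \<Rightarrow> 'a) \<Rightarrow> real \<Rightarrow> 'a::euclidean_space" and B t0 :: real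
  assumes B_pos: "B > 0"
    and N_cont: "\<And>X. continuous_on UNIV X \<Longrightarrow> continuous_on UNIV (N X)"
    and N_lipschitz: "\<And>X Y D s. D \<ge> 0 \<Longrightarrow> t0 \<le> s \<Longrightarrow>
      (\<And>r. r \<le> s \<Longrightarrow> norm (X r - Y r) \<le> D * exp (2 * B * (r - t0))) \<Longrightarrow>
      norm (N X s - N Y s) \<le> B * D * exp (2 * B * (s - t0))"
begin

text \<open>One formula serves both sides of \<open>t0\<close>: to the left the interval of
  integration is empty and the history \<open>H\<close> remains.\<close>

definition picard where
  "picard H X t = H (min t t0) + integral {t0..t} (N X)"

lemma picard_left: "t \<le> t0 \<Longrightarrow> picard H X t = H t"
  by (cases "t = t0") (auto simp: picard_def)

lemma picard_cont:
  assumes "continuous_on UNIV H" "continuous_on UNIV X"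
  shows "continuous_on UNIV (picard H X)"
proof -
  have "isCont (\<lambda>t. integral {t0..t} (N X)) t" for t
  proof (cases "t < t0")
    case True
    then have "eventually (\<lambda>s. integral {t0..s} (N X) = 0) (nhds t)"
      using eventually_nhds_in_open[of "{..<t0}" t] by (auto elim: eventually_mono)
    then show ?thesis by (simp add: isCont_cong)
  next
    case False
    \<comment> \<open>Integration starts at \<open>t0 - 1\<close> so that \<open>t0\<close> itself
      is an interior point.\<close>
    have "continuous_on {t0 - 1..t + 1} (\<lambda>t. integral {t0 - 1..t} (N X))"
      using N_cont[OF assms(2)]
      by (intro indefinite_integral_continuous_1 integrable_continuous_interval)
        (rule continuous_on_subset, auto)
    then have "isCont (\<lambda>t. integral {t0 - 1..t} (N X)) t"
      using False by (intro continuous_on_interior) auto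
    then have c: "isCont (\<lambda>s. integral {t0 - 1..s} (N X) - integral {t0 - 1..t0} (N X)) t"
      by (intro continuous_intros)
    have eq: "integral {t0..s} (N X) = integral {t0 - 1..s} (N X) - integral {t0 - 1..t0} (N X)"
      if "t0 \<le> s" for s
      using Henstock_Kurzweil_Integration.integral_combine[of "t0 - 1" t0 s "N X"] that
        N_cont[OF assms(2)] continuous_on_subset integrable_continuous_interval
      by (smt (verit) add_diff_cancel_left' subset_UNIV)
    define J where "J = (\<lambda>s. integral {t0 - 1..max s t0} (N X) - integral {t0 - 1..t0} (N X))"
    have "integral {t0..s} (N X) = J s" for s
      using eq[of s] unfolding J_def by (cases "t0 \<le> s") (auto simp: max_def)
    moreover have "isCont (\<lambda>s. max s t0) t" by (intro continuous_intros)
    moreover have "max t t0 = t" using False by simp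
    ultimately show ?thesis
      using isCont_o2[of t "\<lambda>s. max s t0" "\<lambda>s. integral {t0 - 1..s} (N X) - integral {t0 - 1..t0} (N X)"] c
      unfolding J_def by simp
  qed
  then have "continuous_on UNIV (\<lambda>t. integral {t0..t} (N X))"
    by (simp add: continuous_at_imp_continuous_on)
  moreover have "continuous_on UNIV (\<lambda>t. H (min t t0))"
    by (rule continuous_on_compose2[OF assms(1)]) (auto intro!: continuous_intros)
  ultimately show ?thesis unfolding picard_def[abs_def] by (intro continuous_intros)
qed

lemma picard_contraction:
  assumes "continuous_on UNIV X" "continuous_on UNIV Y" "D \<ge> 0" "D' \<ge> 0"
    and H: "\<And>t. t \<le> t0 \<Longrightarrow> norm (H t - H' t) \<le> D' * exp (2 * B * (t - t0))"
    and XY: "\<And>r. r \<le> t \<Longrightarrow> norm (X r - Y r) \<le> D * exp (2 * B * (r - t0))"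
  shows "norm (picard H X t - picard H' Y t) \<le> (D' + D / 2) * exp (2 * B * (t - t0))"
proof (cases "t \<le> t0")
  case True
  have "D' * exp (2 * B * (t - t0)) \<le> (D' + D / 2) * exp (2 * B * (t - t0))"
    using assms by (intro mult_right_mono) auto
  then show ?thesis using H[OF True] unfolding picard_left[OF True] by linarith
next
  case False
  have "norm (integral {t0..t} (\<lambda>s. N X s - N Y s)) \<le> D / 2 * exp (2 * B * (t - t0))"
    by (rule integral_exp_bound)
      (use assms B_pos False XY in \<open>auto intro!: continuous_intros N_cont N_lipschitz\<close>)
  moreover have "integral {t0..t} (\<lambda>s. N X s - N Y s) = integral {t0..t} (N X) - integral {t0..t} (N Y)"
    using N_cont assms(1,2) continuous_on_subset
    by (intro integral_diff integrable_continuous_interval) blast+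
  moreover have "norm (H t0 - H' t0) \<le> D' * exp (2 * B * (t - t0))"
  proof -
    have "D' * 1 \<le> D' * exp (2 * B * (t - t0))"
      using False B_pos assms by (intro mult_left_mono) auto
    then show ?thesis using H[of t0] by simp
  qed
  moreover have "picard H X t - picard H' Y t = (H t0 - H' t0) + (integral {t0..t} (N X) - integral {t0..t} (N Y))"
    using False by (simp add: picard_def)
  moreover have "(D' + D / 2) * exp (2 * B * (t - t0)) =
      D' * exp (2 * B * (t - t0)) + D / 2 * exp (2 * B * (t - t0))"
    by (rule distrib_right)
  ultimately show ?thesis
    using norm_triangle_ineq[of "H t0 - H' t0" "integral {t0..t} (N X) - integral {t0..t} (N Y)"]
    by (simp only:)
qed

definition iter where
  "iter H k = (picard H ^^ k) (\<lambda>t. H (min t t0))"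

lemma iter_0: "iter H 0 = (\<lambda>t. H (min t t0))"
  and iter_Suc: "iter H (Suc k) = picard H (iter H k)"
  unfolding iter_def by simp_all

lemma iter_cont:
  assumes "continuous_on UNIV H"
  shows "continuous_on UNIV (iter H k)"
proof (induction k)
  case 0
  show ?case unfolding iter_0
    by (rule continuous_on_compose2[OF assms]) (auto intro!: continuous_intros)
qed (simp add: iter_Suc picard_cont assms)

lemma iter_step:
  assumes "continuous_on UNIV H" "C \<ge> 0"
    and C: "\<And>s. t0 \<le> s \<Longrightarrow> norm (N (iter H 0) s) \<le> B * C * exp (2 * B * (s - t0))"
  shows "norm (iter H (Suc k) t - iter H k t) \<le> C * (1 / 2) ^ k * exp (2 * B * (t - t0))"
proof (induction k arbitrary: t)
  case 0
  have "norm (integral {t0..t} (N (iter H 0))) \<le> C * exp (2 * B * (t - t0))"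
  proof (cases "t0 \<le> t")
    case True
    have "norm (integral {t0..t} (N (iter H 0))) \<le> C / 2 * exp (2 * B * (t - t0))"
      by (rule integral_exp_bound) (use True assms B_pos iter_cont[OF assms(1), of 0] in \<open>auto intro!: N_cont C\<close>)
    also have "\<dots> \<le> C * exp (2 * B * (t - t0))" using \<open>C \<ge> 0\<close> by (intro mult_right_mono) auto
    finally show ?thesis .
  qed (use \<open>C \<ge> 0\<close> in simp)
  then show ?case by (simp add: iter_Suc picard_def) (simp add: iter_0)
next
  case (Suc k)
  have "norm (picard H (iter H (Suc k)) t - picard H (iter H k) t) \<le>
      (0 + C * (1 / 2) ^ k / 2) * exp (2 * B * (t - t0))"
    by (rule picard_contraction) (use assms iter_cont Suc in auto)
  then show ?case by (simp add: iter_Suc)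
qed

lemma solution_exists:
  assumes H: "continuous_on UNIV H" and "C \<ge> 0"
    and C: "\<And>s. t0 \<le> s \<Longrightarrow> norm (N (iter H 0) s) \<le> B * C * exp (2 * B * (s - t0))"
  obtains X where "continuous_on UNIV X" "\<And>t. X t = picard H X t" "\<And>t. (\<lambda>k. iter H k t) \<longlonglongrightarrow> X t"
proof -
  define w where "w = (\<lambda>t. exp (2 * B * (t - t0)))"
  have w_pos: "w t > 0" for t unfolding w_def by simp
  have diff: "norm (iter H (m + n) t - iter H m t) \<le> 2 * C * (1 / 2) ^ m * w t" for m n t
  proof -
    \<comment> \<open>The geometric sum keeps its remainder, which the induction on \<open>n\<close>
      needs in order to close.\<close>
    have "norm (iter H (m + n) t - iter H m t) \<le> C * ((1 / 2) ^ m + (1 / 2) ^ m - 2 * (1 / 2) ^ (m + n)) * w t"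
    proof (induction n)
      case (Suc n)
      have "norm (iter H (Suc (m + n)) t - iter H m t) \<le>
          norm (iter H (Suc (m + n)) t - iter H (m + n) t) + norm (iter H (m + n) t - iter H m t)"
        using norm_triangle_ineq[of "iter H (Suc (m + n)) t - iter H (m + n) t" "iter H (m + n) t - iter H m t"] by simp
      also have "\<dots> \<le> C * (1 / 2) ^ (m + n) * w t + C * ((1 / 2) ^ m + (1 / 2) ^ m - 2 * (1 / 2) ^ (m + n)) * w t"
        using iter_step[OF assms, of "m + n" t] Suc unfolding w_def by (intro add_mono) auto
      also have "\<dots> = C * ((1 / 2) ^ m + (1 / 2) ^ m - 2 * (1 / 2) ^ (m + Suc n)) * w t"
        by (simp add: algebra_simps)
      finally show ?case by simp
    qed simp
    also have "\<dots> \<le> 2 * C * (1 / 2) ^ m * w t"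
      using \<open>C \<ge> 0\<close> w_pos[of t] by (simp add: algebra_simps)
    finally show ?thesis .
  qed
  have conv0: "(\<lambda>m. 2 * C * (1 / 2) ^ m * W) \<longlonglongrightarrow> 0" for W :: real
    using tendsto_mult[OF tendsto_mult[OF tendsto_const[of "2 * C"] LIMSEQ_power_zero[of "1 / 2 :: real"]] tendsto_const[of W]] by simp
  have "convergent (\<lambda>k. iter H k t)" for t
  proof (intro Cauchy_convergent CauchyI)
    fix e :: real assume "e > 0"
    then have "eventually (\<lambda>m. 2 * C * (1 / 2) ^ m * w t < e) sequentially"
      using order_tendstoD(2)[OF conv0] by blast
    then obtain M0 where M0: "\<And>m. m \<ge> M0 \<Longrightarrow> 2 * C * (1 / 2) ^ m * w t < e"
      unfolding eventually_sequentially by blast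
    have less: "norm (iter H m t - iter H n t) < e" if "m \<ge> M0" "m \<le> n" for m n
      using diff[of m "n - m" t] M0[OF that(1)] that by (simp add: norm_minus_commute)
    have "norm (iter H m t - iter H n t) < e" if "m \<ge> M0" "n \<ge> M0" for m n
      using less[of m n] less[of n m] that by (cases m n rule: le_cases) (auto simp: norm_minus_commute)
    then show "\<exists>M. \<forall>m\<ge>M. \<forall>n\<ge>M. norm (iter H m t - iter H n t) < e" by blast
  qed
  then obtain X where X: "\<And>t. (\<lambda>k. iter H k t) \<longlonglongrightarrow> X t"
    unfolding convergent_def by metis
  have X_diff: "norm (X t - iter H m t) \<le> 2 * C * (1 / 2) ^ m * w t" for m t
  proof (rule tendsto_upperbound)
    show "((\<lambda>n. norm (iter H (n + m) t - iter H m t)) \<longlongrightarrow> norm (X t - iter H m t)) sequentially"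
      by (intro tendsto_intros LIMSEQ_ignore_initial_segment X)
    show "\<forall>\<^sub>F n in sequentially. norm (iter H (n + m) t - iter H m t) \<le> 2 * C * (1 / 2) ^ m * w t"
      using diff[of m _ t] by (simp add: add.commute)
  qed simp
  have cont: "isCont X t" for t
  proof -
    have "uniform_limit {..t + 1} (iter H) X sequentially"
    proof (rule uniform_limitI)
      fix e :: real assume "e > 0"
      then have "eventually (\<lambda>m. 2 * C * (1 / 2) ^ m * w (t + 1) < e) sequentially"
        using order_tendstoD(2)[OF conv0] by blast
      then show "\<forall>\<^sub>F m in sequentially. \<forall>x\<in>{..t + 1}. dist (iter H m x) (X x) < e"
      proof eventually_elim
        case (elim m)
        show ?case
        proof
          fix x assume "x \<in> {..t + 1}"
          then have "w x \<le> w (t + 1)" unfolding w_def using B_pos by simp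
          then have "2 * C * (1 / 2) ^ m * w x \<le> 2 * C * (1 / 2) ^ m * w (t + 1)"
            using \<open>C \<ge> 0\<close> by (intro mult_left_mono) auto
          then show "dist (iter H m x) (X x) < e"
            using X_diff[of x m] elim by (simp add: dist_norm norm_minus_commute)
        qed
      qed
    qed
    then have "continuous_on {..t + 1} X"
      by (rule uniform_limit_theorem[rotated])
        (auto intro!: always_eventually continuous_on_subset[OF iter_cont[OF H]])
    then show ?thesis by (rule continuous_on_interior) simp
  qed
  then have contX: "continuous_on UNIV X" by (simp add: continuous_at_imp_continuous_on)
  have "X t = picard H X t" for t
  proof -
    have le: "norm (picard H X t - iter H (Suc m) t) \<le> 2 * C * (1 / 2) ^ m * w t" for m
    proof -
      have "norm (picard H X t - picard H (iter H m) t) \<le> (0 + (2 * C * (1 / 2) ^ m) / 2) * exp (2 * B * (t - t0))"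
        by (rule picard_contraction)
          (use contX iter_cont[OF H] \<open>C \<ge> 0\<close> X_diff in \<open>auto simp: w_def\<close>)
      also have "\<dots> \<le> 2 * C * (1 / 2) ^ m * w t"
        unfolding w_def using \<open>C \<ge> 0\<close> by (intro mult_right_mono) auto
      finally show ?thesis by (simp add: iter_Suc)
    qed
    have "(\<lambda>m. picard H X t - iter H (Suc m) t) \<longlonglongrightarrow> 0"
      by (rule Lim_null_comparison[OF _ conv0[of "w t"]]) (use le in auto)
    moreover have "(\<lambda>m. picard H X t - iter H (Suc m) t) \<longlonglongrightarrow> picard H X t - X t"
      by (intro tendsto_intros LIMSEQ_Suc X)
    ultimately have "picard H X t - X t = 0" using LIMSEQ_unique by blast
    then show ?thesis by simp
  qed
  then show ?thesis using that[of X] contX X by blast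
qed

text \<open>The constant \<open>2 * D\<close> solves \<open>x = D + x / 2\<close>. The bound is
  uniform in \<open>k\<close>, so it passes to the solutions obtained as limits of the
  iterates.\<close>

lemma iter_dependence:
  assumes "continuous_on UNIV H" "continuous_on UNIV H'" "D \<ge> 0"
    and H: "\<And>t. t \<le> t0 \<Longrightarrow> norm (H t - H' t) \<le> D * exp (2 * B * (t - t0))"
  shows "norm (iter H k t - iter H' k t) \<le> 2 * D * exp (2 * B * (t - t0))"
proof (induction k arbitrary: t)
  case 0
  have "exp (2 * B * (min t t0 - t0)) \<le> exp (2 * B * (t - t0))"
    using B_pos by (intro exp_le_cancel_iff[THEN iffD2] mult_left_mono) auto
  then have "D * exp (2 * B * (min t t0 - t0)) \<le> 2 * D * exp (2 * B * (t - t0))"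
    using \<open>D \<ge> 0\<close> by (intro mult_mono) auto
  then show ?case using H[of "min t t0"] by (simp add: iter_0)
next
  case (Suc k)
  have "norm (picard H (iter H k) t - picard H' (iter H' k) t) \<le> (D + 2 * D / 2) * exp (2 * B * (t - t0))"
    by (rule picard_contraction) (use assms iter_cont Suc in auto)
  then show ?case by (simp add: iter_Suc)
qed

end

section \<open>Existence\<close>

lemma DERIV_of_integral_equation:
  fixes f F :: "real \<Rightarrow> real"
  assumes cont: "continuous_on UNIV f" and "t0 < t"
    and F: "\<And>s. t0 \<le> s \<Longrightarrow> F s = a + integral {t0..s} f"
  shows "(F has_real_derivative f t) (at t)"
proof -
  obtain A where A: "\<And>t. (A has_real_derivative f t) (at t)"
    using antiderivative_exists[OF cont] by blast
  have "((\<lambda>s. a + (A s - A t0)) has_real_derivative f t) (at t)"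
    by (auto intro!: derivative_eq_intros A)
  then show ?thesis
  proof (rule has_field_derivative_transform_within_open[where S = "{t0<..}"])
    fix s assume "s \<in> {t0<..}"
    then show "a + (A s - A t0) = F s"
      using window_integral_eq[OF A, of "s - t0" s] F[of s] by simp
  qed (use assms in auto)
qed

context delayed_wave
begin

lemma g_max_lipschitz: "\<bar>g (max x 0) - g (max y 0)\<bar> \<le> L * \<bar>x - y\<bar>"
proof -
  have "\<bar>g (max x 0) - g (max y 0)\<bar> \<le> L * \<bar>max x 0 - max y 0\<bar>" by (rule g_lipschitz) auto
  also have "\<dots> \<le> L * \<bar>x - y\<bar>" using L_nonneg by (intro mult_left_mono) auto
  finally show ?thesis .
qed

lemma g_max_cont:
  assumes "continuous_on UNIV f"
  shows "continuous_on UNIV (\<lambda>t. g (max (f t) 0))"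
proof -
  have "L-lipschitz_on UNIV (\<lambda>x. g (max x 0))"
    by (rule lipschitz_onI) (use g_max_lipschitz L_nonneg in \<open>auto simp: dist_real_def\<close>)
  then have "continuous_on UNIV (\<lambda>x. g (max x 0))" by (rule lipschitz_on_continuous_on)
  then show ?thesis by (rule continuous_on_compose2[OF _ assms]) simp
qed

text \<open>The equation factors as \<open>(D - \<nu>) (D - \<mu>) \<phi> = - g(\<phi>(\<cdot> - d))\<close>; here \<open>u = (D - \<mu>) \<phi>\<close>, with initial value \<open>u0\<close>.\<close>

lemma initial_value_problem:
  fixes \<theta> :: "real \<Rightarrow> real"
  assumes \<theta>: "continuous_on UNIV \<theta>"
  obtains \<phi> u where
    "\<And>u0. continuous_on UNIV (\<phi> u0)" "\<And>u0. continuous_on UNIV (u u0)"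
    "\<And>u0 t. t \<le> t0 \<Longrightarrow> \<phi> u0 t = \<theta> t" "\<And>u0. u u0 t0 = u0"
    "\<And>u0 t. t0 < t \<Longrightarrow> (\<phi> u0 has_real_derivative \<mu> * \<phi> u0 t + u u0 t) (at t)"
    "\<And>u0 t. t0 < t \<Longrightarrow> (u u0 has_real_derivative \<nu> * u u0 t - g (max (\<phi> u0 (t - d)) 0)) (at t)"
    "\<And>t. continuous_on UNIV (\<lambda>u0. u u0 t)"
proof -
  \<comment> \<open>\<open>g\<close> is meaningful only at nonnegative arguments, hence the
    truncation; \<open>half_line_solution\<close> removes it after showing
    \<open>\<phi> \<ge> 0\<close>.\<close>
  define N where "N = (\<lambda>(X :: real \<Rightarrow> real \<times> real) s.
    (\<mu> * fst (X s) + snd (X s), \<nu> * snd (X s) - g (max (fst (X (s - d))) 0)))"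
  define B where "B = \<bar>\<mu>\<bar> + 1 + \<nu> + L"
  have B: "B > 0" unfolding B_def using \<nu>_pos L_nonneg by simp
  have norm_pair: "norm (a, b) \<le> \<bar>a\<bar> + \<bar>b\<bar>" for a b :: real
    using sqrt_sum_squares_le_sum_abs[of a b] by (simp add: norm_Pair)
  interpret causal_functional N B t0
  proof
    show "B > 0" by (rule B)
    show "continuous_on UNIV (N X)" if X: "continuous_on UNIV X" for X
    proof -
      have "continuous_on UNIV (\<lambda>s. X (s - d))"
        by (rule continuous_on_compose2[OF X]) (auto intro!: continuous_intros)
      then have "continuous_on UNIV (\<lambda>s. g (max (fst (X (s - d))) 0))"
        by (intro g_max_cont continuous_intros)
      then show ?thesis unfolding N_def by (intro continuous_intros X)
    qed
    fix X Y :: "real \<Rightarrow> real \<times> real" and D s assume D: "D \<ge> 0" "t0 \<le> s"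
      and XY: "\<And>r. r \<le> s \<Longrightarrow> norm (X r - Y r) \<le> D * exp (2 * B * (r - t0))"
    define n where "n = D * exp (2 * B * (s - t0))"
    have fst_le: "\<bar>fst (X r) - fst (Y r)\<bar> \<le> norm (X r - Y r)" for r
      by (metis fst_diff norm_fst_le prod.collapse real_norm_def)
    have snd_le: "\<bar>snd (X r) - snd (Y r)\<bar> \<le> norm (X r - Y r)" for r
      by (metis snd_diff norm_snd_le prod.collapse real_norm_def)
    have 1: "\<bar>fst (X s) - fst (Y s)\<bar> \<le> n" "\<bar>snd (X s) - snd (Y s)\<bar> \<le> n"
      using fst_le[of s] snd_le[of s] XY[of s] unfolding n_def by auto
    have "D * exp (2 * B * (s - d - t0)) \<le> n"
      unfolding n_def using D B d_nonneg by (intro mult_left_mono) auto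
    then have 2: "\<bar>fst (X (s - d)) - fst (Y (s - d))\<bar> \<le> n"
      using fst_le[of "s - d"] XY[of "s - d"] d_nonneg by simp
    define a1 a2 a3 a4 where "a1 = \<mu> * (fst (X s) - fst (Y s))" "a2 = snd (X s) - snd (Y s)"
      "a3 = \<nu> * (snd (X s) - snd (Y s))"
      "a4 = g (max (fst (X (s - d))) 0) - g (max (fst (Y (s - d))) 0)"
    have "\<bar>a1\<bar> \<le> \<bar>\<mu>\<bar> * n"
      unfolding a1_a2_a3_a4_def using 1 by (simp add: abs_mult mult_left_mono)
    moreover have "\<bar>a2\<bar> \<le> n" unfolding a1_a2_a3_a4_def by (rule 1(2))
    moreover have "\<bar>a3\<bar> \<le> \<nu> * n"
      unfolding a1_a2_a3_a4_def using 1 \<nu>_pos by (simp add: abs_mult mult_left_mono)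
    moreover have "L * \<bar>fst (X (s - d)) - fst (Y (s - d))\<bar> \<le> L * n"
      using 2 L_nonneg by (intro mult_left_mono)
    then have "\<bar>a4\<bar> \<le> L * n"
      unfolding a1_a2_a3_a4_def using g_max_lipschitz order_trans by blast
    moreover have "N X s - N Y s = (a1 + a2, a3 - a4)"
      unfolding N_def a1_a2_a3_a4_def by (simp add: algebra_simps)
    then have "norm (N X s - N Y s) \<le> \<bar>a1 + a2\<bar> + \<bar>a3 - a4\<bar>" by (simp only: norm_pair)
    ultimately have "norm (N X s - N Y s) \<le> \<bar>\<mu>\<bar> * n + n + (\<nu> * n + L * n)" by linarith
    then show "norm (N X s - N Y s) \<le> B * D * exp (2 * B * (s - t0))"
      unfolding B_def n_def by (simp add: algebra_simps)
  qed
  \<comment> \<open>Of the second component only the value at \<open>t0\<close> matters. Its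
    fictitious past decays to the left like the weight, so that the histories for two initial values
    satisfy the hypothesis of \<open>iter_dependence\<close> on the whole left half-line.\<close>
  define H where "H = (\<lambda>u0 t. (\<theta> t, u0 * exp (2 * B * (t - t0))))"
  have H_cont: "continuous_on UNIV (H u0)" for u0
    unfolding H_def by (intro continuous_intros \<theta>)
  have "\<exists>X. continuous_on UNIV X \<and> (\<forall>t. X t = picard (H u0) X t) \<and> (\<forall>t. (\<lambda>k. iter (H u0) k t) \<longlonglongrightarrow> X t)" for u0
  proof -
    define C where "C = (\<bar>\<mu>\<bar> * \<bar>\<theta> t0\<bar> + \<bar>u0\<bar> + (\<nu> * \<bar>u0\<bar> + M)) / B"
    have C: "C \<ge> 0" "B * C = \<bar>\<mu>\<bar> * \<bar>\<theta> t0\<bar> + \<bar>u0\<bar> + (\<nu> * \<bar>u0\<bar> + M)"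
      unfolding C_def using B \<nu>_pos M_ge_1 by (auto intro!: divide_nonneg_pos add_nonneg_nonneg)
    have "norm (N (iter (H u0) 0) s) \<le> B * C * exp (2 * B * (s - t0))" if "t0 \<le> s" for s
    proof -
      define y where "y = max (fst (H u0 (min (s - d) t0))) 0"
      have "N (iter (H u0) 0) s = (\<mu> * \<theta> t0 + u0, \<nu> * u0 - g y)"
        unfolding iter_0 y_def using that by (simp add: N_def[THEN fun_cong, THEN fun_cong] H_def)
      moreover have "\<bar>g y\<bar> \<le> M" using g_le[of y] g_nonneg[of y] unfolding y_def by simp
      moreover have "\<bar>\<mu> * \<theta> t0\<bar> = \<bar>\<mu>\<bar> * \<bar>\<theta> t0\<bar>" "\<bar>\<nu> * u0\<bar> = \<nu> * \<bar>u0\<bar>"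
        using \<nu>_pos by (auto simp: abs_mult)
      ultimately have "norm (N (iter (H u0) 0) s) \<le> B * C"
        using norm_pair[of "\<mu> * \<theta> t0 + u0" "\<nu> * u0 - g y"] unfolding C(2) by (simp only:) linarith
      also have "B * C * 1 \<le> B * C * exp (2 * B * (s - t0))"
        using B C(1) that by (intro mult_left_mono) auto
      finally show ?thesis by simp
    qed
    then show ?thesis using solution_exists[OF H_cont C(1)] by metis
  qed
  then obtain X where X: "\<And>u0. continuous_on UNIV (X u0)" "\<And>u0 t. X u0 t = picard (H u0) (X u0) t"
    "\<And>u0 t. (\<lambda>k. iter (H u0) k t) \<longlonglongrightarrow> X u0 t" by metis
  define \<phi> u where "\<phi> = (\<lambda>u0 t. fst (X u0 t))" "u = (\<lambda>u0 t. snd (X u0 t))"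
  have left: "X u0 t = H u0 t" if "t \<le> t0" for u0 t
    using X(2)[of u0 t] picard_left[OF that] by simp
  have int: "N (X u0) integrable_on {t0..t}" for u0 t
    using N_cont[OF X(1)] continuous_on_subset integrable_continuous_interval by blast
  have right: "X u0 t = H u0 t0 + integral {t0..t} (N (X u0))" if "t0 \<le> t" for u0 t
    using X(2)[of u0 t] that by (simp add: picard_def)
  have f: "\<phi> u0 t = fst (H u0 t0) + integral {t0..t} (\<lambda>s. \<mu> * \<phi> u0 s + u u0 s)" if "t0 \<le> t" for u0 t
    using integral_linear[OF int[of u0 t] bounded_linear_fst] right[OF that, of u0]
    unfolding \<phi>_u_def by (simp add: o_def N_def)
  have s: "u u0 t = snd (H u0 t0) + integral {t0..t} (\<lambda>s. \<nu> * u u0 s - g (max (\<phi> u0 (s - d)) 0))" if "t0 \<le> t" for u0 t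
    using integral_linear[OF int[of u0 t] bounded_linear_snd] right[OF that, of u0]
    unfolding \<phi>_u_def by (simp add: o_def N_def)
  have \<phi>_cont: "continuous_on UNIV (\<phi> u0)" and u_cont: "continuous_on UNIV (u u0)" for u0
    unfolding \<phi>_u_def by (intro continuous_intros X(1))+
  have shift_cont: "continuous_on UNIV (\<lambda>t. \<phi> u0 (t - d))" for u0
    by (rule continuous_on_compose2[OF \<phi>_cont]) (auto intro!: continuous_intros)
  show ?thesis
  proof (rule that[of \<phi> u])
    fix u0 t
    show "continuous_on UNIV (\<phi> u0)" by (rule \<phi>_cont)
    show "continuous_on UNIV (u u0)" by (rule u_cont)
    show "\<phi> u0 t = \<theta> t" if "t \<le> t0" using left[OF that] unfolding \<phi>_u_def H_def by simp
    show "u u0 t0 = u0" using left[of t0] unfolding \<phi>_u_def H_def by simp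
    show "(\<phi> u0 has_real_derivative \<mu> * \<phi> u0 t + u u0 t) (at t)" if "t0 < t"
      by (rule DERIV_of_integral_equation[OF _ that f]) (intro continuous_intros \<phi>_cont u_cont)
    show "(u u0 has_real_derivative \<nu> * u u0 t - g (max (\<phi> u0 (t - d)) 0)) (at t)" if "t0 < t"
      by (rule DERIV_of_integral_equation[OF _ that s])
        (intro continuous_intros g_max_cont shift_cont u_cont)
    show "continuous_on UNIV (\<lambda>u0. u u0 t)"
    proof -
      have dep: "norm (X a t - X b t) \<le> 2 * \<bar>a - b\<bar> * exp (2 * B * (t - t0))" for a b
      proof (rule tendsto_upperbound)
        show "((\<lambda>k. norm (iter (H a) k t - iter (H b) k t)) \<longlongrightarrow> norm (X a t - X b t)) sequentially"
          by (intro tendsto_intros X)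
        have "norm (iter (H a) k t - iter (H b) k t) \<le> 2 * \<bar>a - b\<bar> * exp (2 * B * (t - t0))" for k
        proof (rule iter_dependence[OF H_cont H_cont])
          fix s
          have "H a s - H b s = (0, (a - b) * exp (2 * B * (s - t0)))"
            unfolding H_def by (simp add: algebra_simps)
          then show "norm (H a s - H b s) \<le> \<bar>a - b\<bar> * exp (2 * B * (s - t0))"
            by (simp add: norm_Pair abs_mult)
        qed simp
        then show "\<forall>\<^sub>F k in sequentially. norm (iter (H a) k t - iter (H b) k t) \<le> 2 * \<bar>a - b\<bar> * exp (2 * B * (t - t0))"
          by simp
      qed simp
      have "(2 * exp (2 * B * (t - t0)))-lipschitz_on UNIV (\<lambda>u0. u u0 t)"
      proof (rule lipschitz_onI)
        fix a b
        have "\<bar>u a t - u b t\<bar> \<le> norm (X a t - X b t)"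
          unfolding \<phi>_u_def by (metis snd_diff norm_snd_le prod.collapse real_norm_def)
        then show "dist (u a t) (u b t) \<le> 2 * exp (2 * B * (t - t0)) * dist a b"
          using dep[of a b] by (simp add: dist_real_def algebra_simps)
      qed simp
      then show ?thesis by (rule lipschitz_on_continuous_on)
    qed
  qed
qed

text \<open>Shooting: the initial values for which \<open>u\<close> eventually leaves \<open>[0, M / \<nu>]\<close> through the lower
  resp. the upper end form two disjoint nonempty open sets, so they do not exhaust the real line.\<close>

lemma half_line_solution:
  assumes \<theta>: "continuous_on UNIV \<theta>" "\<And>t. t \<le> t0 \<Longrightarrow> 0 \<le> \<theta> t" "\<And>t. t \<le> t0 \<Longrightarrow> \<theta> t \<le> M"
  obtains \<phi> u where "continuous_on UNIV \<phi>" "\<And>t. t \<le> t0 \<Longrightarrow> \<phi> t = \<theta> t"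
    "\<And>t. t0 < t \<Longrightarrow> (\<phi> has_real_derivative \<mu> * \<phi> t + u t) (at t)"
    "\<And>t. t0 < t \<Longrightarrow> (u has_real_derivative \<nu> * u t - g (\<phi> (t - d))) (at t)"
    "\<And>t. t0 \<le> t \<Longrightarrow> 0 \<le> u t" "\<And>t. t0 \<le> t \<Longrightarrow> u t \<le> M / \<nu>"
    "\<And>t. 0 \<le> \<phi> t" "\<And>t. \<phi> t \<le> M" "continuous_on UNIV u"
proof -
  obtain \<phi> u where cont: "\<And>u0. continuous_on UNIV (\<phi> u0)" "\<And>u0. continuous_on UNIV (u u0)"
    and init: "\<And>u0 t. t \<le> t0 \<Longrightarrow> \<phi> u0 t = \<theta> t" "\<And>u0. u u0 t0 = u0"
    and d\<phi>: "\<And>u0 t. t0 < t \<Longrightarrow> (\<phi> u0 has_real_derivative \<mu> * \<phi> u0 t + u u0 t) (at t)"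
    and du: "\<And>u0 t. t0 < t \<Longrightarrow> (u u0 has_real_derivative \<nu> * u u0 t - g (max (\<phi> u0 (t - d)) 0)) (at t)"
    and dep: "\<And>t. continuous_on UNIV (\<lambda>u0. u u0 t)"
    by (rule initial_value_problem[OF \<theta>(1), of t0]) (rule that)
  \<comment> \<open>As \<open>g \<ge> 0\<close>, the product of \<open>u\<close> and
    \<open>exp (- (\<nu> * t))\<close> is nonincreasing, so a negative value persists. Dually,
    \<open>g \<le> M\<close> makes an excess over \<open>M / \<nu>\<close> persist.\<close>
  have below: "u u0 t < 0" if "t0 \<le> s" "s \<le> t" "u u0 s < 0" for u0 s t
  proof -
    have "- (u u0 s * exp (- (\<nu> * s))) \<le> - (u u0 t * exp (- (\<nu> * t)))"
    proof (rule DERIV_mono_on_open[OF that(2)])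
      show "continuous_on UNIV (\<lambda>s. - (u u0 s * exp (- (\<nu> * s))))" by (intro continuous_intros cont(2))
      fix r assume r: "s < r" "r < t"
      show "((\<lambda>s. - (u u0 s * exp (- (\<nu> * s)))) has_real_derivative g (max (\<phi> u0 (r - d)) 0) * exp (- (\<nu> * r))) (at r)"
        using r that by (auto intro!: derivative_eq_intros du simp: algebra_simps)
      show "g (max (\<phi> u0 (r - d)) 0) * exp (- (\<nu> * r)) \<ge> 0" using g_nonneg by simp
    qed
    then have "u u0 t * exp (- (\<nu> * t)) \<le> u u0 s * exp (- (\<nu> * s))" by simp
    also have "\<dots> < 0" using that by (simp add: mult_neg_pos)
    finally show ?thesis by (simp add: mult_less_0_iff)
  qed
  have above: "u u0 t > M / \<nu>" if "t0 \<le> s" "s \<le> t" "u u0 s > M / \<nu>" for u0 s t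
  proof -
    have "(u u0 s - M / \<nu>) * exp (- (\<nu> * s)) \<le> (u u0 t - M / \<nu>) * exp (- (\<nu> * t))"
    proof (rule DERIV_mono_on_open[OF that(2)])
      show "continuous_on UNIV (\<lambda>s. (u u0 s - M / \<nu>) * exp (- (\<nu> * s)))" by (intro continuous_intros cont(2))
      fix r assume r: "s < r" "r < t"
      show "((\<lambda>s. (u u0 s - M / \<nu>) * exp (- (\<nu> * s))) has_real_derivative (M - g (max (\<phi> u0 (r - d)) 0)) * exp (- (\<nu> * r))) (at r)"
        using r that \<nu>_pos by (auto intro!: derivative_eq_intros du simp: field_simps)
      show "(M - g (max (\<phi> u0 (r - d)) 0)) * exp (- (\<nu> * r)) \<ge> 0" using g_le by simp
    qed
    moreover have "(u u0 s - M / \<nu>) * exp (- (\<nu> * s)) > 0" using that by simp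
    ultimately have "(u u0 t - M / \<nu>) * exp (- (\<nu> * t)) > 0" by simp
    then show ?thesis by (simp add: zero_less_mult_iff)
  qed
  have M\<nu>: "M / \<nu> > 0" using M_ge_1 \<nu>_pos by simp
  define A where "A = (\<Union>t\<in>{t0..}. {u0. u u0 t < 0})"
  define B where "B = (\<Union>t\<in>{t0..}. {u0. u u0 t > M / \<nu>})"
  have "open A" "open B"
    unfolding A_def B_def
    by (intro open_UN ballI open_Collect_less continuous_on_const dep)+
  moreover have "A \<inter> B = {}"
  proof -
    have False if ab: "t0 \<le> s" "t0 \<le> t" "u u0 s < 0" "u u0 t > M / \<nu>" for u0 s t
    proof -
      have "u u0 (max s t) < 0" by (rule below[OF ab(1) _ ab(3)]) simp
      moreover have "u u0 (max s t) > M / \<nu>" by (rule above[OF ab(2) _ ab(4)]) simp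
      ultimately show False using M\<nu> by simp
    qed
    then show ?thesis unfolding A_def B_def by auto
  qed
  moreover have "- 1 \<in> A" unfolding A_def using init(2) by (auto intro!: bexI[of _ t0])
  moreover have "M / \<nu> + 1 \<in> B" unfolding B_def using init(2) by (auto intro!: bexI[of _ t0])
  ultimately have "\<not> UNIV \<subseteq> A \<union> B"
    using connectedD[of UNIV A B] connected_UNIV by blast
  then obtain u0 where u0: "u0 \<notin> A" "u0 \<notin> B" by blast
  have u_ge: "0 \<le> u u0 t" if "t0 \<le> t" for t using u0(1) that unfolding A_def by (auto simp: not_less)
  have u_le: "u u0 t \<le> M / \<nu>" if "t0 \<le> t" for t using u0(2) that unfolding B_def by (auto simp: not_less)
  have \<phi>0: "0 \<le> \<phi> u0 t" for t
  proof (cases "t \<le> t0")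
    case False
    then have "t0 \<le> t" by simp
    have "\<phi> u0 t0 * exp (- (\<mu> * t0)) \<le> \<phi> u0 t * exp (- (\<mu> * t))"
    proof (rule DERIV_mono_on_open[OF \<open>t0 \<le> t\<close>])
      show "continuous_on UNIV (\<lambda>t. \<phi> u0 t * exp (- (\<mu> * t)))" by (intro continuous_intros cont(1))
      fix r assume r: "t0 < r" "r < t"
      show "((\<lambda>t. \<phi> u0 t * exp (- (\<mu> * t))) has_real_derivative u u0 r * exp (- (\<mu> * r))) (at r)"
        using r by (auto intro!: derivative_eq_intros d\<phi> simp: algebra_simps)
      show "u u0 r * exp (- (\<mu> * r)) \<ge> 0" using u_ge[of r] r by simp
    qed
    moreover have "\<phi> u0 t0 * exp (- (\<mu> * t0)) \<ge> 0" using init(1)[of t0] \<theta>(2)[of t0] by simp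
    ultimately have "\<phi> u0 t * exp (- (\<mu> * t)) \<ge> 0" by simp
    then show ?thesis by (simp add: zero_le_mult_iff)
  qed (use init(1) \<theta>(2) in simp)
  have \<phi>M: "\<phi> u0 t \<le> M" for t
  proof (cases "t \<le> t0")
    case False
    then have "t0 \<le> t" by simp
    \<comment> \<open>For \<open>u \<le> M / \<nu> = - \<mu> * M\<close> the equation
      \<open>\<phi>' = \<mu> * \<phi> + u\<close> does not let \<open>\<phi>\<close> cross the level
      \<open>M\<close> upwards.\<close>
    have \<mu>M: "\<mu> * M = - (M / \<nu>)" using \<mu>_\<nu>_prod \<nu>_pos by (simp add: field_simps)
    have "(M - \<phi> u0 t0) * exp (- (\<mu> * t0)) \<le> (M - \<phi> u0 t) * exp (- (\<mu> * t))"
    proof (rule DERIV_mono_on_open[OF \<open>t0 \<le> t\<close>])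
      show "continuous_on UNIV (\<lambda>t. (M - \<phi> u0 t) * exp (- (\<mu> * t)))" by (intro continuous_intros cont(1))
      fix r assume r: "t0 < r" "r < t"
      show "((\<lambda>t. (M - \<phi> u0 t) * exp (- (\<mu> * t))) has_real_derivative (- \<mu> * M - u u0 r) * exp (- (\<mu> * r))) (at r)"
        using r by (auto intro!: derivative_eq_intros d\<phi> simp: algebra_simps)
      show "(- \<mu> * M - u u0 r) * exp (- (\<mu> * r)) \<ge> 0" using u_le[of r] r \<mu>M by simp
    qed
    moreover have "(M - \<phi> u0 t0) * exp (- (\<mu> * t0)) \<ge> 0" using init(1)[of t0] \<theta>(3)[of t0] by simp
    ultimately have "(M - \<phi> u0 t) * exp (- (\<mu> * t)) \<ge> 0" by simp
    then show ?thesis by (simp add: zero_le_mult_iff)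
  qed (use init(1) \<theta>(3) in simp)
  show ?thesis
  proof (rule that[of "\<phi> u0" "u u0"])
    show "(u u0 has_real_derivative \<nu> * u u0 t - g (\<phi> u0 (t - d))) (at t)" if "t0 < t" for t
      using du[OF that, of u0] \<phi>0[of "t - d"] by (simp add: max_def)
  qed (use cont init d\<phi> u_ge u_le \<phi>0 \<phi>M in auto)
qed

end

text \<open>The pointwise half of Ascoli's theorem, for functions that are equi-Lipschitz on a
  half-line only from some index on: an approximation solves the equation only to the right of its
  starting point, and the starting points move to minus infinity.\<close>

lemma convergent_of_convergent_on_Rats:
  fixes h :: "nat \<Rightarrow> real \<Rightarrow> real"
  assumes lip: "\<And>a. \<exists>N. \<forall>n\<ge>N. \<forall>x y. a \<le> x \<longrightarrow> a \<le> y \<longrightarrow> \<bar>h n x - h n y\<bar> \<le> B * \<bar>x - y\<bar>"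
    and "B > 0" and rat: "\<And>q. q \<in> \<rat> \<Longrightarrow> convergent (\<lambda>n. h n q)"
  shows "convergent (\<lambda>n. h n t)"
proof (intro Cauchy_convergent CauchyI)
  fix e :: real assume "e > 0"
  obtain q where q: "q \<in> \<rat>" "t - e / (3 * B) < q" "q < t"
    using Rats_dense_in_real[of "t - e / (3 * B)" t] \<open>e > 0\<close> \<open>B > 0\<close> by auto
  have "B * \<bar>t - q\<bar> < e / 3" using q \<open>B > 0\<close> by (simp add: field_simps)
  obtain N where N: "\<And>n. n \<ge> N \<Longrightarrow> \<bar>h n t - h n q\<bar> \<le> B * \<bar>t - q\<bar>"
    using lip[of q] q by (metis less_imp_le order_refl)
  obtain N' where N': "\<And>m n. m \<ge> N' \<Longrightarrow> n \<ge> N' \<Longrightarrow> norm (h m q - h n q) < e / 3"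
    using CauchyD[OF convergent_Cauchy[OF rat[OF q(1)]], of "e / 3"] \<open>e > 0\<close> by auto
  have "norm (h m t - h n t) < e" if "m \<ge> max N N'" "n \<ge> max N N'" for m n
    using N[of m] N[of n] N'[of m n] that \<open>B * \<bar>t - q\<bar> < e / 3\<close> unfolding real_norm_def by linarith
  then show "\<exists>M. \<forall>m\<ge>M. \<forall>n\<ge>M. norm (h m t - h n t) < e" by blast
qed

text \<open>The equation passes to the limit in integrated form, by dominated convergence from
  pointwise limits and a common bound.\<close>

lemma integral_eq_of_tendsto:
  fixes F f :: "nat \<Rightarrow> real \<Rightarrow> real"
  assumes "a \<le> b"
    and der: "\<And>n t. n \<ge> N \<Longrightarrow> a \<le> t \<Longrightarrow> t \<le> b \<Longrightarrow> (F n has_real_derivative f n t) (at t)"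
    and bound: "\<And>n t. n \<ge> N \<Longrightarrow> a \<le> t \<Longrightarrow> t \<le> b \<Longrightarrow> \<bar>f n t\<bar> \<le> C"
    and F: "\<And>t. (\<lambda>n. F n t) \<longlonglongrightarrow> G t"
    and f: "\<And>t. a \<le> t \<Longrightarrow> t \<le> b \<Longrightarrow> (\<lambda>n. f n t) \<longlonglongrightarrow> g t"
  shows "G b = G a + integral {a..b} g"
proof -
  have int: "(f (n + N) has_integral F (n + N) b - F (n + N) a) {a..b}" for n
    using der
    by (intro fundamental_theorem_of_calculus assms)
      (auto simp: has_real_derivative_iff_has_vector_derivative[symmetric] intro: has_field_derivative_at_within)
  have "(\<lambda>n. integral {a..b} (f (n + N))) \<longlonglongrightarrow> integral {a..b} g"
    by (rule dominated_convergence(2)[where h = "\<lambda>_. C"])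
      (use int bound f in \<open>auto intro: LIMSEQ_ignore_initial_segment\<close>)
  then have "(\<lambda>n. F (n + N) b - F (n + N) a) \<longlonglongrightarrow> integral {a..b} g"
    by (simp only: integral_unique[OF int])
  moreover have "(\<lambda>n. F (n + N) b - F (n + N) a) \<longlonglongrightarrow> G b - G a"
    by (intro tendsto_intros LIMSEQ_ignore_initial_segment F)
  ultimately have "integral {a..b} g = G b - G a" using LIMSEQ_unique by blast
  then show ?thesis by simp
qed

context delayed_wave
begin

definition K' where "K' = max K (p * \<delta> powr - \<alpha>)"

lemma K'_pos: "K' > 0"
  unfolding K'_def using K_pos by simp

text \<open>Beyond \<open>\<delta>\<close> already \<open>p * x\<close> is at most
  \<open>p * \<delta> powr - \<alpha>\<close> times \<open>x powr (1 + \<alpha>)\<close>, and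
  \<open>g \<ge> 0\<close>. With the constant \<open>K'\<close> the estimate near 0 becomes
  global.\<close>

lemma g_lower_bound:
  assumes "x \<ge> 0"
  shows "p * x - g x \<le> K' * x powr (1 + \<alpha>)"
proof (cases "x < \<delta>")
  case True
  have "\<bar>g x - g 0 - p * (x - 0)\<bar> \<le> K * \<bar>x - 0\<bar> * (0 powr \<alpha> + x powr \<alpha>)"
    using True assms \<delta>_pos by (intro g_smooth) auto
  then have "p * x - g x \<le> K * (x * x powr \<alpha>)"
    using g_0 assms by (simp add: abs_le_iff algebra_simps)
  also have "\<dots> \<le> K' * (x * x powr \<alpha>)"
    unfolding K'_def using assms by (intro mult_right_mono) auto
  finally show ?thesis using assms by (cases "x = 0") (auto simp: powr_add)
next
  case False
  then have "x > 0" using \<delta>_pos by simp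
  have "1 = \<delta> powr - \<alpha> * \<delta> powr \<alpha>" using \<delta>_pos by (simp add: powr_minus)
  also have "\<dots> \<le> \<delta> powr - \<alpha> * x powr \<alpha>"
    using False \<delta>_pos \<alpha>_pos by (intro mult_left_mono powr_mono2) auto
  finally have "p * x * 1 \<le> p * x * (\<delta> powr - \<alpha> * x powr \<alpha>)"
    using p_gt_1 \<open>x > 0\<close> by (intro mult_left_mono) auto
  also have "\<dots> = (p * \<delta> powr - \<alpha>) * (x * x powr \<alpha>)" by simp
  also have "\<dots> \<le> K' * (x * x powr \<alpha>)"
    unfolding K'_def using \<open>x > 0\<close> by (intro mult_right_mono) auto
  finally have "p * x \<le> K' * (x * x powr \<alpha>)" by simp
  moreover have "K' * x powr (1 + \<alpha>) = K' * (x * x powr \<alpha>)" using \<open>x > 0\<close> by (simp add: powr_add)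
  ultimately show ?thesis using g_nonneg[OF assms] by linarith
qed

lemma exp_l_d: "p * exp (- (l * d)) = 1 + c * l - l\<^sup>2"
  using cf_l unfolding cf_def by simp

lemma conjugated_operator:
  assumes "x2 = c * x1 + x - G"
  shows "(x2 - 2 * l * x1 + l\<^sup>2 * x) * exp (- (l * t)) - (c - 2 * l) * ((x1 - l * x) * exp (- (l * t))) -
      p * exp (- (l * d)) * (x * exp (- (l * t))) + p * exp (- (l * d)) * (y * exp (- (l * (t - d)))) =
    (p * y - G) * exp (- (l * t))"
proof -
  have e: "exp (- (l * d)) * exp (- (l * (t - d))) = exp (- (l * t))"
    by (simp add: exp_add[symmetric] algebra_simps)
  have "p * exp (- (l * d)) * (y * exp (- (l * (t - d)))) = p * y * (exp (- (l * d)) * exp (- (l * (t - d))))"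
    by simp
  also have "\<dots> = p * y * exp (- (l * t))" unfolding e ..
  finally have y: "p * exp (- (l * d)) * (y * exp (- (l * (t - d)))) = p * y * exp (- (l * t))" .
  show ?thesis
    unfolding y unfolding exp_l_d assms by (simp add: algebra_simps power2_eq_square)
qed

text \<open>The linear operator of slope \<open>p\<close> in the variable v = w e^(-l t). Because
  \<open>l\<close> is a zero of \<open>cf\<close>, the last two coefficients are opposite and
  constants are annihilated, as \<open>delayed_max_principle\<close> requires.\<close>

abbreviation conj_op where
  "conj_op v v1 v2 t \<equiv> v2 t - (c - 2 * l) * v1 t - p * exp (- (l * d)) * v t + p * exp (- (l * d)) * v (t - d)"

lemma max_principle_conjugated:
  assumes "continuous_on UNIV v" "t0 < r"
    and "\<And>t. t0 < t \<Longrightarrow> t < r \<Longrightarrow> (v has_real_derivative v1 t) (at t)"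
    and "\<And>t. t0 < t \<Longrightarrow> t < r \<Longrightarrow> (v1 has_real_derivative v2 t) (at t)"
    and ineq: "\<And>t. t0 < t \<Longrightarrow> t < r \<Longrightarrow>
conj_op v v1 v2 t \<ge> 0"
    and "\<And>t. t \<le> t0 \<Longrightarrow> v t \<le> 0" "v r \<le> 0" "t \<le> r"
  shows "v t \<le> 0"
proof (rule delayed_max_principle[where ?z1.0 = "\<mu> - l" and ?z2.0 = "\<nu> - l" and l = t0 and r = r and d = d,
      OF assms(1) d_nonneg _ _ assms(2-4)])
  have prod: "(\<mu> - l) * (\<nu> - l) = - (p * exp (- (l * d)))"
    using quadratic_factor[of l] unfolding exp_l_d by (simp add: algebra_simps)
  have sum: "\<mu> - l + (\<nu> - l) = c - 2 * l" using \<mu>_\<nu>_sum by simp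
  show "v2 t - (\<mu> - l + (\<nu> - l)) * v1 t + (\<mu> - l) * (\<nu> - l) * v t - (\<mu> - l) * (\<nu> - l) * v (t - d) \<ge> 0"
    if "t0 < t" "t < r" for t
    unfolding prod sum using ineq[OF that] by simp
  show "\<mu> - l < 0" "0 < \<nu> - l" using \<mu>_neg l_pos l_less_\<nu> by auto
qed (use assms in auto)

section \<open>Comparison with an upper and a lower barrier\<close>

context
  fixes s s1 s2 f f1 f2 :: "real \<Rightarrow> real" and R R' :: real
  assumes s: "\<And>t. (s has_real_derivative s1 t) (at t)" "\<And>t. (s1 has_real_derivative s2 t) (at t)"
    and f: "\<And>t. (f has_real_derivative f1 t) (at t)" "\<And>t. (f1 has_real_derivative f2 t) (at t)"
    and s_eq: "\<And>t. conj_op s s1 s2 t = 0"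
    and f_ineq: "\<And>t. t < R' \<Longrightarrow> conj_op f f1 f2 t \<ge>
      K' * (s (t - d) * exp (l * (t - d))) powr (1 + \<alpha>) * exp (- (l * t))"
    and R: "R' \<le> R" "M \<le> s R * exp (l * R)" "\<And>t. t \<le> R' \<Longrightarrow> f t \<le> s t" "f R' \<le> 0"
begin

text \<open>Both comparisons are linear. Above, \<open>g \<phi> \<le> p * \<phi>\<close> makes the
  conjugated solution minus \<open>s\<close> a subsolution up to \<open>R\<close>, where the upper
  barrier has reached \<open>M\<close>. This upper bound then controls the defect
  \<open>p * \<phi> - g \<phi>\<close>, and \<open>f_ineq\<close> dominates it up to
  \<open>R'\<close>, where \<open>f\<close> is nonpositive.\<close>

lemma half_line_bounds:
  assumes "t0 < R'"
    and \<phi>: "continuous_on UNIV \<phi>" "\<And>t. t \<le> t0 \<Longrightarrow> \<phi> t = s t * exp (l * t)"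
      "\<And>t. t0 < t \<Longrightarrow> (\<phi> has_real_derivative \<mu> * \<phi> t + u t) (at t)"
      "\<And>t. t0 < t \<Longrightarrow> (u has_real_derivative \<nu> * u t - g (\<phi> (t - d))) (at t)"
      "\<And>t. 0 \<le> \<phi> t" "\<And>t. \<phi> t \<le> M"
  shows "t \<le> R' \<Longrightarrow> f t * exp (l * t) \<le> \<phi> t" "t \<le> R' \<Longrightarrow> \<phi> t \<le> s t * exp (l * t)"
proof -
  define \<phi>1 where "\<phi>1 = (\<lambda>t. \<mu> * \<phi> t + u t)"
  define \<phi>2 where "\<phi>2 = (\<lambda>t. c * \<phi>1 t + \<phi> t - g (\<phi> (t - d)))"
  have d1: "(\<phi> has_real_derivative \<phi>1 t) (at t)" if "t0 < t" for t
    using \<phi>(3)[OF that] unfolding \<phi>1_def .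
  have d2: "(\<phi>1 has_real_derivative \<phi>2 t) (at t)" if "t0 < t" for t
  proof -
    have "(\<phi>1 has_real_derivative \<mu> * (\<mu> * \<phi> t + u t) + (\<nu> * u t - g (\<phi> (t - d)))) (at t)"
      unfolding \<phi>1_def by (intro derivative_intros \<phi>(3,4)[OF that] DERIV_cmult)
    moreover have "\<mu> * (\<mu> * \<phi> t + u t) + (\<nu> * u t - g (\<phi> (t - d))) =
        (\<mu> + \<nu>) * \<phi>1 t - \<mu> * \<nu> * \<phi> t - g (\<phi> (t - d))"
      unfolding \<phi>1_def by (simp add: algebra_simps)
    ultimately show ?thesis by (simp add: \<mu>_\<nu>_prod \<mu>_\<nu>_sum \<phi>2_def)
  qed
  define Y where "Y = (\<lambda>t. \<phi> t * exp (- (l * t)))"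
  define Y1 where "Y1 = (\<lambda>t. (\<phi>1 t - l * \<phi> t) * exp (- (l * t)))"
  define Y2 where "Y2 = (\<lambda>t. (\<phi>2 t - 2 * l * \<phi>1 t + l\<^sup>2 * \<phi> t) * exp (- (l * t)))"
  have Y1: "(Y has_real_derivative Y1 t) (at t)" if "t0 < t" for t
    unfolding Y_def Y1_def by (auto intro!: derivative_eq_intros d1[OF that] simp: algebra_simps)
  have Y2: "(Y1 has_real_derivative Y2 t) (at t)" if "t0 < t" for t
    unfolding Y1_def Y2_def
    by (auto intro!: derivative_eq_intros d1[OF that] d2[OF that] simp: algebra_simps power2_eq_square)
  have Y_eq: "conj_op Y Y1 Y2 t =
      (p * \<phi> (t - d) - g (\<phi> (t - d))) * exp (- (l * t))" for t
    unfolding Y_def Y1_def Y2_def by (rule conjugated_operator) (simp add: \<phi>2_def)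
  have Y_left: "Y t = s t" if "t \<le> t0" for t
    unfolding Y_def using \<phi>(2)[OF that] by (simp add: mult.assoc exp_add[symmetric])
  have \<phi>_Y: "\<phi> t = Y t * exp (l * t)" for t
    unfolding Y_def by (simp add: mult.assoc exp_add[symmetric])
  have contY: "continuous_on UNIV Y" unfolding Y_def by (intro continuous_intros \<phi>(1))
  have upper: "Y t \<le> s t" if "t \<le> R" for t
  proof -
    have "Y t - s t \<le> 0"
    proof (rule max_principle_conjugated[where v = "\<lambda>t. Y t - s t" and ?v1.0 = "\<lambda>t. Y1 t - s1 t" and
          ?v2.0 = "\<lambda>t. Y2 t - s2 t" and ?t0.0 = t0 and r = R])
      show "continuous_on UNIV (\<lambda>t. Y t - s t)"
        by (intro continuous_intros contY continuous_of_DERIV[OF s(1)])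
      have "M * exp (- (l * R)) \<le> s R * exp (l * R) * exp (- (l * R))"
        using R(2) by (intro mult_right_mono) auto
      then have "M * exp (- (l * R)) \<le> s R" by (simp add: mult.assoc exp_add[symmetric])
      moreover have "Y R \<le> M * exp (- (l * R))" unfolding Y_def using \<phi>(6) by simp
      ultimately show "Y R - s R \<le> 0" by simp
      show "t0 < R" using R(1) \<open>t0 < R'\<close> by simp
      show "Y t - s t \<le> 0" if "t \<le> t0" for t using Y_left[OF that] by simp
      fix r assume r: "t0 < r" "r < R"
      show "((\<lambda>t. Y t - s t) has_real_derivative Y1 r - s1 r) (at r)"
        by (intro derivative_intros Y1 r s)
      show "((\<lambda>t. Y1 t - s1 t) has_real_derivative Y2 r - s2 r) (at r)"
        by (intro derivative_intros Y2 r s)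
      have "(p * \<phi> (r - d) - g (\<phi> (r - d))) * exp (- (l * r)) \<ge> 0"
        using g_le_linear[OF \<phi>(5)[of "r - d"]] by simp
      then show "conj_op (\<lambda>t. Y t - s t) (\<lambda>t. Y1 t - s1 t) (\<lambda>t. Y2 t - s2 t) r \<ge> 0"
        unfolding Y_eq[symmetric] using s_eq[of r] by (simp add: algebra_simps)
    qed (rule that)
    then show ?thesis by simp
  qed
  have lower: "f t \<le> Y t" if "t \<le> R'" for t
  proof -
    have "f t - Y t \<le> 0"
    proof (rule max_principle_conjugated[where v = "\<lambda>t. f t - Y t" and ?v1.0 = "\<lambda>t. f1 t - Y1 t" and
          ?v2.0 = "\<lambda>t. f2 t - Y2 t" and ?t0.0 = t0 and r = R'])
      show "continuous_on UNIV (\<lambda>t. f t - Y t)"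
        by (intro continuous_intros contY continuous_of_DERIV[OF f(1)])
      have "Y R' \<ge> 0" unfolding Y_def using \<phi>(5) by simp
      then show "f R' - Y R' \<le> 0" using R(4) by simp
      show "f t - Y t \<le> 0" if "t \<le> t0" for t
        using Y_left[OF that] R(3)[of t] that \<open>t0 < R'\<close> by simp
      fix r assume r: "t0 < r" "r < R'"
      show "((\<lambda>t. f t - Y t) has_real_derivative f1 r - Y1 r) (at r)"
        by (intro derivative_intros Y1 r f)
      show "((\<lambda>t. f1 t - Y1 t) has_real_derivative f2 r - Y2 r) (at r)"
        by (intro derivative_intros Y2 r f)
      have "\<phi> (r - d) \<le> s (r - d) * exp (l * (r - d))"
        unfolding \<phi>_Y using upper[of "r - d"] r R d_nonneg by simp
      then have "\<phi> (r - d) powr (1 + \<alpha>) \<le> (s (r - d) * exp (l * (r - d))) powr (1 + \<alpha>)"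
        using \<phi>(5) \<alpha>_pos by (intro powr_mono2) auto
      then have "K' * \<phi> (r - d) powr (1 + \<alpha>) \<le> K' * (s (r - d) * exp (l * (r - d))) powr (1 + \<alpha>)"
        using K'_pos by (intro mult_left_mono) auto
      then have "p * \<phi> (r - d) - g (\<phi> (r - d)) \<le> K' * (s (r - d) * exp (l * (r - d))) powr (1 + \<alpha>)"
        using g_lower_bound[OF \<phi>(5)[of "r - d"]] by simp
      then have "(p * \<phi> (r - d) - g (\<phi> (r - d))) * exp (- (l * r)) \<le>
          K' * (s (r - d) * exp (l * (r - d))) powr (1 + \<alpha>) * exp (- (l * r))"
        by (intro mult_right_mono) auto
      then have "(p * \<phi> (r - d) - g (\<phi> (r - d))) * exp (- (l * r)) \<le>
          conj_op f f1 f2 r"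
        using f_ineq[OF r(2)] by (rule order_trans)
      then show "conj_op (\<lambda>t. f t - Y t) (\<lambda>t. f1 t - Y1 t) (\<lambda>t. f2 t - Y2 t) r \<ge> 0"
        unfolding Y_eq[symmetric] by (simp add: algebra_simps)
    qed (rule \<open>t0 < R'\<close> that)+
    then show ?thesis by simp
  qed
  show "f t * exp (l * t) \<le> \<phi> t" if "t \<le> R'"
    unfolding \<phi>_Y using lower[OF that] by simp
  show "\<phi> t \<le> s t * exp (l * t)" if "t \<le> R'"
    unfolding \<phi>_Y using upper[of t] that R by simp
qed

lemma profile_from_barriers:
  assumes s_nonneg: "\<And>t. t \<le> R' \<Longrightarrow> s t \<ge> 0"
    and s_lim: "((\<lambda>t. s t * exp (l * t)) \<longlongrightarrow> 0) at_bot"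
    and f_pos: "\<And>t. t \<le> R0 \<Longrightarrow> f t > 0"
  shows "\<exists>\<phi> \<phi>1 \<phi>2. profile \<phi> \<phi>1 \<phi>2"
proof -
  define S where "S = (\<lambda>t. s t * exp (l * t))"
  have S_cont: "continuous_on UNIV S" unfolding S_def
    by (intro continuous_intros continuous_of_DERIV[OF s(1)])
  have "eventually (\<lambda>t. S t < M) at_bot"
    using s_lim order_tendstoD(2)[of S 0 at_bot M] M_ge_1 unfolding S_def by simp
  then obtain T1 where T1: "\<And>t. t \<le> T1 \<Longrightarrow> S t < M" unfolding eventually_at_bot_linorder by blast
  define T where "T = min T1 (R' - 1)"
  \<comment> \<open>Starting points that move to minus infinity; to their left the upper barrier,
    which is below \<open>M\<close> there, serves as history.\<close>
  define T0 where "T0 = (\<lambda>n::nat. T - real n)"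
  have T0: "T0 n \<le> T1" "T0 n < R'" for n unfolding T0_def T_def by auto
  have "\<exists>\<phi> u. continuous_on UNIV \<phi> \<and> (\<forall>t\<le>T0 n. \<phi> t = S t) \<and>
      (\<forall>t>T0 n. (\<phi> has_real_derivative \<mu> * \<phi> t + u t) (at t)) \<and>
      (\<forall>t>T0 n. (u has_real_derivative \<nu> * u t - g (\<phi> (t - d))) (at t)) \<and>
      (\<forall>t\<ge>T0 n. 0 \<le> u t) \<and> (\<forall>t\<ge>T0 n. u t \<le> M / \<nu>) \<and> (\<forall>t. 0 \<le> \<phi> t) \<and> (\<forall>t. \<phi> t \<le> M)" for n
  proof -
    have S0: "0 \<le> S t" if "t \<le> T0 n" for t
      unfolding S_def using s_nonneg[of t] T0(2)[of n] that by simp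
    have SM: "S t \<le> M" if "t \<le> T0 n" for t
      using T1[of t] T0(1)[of n] that by simp
    show ?thesis
    proof (rule half_line_solution[where ?t0.0 = "T0 n", OF S_cont])
      show "0 \<le> S t" "S t \<le> M" if "t \<le> T0 n" for t using S0[OF that] SM[OF that] .
    qed blast
  qed
  then obtain \<phi> u where
    \<phi>: "\<And>n. continuous_on UNIV (\<phi> n)" "\<And>n t. t \<le> T0 n \<Longrightarrow> \<phi> n t = S t"
      "\<And>n t. T0 n < t \<Longrightarrow> (\<phi> n has_real_derivative \<mu> * \<phi> n t + u n t) (at t)"
      "\<And>n t. T0 n < t \<Longrightarrow> (u n has_real_derivative \<nu> * u n t - g (\<phi> n (t - d))) (at t)"
    and u: "\<And>n t. T0 n \<le> t \<Longrightarrow> 0 \<le> u n t" "\<And>n t. T0 n \<le> t \<Longrightarrow> u n t \<le> M / \<nu>"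
    and \<phi>_bd: "\<And>n t. 0 \<le> \<phi> n t" "\<And>n t. \<phi> n t \<le> M"
    by metis
  have lower: "f t * exp (l * t) \<le> \<phi> n t" if "t \<le> R'" for n t
    by (rule half_line_bounds(1)[OF T0(2)[of n] \<phi>(1) _ \<phi>(3,4) \<phi>_bd that])
      (simp_all add: \<phi>(2) S_def)
  have upper: "\<phi> n t \<le> s t * exp (l * t)" if "t \<le> R'" for n t
    by (rule half_line_bounds(2)[OF T0(2)[of n] \<phi>(1) _ \<phi>(3,4) \<phi>_bd that])
      (simp_all add: \<phi>(2) S_def)
  have M: "M > 0" "M / \<nu> > 0" using M_ge_1 \<nu>_pos by auto
  define C where "C = \<bar>\<mu>\<bar> * M + M / \<nu> + 2 * M"
  have C: "C > 0" unfolding C_def using M by (simp add: add_nonneg_pos)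
  have \<phi>'_bd: "\<bar>\<mu> * \<phi> n t + u n t\<bar> \<le> C" if "T0 n \<le> t" for n t
  proof -
    have "\<bar>\<mu> * \<phi> n t\<bar> \<le> \<bar>\<mu>\<bar> * M" using \<phi>_bd[of n t] by (simp add: abs_mult mult_left_mono)
    moreover have "\<bar>u n t\<bar> \<le> M / \<nu>" using u[OF that] by simp
    ultimately show ?thesis unfolding C_def using M by linarith
  qed
  have u'_bd: "\<bar>\<nu> * u n t - g (\<phi> n (t - d))\<bar> \<le> C" if "T0 n \<le> t" for n t
  proof -
    have "\<nu> * u n t \<le> \<nu> * (M / \<nu>)" using u[OF that] \<nu>_pos by (intro mult_left_mono) auto
    then have "\<nu> * u n t \<le> M" using \<nu>_pos by simp
    moreover have "0 \<le> \<nu> * u n t" using u[OF that] \<nu>_pos by simp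
    moreover have "0 \<le> g (\<phi> n (t - d))" "g (\<phi> n (t - d)) \<le> M" using g_nonneg g_le \<phi>_bd by auto
    moreover have "0 \<le> \<bar>\<mu>\<bar> * M" using M by simp
    ultimately show ?thesis unfolding C_def using M by linarith
  qed
  have lipschitz: "\<bar>F x - F y\<bar> \<le> C * \<bar>x - y\<bar>"
    if F: "\<And>t. T0 n < t \<Longrightarrow> (F has_real_derivative F' t) (at t)" "\<And>t. T0 n \<le> t \<Longrightarrow> \<bar>F' t\<bar> \<le> C"
      and xy: "T0 n < x" "T0 n < y" for F F' n x y
  proof -
    have *: "\<bar>F y - F x\<bar> \<le> C * \<bar>x - y\<bar>" if xy: "T0 n < x" "x < y" for x y
    proof -
      obtain z where z: "x < z" "z < y" "F y - F x = (y - x) * F' z"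
        using MVT2[of x y F F'] F xy by auto
      have "\<bar>F' z\<bar> \<le> C" using F(2)[of z] z xy by simp
      then have "(y - x) * \<bar>F' z\<bar> \<le> (y - x) * C" using xy by (intro mult_left_mono) auto
      then show ?thesis using z xy by (simp add: abs_mult mult.commute)
    qed
    show ?thesis using *[of x y] *[of y x] xy
      by (cases x y rule: linorder_cases) (auto simp: abs_minus_commute)
  qed
  have T0_lt: "\<exists>N. \<forall>n\<ge>N. T0 n < a" for a
  proof -
    obtain N :: nat where N: "real N > T - a" using reals_Archimedean2 by blast
    have "T0 n < a" if "n \<ge> N" for n
    proof -
      have "real n \<ge> real N" using that by simp
      then show ?thesis using N unfolding T0_def by simp
    qed
    then show ?thesis by blast
  qed
  \<comment> \<open>\<open>u n\<close> is controlled only from its starting point on. Setting it to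
    0 before gives sequences bounded at every rational without changing their late terms, and the
    pairing lets one subsequence serve both components.\<close>
  define Z where "Z = (\<lambda>n t. (\<phi> n t, if T0 n \<le> t then u n t else 0))"
  have "norm (Z n t) \<le> M + M / \<nu>" for n t
  proof -
    have "norm (Z n t) \<le> norm (\<phi> n t) + norm (if T0 n \<le> t then u n t else 0)"
      unfolding Z_def by (rule norm_Pair_le)
    also have "\<dots> \<le> M + M / \<nu>" using \<phi>_bd[of n t] u[of n t] M by (intro add_mono) auto
    finally show ?thesis .
  qed
  then obtain k where k: "strict_mono (k :: nat \<Rightarrow> nat)" "\<And>q. q \<in> \<rat> \<Longrightarrow> \<exists>z. (\<lambda>n. Z (k n) q) \<longlonglongrightarrow> z"
    using function_convergent_subsequence[OF countable_rat, of Z "M + M / \<nu>"] by metis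
  have k_late: "\<exists>N. \<forall>n\<ge>N. T0 (k n) < a" for a
    using T0_lt[of a] seq_suble[OF k(1)] by (meson order_trans)
  have lim_le: "a \<le> b" if "X \<longlonglongrightarrow> a" "Y \<longlonglongrightarrow> b" "\<And>n. n \<ge> N \<Longrightarrow> X n \<le> Y n" for X Y :: "nat \<Rightarrow> real" and a b N
    using LIMSEQ_le[OF that(1,2)] that(3) by blast
  have limit: "\<exists>G. continuous_on UNIV G \<and> (\<forall>t. (\<lambda>n. F (k n) t) \<longlonglongrightarrow> G t)"
    if lip: "\<And>n x y. T0 n < x \<Longrightarrow> T0 n < y \<Longrightarrow> \<bar>F n x - F n y\<bar> \<le> C * \<bar>x - y\<bar>"
      and rat: "\<And>q. q \<in> \<rat> \<Longrightarrow> convergent (\<lambda>n. F (k n) q)" for F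
  proof -
    have late: "\<exists>N. \<forall>n\<ge>N. \<forall>x y. a \<le> x \<longrightarrow> a \<le> y \<longrightarrow> \<bar>F (k n) x - F (k n) y\<bar> \<le> C * \<bar>x - y\<bar>" for a
    proof -
      obtain N where N: "\<And>n. n \<ge> N \<Longrightarrow> T0 (k n) < a" using k_late by blast
      show ?thesis by (intro exI[of _ N] allI impI lip) (auto dest!: N)
    qed
    obtain G where G: "\<And>t. (\<lambda>n. F (k n) t) \<longlonglongrightarrow> G t"
      using convergent_of_convergent_on_Rats[OF late C rat] unfolding convergent_def by metis
    have "\<bar>G x - G y\<bar> \<le> C * \<bar>x - y\<bar>" for x y
    proof -
      obtain N where N: "\<And>n. n \<ge> N \<Longrightarrow> \<bar>F (k n) x - F (k n) y\<bar> \<le> C * \<bar>x - y\<bar>"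
        using late[of "min x y"] by (meson min.cobounded1 min.cobounded2)
      have "(\<lambda>n. \<bar>F (k n) x - F (k n) y\<bar>) \<longlonglongrightarrow> \<bar>G x - G y\<bar>" by (intro tendsto_intros G)
      then show ?thesis by (rule lim_le[OF _ tendsto_const, of _ _ N]) (rule N)
    qed
    then have "C-lipschitz_on UNIV G" using C by (intro lipschitz_onI) (auto simp: dist_real_def)
    then show ?thesis using G lipschitz_on_continuous_on by blast
  qed
  have Z_conv: "convergent (\<lambda>n. \<phi> (k n) q) \<and> convergent (\<lambda>n. u (k n) q)" if q: "q \<in> \<rat>" for q
  proof -
    obtain z where z: "(\<lambda>n. Z (k n) q) \<longlonglongrightarrow> z" using k(2)[OF q] by blast
    have "(\<lambda>n. \<phi> (k n) q) \<longlonglongrightarrow> fst z" using tendsto_fst[OF z] unfolding Z_def by simp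
    moreover have lim: "(\<lambda>n. if T0 (k n) \<le> q then u (k n) q else 0) \<longlonglongrightarrow> snd z"
      using tendsto_snd[OF z] unfolding Z_def by simp
    obtain N where N: "\<And>n. n \<ge> N \<Longrightarrow> T0 (k n) < q" using k_late by blast
    have "(\<lambda>n. u (k n) q) \<longlonglongrightarrow> snd z"
      by (rule Lim_transform_eventually[OF lim])
        (use N in \<open>auto simp: eventually_sequentially less_imp_le intro!: exI[of _ N]\<close>)
    ultimately show ?thesis by (auto simp: convergent_def)
  qed
  have lip_\<phi>: "\<bar>\<phi> n x - \<phi> n y\<bar> \<le> C * \<bar>x - y\<bar>" if "T0 n < x" "T0 n < y" for n x y
    by (rule lipschitz[OF \<phi>(3) \<phi>'_bd that])
  have lip_u: "\<bar>u n x - u n y\<bar> \<le> C * \<bar>x - y\<bar>" if "T0 n < x" "T0 n < y" for n x y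
    by (rule lipschitz[OF \<phi>(4) u'_bd that])
  obtain \<Phi> where \<Phi>_cont: "continuous_on UNIV \<Phi>" and \<Phi>: "\<And>t. (\<lambda>n. \<phi> (k n) t) \<longlonglongrightarrow> \<Phi> t"
    using limit[OF lip_\<phi> Z_conv[THEN conjunct1]] by blast
  obtain U where U_cont: "continuous_on UNIV U" and U: "\<And>t. (\<lambda>n. u (k n) t) \<longlonglongrightarrow> U t"
    using limit[OF lip_u Z_conv[THEN conjunct2]] by blast
  have \<Phi>_nonneg: "0 \<le> \<Phi> t" for t by (rule lim_le[OF tendsto_const \<Phi>, of 0]) (rule \<phi>_bd)
  have \<Phi>_le: "\<Phi> t \<le> M" for t by (rule lim_le[OF \<Phi> tendsto_const, of 0]) (rule \<phi>_bd)
  have \<Phi>_lower: "f t * exp (l * t) \<le> \<Phi> t" if "t \<le> R'" for t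
    by (rule lim_le[OF tendsto_const \<Phi>, of 0]) (rule lower[OF that])
  have \<Phi>_upper: "\<Phi> t \<le> s t * exp (l * t)" if "t \<le> R'" for t
    by (rule lim_le[OF \<Phi> tendsto_const, of 0]) (rule upper[OF that])
  have U_nonneg: "0 \<le> U t" for t
  proof -
    obtain N where N: "\<And>n. n \<ge> N \<Longrightarrow> T0 (k n) < t" using k_late by blast
    show ?thesis by (rule lim_le[OF tendsto_const U, of N]) (use u N in \<open>auto simp: less_imp_le\<close>)
  qed
  have g_\<Phi>: "(\<lambda>n. g (\<phi> (k n) t)) \<longlonglongrightarrow> g (\<Phi> t)" for t
  proof (rule LIM_zero_cancel, rule Lim_null_comparison)
    show "\<forall>\<^sub>F n in sequentially. norm (g (\<phi> (k n) t) - g (\<Phi> t)) \<le> L * \<bar>\<phi> (k n) t - \<Phi> t\<bar>"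
      using g_lipschitz \<phi>_bd \<Phi>_nonneg by simp
    have "(\<lambda>n. L * \<bar>\<phi> (k n) t - \<Phi> t\<bar>) \<longlonglongrightarrow> L * \<bar>\<Phi> t - \<Phi> t\<bar>" by (intro tendsto_intros \<Phi>)
    then show "(\<lambda>n. L * \<bar>\<phi> (k n) t - \<Phi> t\<bar>) \<longlonglongrightarrow> 0" by simp
  qed
  have shift_cont: "continuous_on UNIV (\<lambda>t. \<Phi> (t - d))"
    by (rule continuous_on_compose2[OF \<Phi>_cont]) (auto intro!: continuous_intros)
  have g_cont: "continuous_on UNIV (\<lambda>t. g (\<Phi> (t - d)))"
    using g_max_cont[OF shift_cont] \<Phi>_nonneg by (simp add: max_absorb1)
  have d\<Phi>: "(\<Phi> has_real_derivative \<mu> * \<Phi> t + U t) (at t)" for t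
  proof (rule DERIV_of_integral_equation[where ?t0.0 = "t - 1" and a = "\<Phi> (t - 1)"])
    obtain N where N: "\<And>n. n \<ge> N \<Longrightarrow> T0 (k n) < t - 1" using k_late by blast
    show "\<Phi> r = \<Phi> (t - 1) + integral {t - 1..r} (\<lambda>r. \<mu> * \<Phi> r + U r)" if "t - 1 \<le> r" for r
    proof (rule integral_eq_of_tendsto[OF that, of N, OF _ _ \<Phi>])
      fix n x assume nx: "n \<ge> N" "t - 1 \<le> x"
      then have T0x: "T0 (k n) < x" using N by force
      show "(\<phi> (k n) has_real_derivative \<mu> * \<phi> (k n) x + u (k n) x) (at x)" by (rule \<phi>(3)[OF T0x])
      show "\<bar>\<mu> * \<phi> (k n) x + u (k n) x\<bar> \<le> C" using \<phi>'_bd T0x by simp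
    qed (auto intro!: tendsto_intros \<Phi> U)
  qed (auto intro!: continuous_intros \<Phi>_cont U_cont)
  have dU: "(U has_real_derivative \<nu> * U t - g (\<Phi> (t - d))) (at t)" for t
  proof (rule DERIV_of_integral_equation[where ?t0.0 = "t - 1" and a = "U (t - 1)"])
    obtain N where N: "\<And>n. n \<ge> N \<Longrightarrow> T0 (k n) < t - 1" using k_late by blast
    show "U r = U (t - 1) + integral {t - 1..r} (\<lambda>r. \<nu> * U r - g (\<Phi> (r - d)))" if "t - 1 \<le> r" for r
    proof (rule integral_eq_of_tendsto[OF that, of N, OF _ _ U])
      fix n x assume nx: "n \<ge> N" "t - 1 \<le> x"
      then have T0x: "T0 (k n) < x" using N by force
      show "(u (k n) has_real_derivative \<nu> * u (k n) x - g (\<phi> (k n) (x - d))) (at x)" by (rule \<phi>(4)[OF T0x])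
      show "\<bar>\<nu> * u (k n) x - g (\<phi> (k n) (x - d))\<bar> \<le> C" using u'_bd T0x by simp
    qed (auto intro!: tendsto_intros U g_\<Phi>)
  qed (auto intro!: continuous_intros g_cont U_cont)
  \<comment> \<open>A limit of positive solutions could vanish. The lower barrier makes it positive
    far to the left, and \<open>U \<ge> 0\<close> carries positivity to the right.\<close>
  have \<Phi>_pos: "\<Phi> t > 0" for t
  proof -
    define r where "r = min t (min R0 R')"
    have "\<Phi> r * exp (- (\<mu> * r)) \<le> \<Phi> t * exp (- (\<mu> * t))"
    proof (rule DERIV_mono_on[where f = "\<lambda>t. \<Phi> t * exp (- (\<mu> * t))"])
      fix x
      show "((\<lambda>t. \<Phi> t * exp (- (\<mu> * t))) has_real_derivative U x * exp (- (\<mu> * x))) (at x)"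
        by (auto intro!: derivative_eq_intros d\<Phi> simp: algebra_simps)
      show "U x * exp (- (\<mu> * x)) \<ge> 0" using U_nonneg by simp
    qed (simp add: r_def)
    moreover have "\<Phi> r > 0"
      using \<Phi>_lower[of r] f_pos[of r] unfolding r_def by (smt (verit) exp_gt_zero min.cobounded1 min.cobounded2 zero_less_mult_iff)
    then have "\<Phi> r * exp (- (\<mu> * r)) > 0" by simp
    ultimately have "\<Phi> t * exp (- (\<mu> * t)) > 0" by simp
    then show ?thesis by (simp add: zero_less_mult_iff)
  qed
  have "(\<Phi> \<longlongrightarrow> 0) at_bot"
    by (rule tendsto_sandwich[OF _ _ tendsto_const s_lim])
      (use \<Phi>_nonneg \<Phi>_upper in \<open>auto simp: eventually_at_bot_linorder\<close>)
  moreover have "((\<lambda>t. \<mu> * \<Phi> t + U t) has_real_derivative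
      \<mu> * (\<mu> * \<Phi> t + U t) + (\<nu> * U t - g (\<Phi> (t - d)))) (at t)" for t
    by (intro derivative_intros DERIV_cmult d\<Phi> dU)
  moreover have "\<mu> * (\<mu> * x + y) + (\<nu> * y - z) - c * (\<mu> * x + y) - x + z = 0" for x y z
  proof -
    have "\<mu> * (\<mu> * x + y) + (\<nu> * y - z) - (\<mu> + \<nu>) * (\<mu> * x + y) - x + z = - (1 + \<mu> * \<nu>) * x"
      by (simp add: algebra_simps)
    then show ?thesis by (simp add: \<mu>_\<nu>_sum \<mu>_\<nu>_prod)
  qed
  ultimately have "profile \<Phi> (\<lambda>t. \<mu> * \<Phi> t + U t)
      (\<lambda>t. \<mu> * (\<mu> * \<Phi> t + U t) + (\<nu> * U t - g (\<Phi> (t - d))))"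
    unfolding profile_def using \<Phi>_pos \<Phi>_le d\<Phi> by blast
  then show ?thesis by blast
qed

end


section \<open>Explicit barriers for a simple and for a double zero\<close>

lemma conjugated_exp:
  "conj_op (\<lambda>t. exp (\<eta> * t)) (\<lambda>t. \<eta> * exp (\<eta> * t)) (\<lambda>t. \<eta>\<^sup>2 * exp (\<eta> * t)) t =
    cf p d c (l + \<eta>) * exp (\<eta> * t)"
proof -
  have "p * exp (- (l * d)) * exp (\<eta> * (t - d)) = p * exp (- ((l + \<eta>) * d)) * exp (\<eta> * t)"
    by (simp add: mult.assoc exp_add[symmetric] algebra_simps)
  then show ?thesis
    unfolding cf_def exp_l_d by (simp only:) (simp add: algebra_simps power2_eq_square)
qed

text \<open>In the original variable the barriers are e^(l t) and e^(l t) - q e^((l + \<eta>) t).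
  Just to the right of a simple zero \<open>cf\<close> is negative, so the subtracted term
  contributes \<open>q * m * exp (\<eta> * t)\<close> with \<open>m > 0\<close>;
  \<open>\<eta> \<le> \<alpha> * l\<close> and \<open>q * m \<ge> K'\<close> let it outweigh the
  remainder of order \<open>1 + \<alpha>\<close> for negative \<open>t\<close>.\<close>

lemma profile_exists_noncritical:
  assumes "cf' p d c l < 0"
  shows "\<exists>\<phi> \<phi>1 \<phi>2. profile \<phi> \<phi>1 \<phi>2"
proof -
  obtain e where e: "e > 0" "\<And>h. h > 0 \<Longrightarrow> h < e \<Longrightarrow> cf p d c (l + h) < cf p d c l"
    using DERIV_neg_dec_right[OF DERIV_cf assms] by auto
  define \<eta> where "\<eta> = min (e / 2) (\<alpha> * l)"
  have \<eta>: "0 < \<eta>" "\<eta> < e" "\<eta> \<le> \<alpha> * l"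
    unfolding \<eta>_def using e(1) \<alpha>_pos l_pos by auto
  define m where "m = - cf p d c (l + \<eta>)"
  have m: "m > 0" unfolding m_def using e(2)[of \<eta>] \<eta> cf_l by simp
  define q where "q = max 1 (K' / m)"
  have q: "q \<ge> 1" "K' \<le> q * m"
    unfolding q_def using m by (auto simp: max_def field_simps)
  \<comment> \<open>At \<open>R\<close> the upper barrier e^(l t) equals \<open>M\<close>;
    \<open>R'\<close> is the zero of the lower barrier.\<close>
  define R where "R = ln M / l"
  define R' where "R' = - (ln q / \<eta>)"
  have R: "R \<ge> 0" "R' \<le> 0" unfolding R_def R'_def using M_ge_1 l_pos q \<eta> by auto
  have qR': "q * exp (\<eta> * R') = 1"
    unfolding R'_def using q \<eta> by (simp add: exp_minus)
  let ?f = "\<lambda>t. 1 - q * exp (\<eta> * t)"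
  let ?f1 = "\<lambda>t. - (q * (\<eta> * exp (\<eta> * t)))"
  let ?f2 = "\<lambda>t. - (q * (\<eta>\<^sup>2 * exp (\<eta> * t)))"
  show ?thesis
  proof (rule profile_from_barriers[where s = "\<lambda>_. 1" and ?s1.0 = "\<lambda>_. 0" and ?s2.0 = "\<lambda>_. 0" and
        f = ?f and ?f1.0 = ?f1 and
        ?f2.0 = ?f2 and R = R and R' = R' and ?R0.0 = "R' - 1"])
    fix t
    show "(?f has_real_derivative - (q * (\<eta> * exp (\<eta> * t)))) (at t)"
      by (auto intro!: derivative_eq_intros)
    show "(?f1 has_real_derivative - (q * (\<eta>\<^sup>2 * exp (\<eta> * t)))) (at t)"
      by (auto intro!: derivative_eq_intros simp: power2_eq_square)
    show "1 - q * exp (\<eta> * t) > 0" if "t \<le> R' - 1"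
    proof -
      have "q * exp (\<eta> * t) < q * exp (\<eta> * R')" using that \<eta> q by simp
      then show ?thesis using qR' by simp
    qed
    show "conj_op ?f ?f1 ?f2 t \<ge>
        K' * (1 * exp (l * (t - d))) powr (1 + \<alpha>) * exp (- (l * t))" if "t < R'"
    proof -
      have "(1 * exp (l * (t - d))) powr (1 + \<alpha>) * exp (- (l * t)) = exp (l * (t - d) * (1 + \<alpha>) - l * t)"
        by (simp add: powr_def exp_add[symmetric] algebra_simps)
      also have "l * (t - d) * (1 + \<alpha>) - l * t \<le> \<eta> * t"
      proof -
        have "l * (t - d) * (1 + \<alpha>) - l * t = \<alpha> * l * t - l * d * (1 + \<alpha>)" by (simp add: algebra_simps)
        moreover have "l * d * (1 + \<alpha>) \<ge> 0" using l_pos d_nonneg \<alpha>_pos by simp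
        moreover have "\<alpha> * l * t \<le> \<eta> * t" using \<eta> that R by (intro mult_right_mono_neg) auto
        ultimately show ?thesis by linarith
      qed
      finally have "(1 * exp (l * (t - d))) powr (1 + \<alpha>) * exp (- (l * t)) \<le> exp (\<eta> * t)" by simp
      then have "K' * ((1 * exp (l * (t - d))) powr (1 + \<alpha>) * exp (- (l * t))) \<le> q * m * exp (\<eta> * t)"
        using K'_pos q m by (intro mult_mono) auto
      moreover have "conj_op ?f ?f1 ?f2 t =
          - q * (conj_op (\<lambda>t. exp (\<eta> * t)) (\<lambda>t. \<eta> * exp (\<eta> * t)) (\<lambda>t. \<eta>\<^sup>2 * exp (\<eta> * t)) t)"
        by algebra
      ultimately show ?thesis unfolding conjugated_exp m_def by (simp add: mult.assoc)
    qed
    show "1 - q * exp (\<eta> * t) \<le> 1" using q by simp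
  next
    show "((\<lambda>t. 1 * exp (l * t)) \<longlongrightarrow> 0) at_bot" using l_pos by real_asymp
    show "M \<le> 1 * exp (l * R)" unfolding R_def using l_pos M_ge_1 by simp
  qed (use R qR' in auto)
qed

text \<open>At a double zero t e^(l t) solves the linear equation too, which suggests barriers
  linear in \<open>t\<close> after conjugation. By convexity \<open>cf\<close> is now positive to
  the right of \<open>l\<close>, so the exponential correction enters with the opposite sign; the
  constant \<open>- q\<close> makes the lower barrier vanish at 0.\<close>

lemma profile_exists_critical:
  assumes "cf' p d c l = 0"
  shows "\<exists>\<phi> \<phi>1 \<phi>2. profile \<phi> \<phi>1 \<phi>2"
proof -
  define \<eta> where "\<eta> = \<alpha> * l / 2"
  have \<eta>: "\<eta> > 0" unfolding \<eta>_def using \<alpha>_pos l_pos by simp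
  define m where "m = cf p d c (l + \<eta>)"
  obtain \<xi> where \<xi>: "l < \<xi>" "cf p d c (l + \<eta>) - cf p d c l = (l + \<eta> - l) * cf' p d c \<xi>"
    using MVT2[of l "l + \<eta>" "cf p d c" "cf' p d c"] \<eta> DERIV_cf by (auto simp del: add_diff_cancel_left')
  have "cf' p d c \<xi> > 0"
    using cf'_strict_mono[of p d l \<xi> c] \<xi>(1) p_gt_1 d_nonneg assms by simp
  then have m: "m > 0" unfolding m_def using \<xi>(2) \<eta> cf_l by simp
  \<comment> \<open>With \<open>C - R = 1 / l\<close> the upper barrier at \<open>R\<close> is
    \<open>exp (l * R) / l\<close>; \<open>C\<close> is chosen to make this at least
    \<open>M\<close> while \<open>R \<ge> 0\<close>.\<close>
  define C where "C = (1 + max 0 (ln (l * M))) / l"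
  have C: "C \<ge> 0" unfolding C_def using l_pos by simp
  define R where "R = C - 1 / l"
  have R_eq: "l * R = max 0 (ln (l * M))"
    unfolding R_def C_def using l_pos by (simp add: field_simps)
  then have "R \<ge> 0" using l_pos by (metis max.cobounded1 mult_nonneg_nonneg zero_le_mult_iff not_less mult_pos_neg)
  have MR: "M \<le> (C - R) * exp (l * R)"
  proof -
    have "exp (l * R) \<ge> l * M"
      unfolding R_eq using l_pos M_ge_1 by (simp add: max_def)
    then show ?thesis unfolding R_def using l_pos by (simp add: field_simps)
  qed
  \<comment> \<open>The remainder contains the power \<open>1 + \<alpha>\<close> of a linear
    function of \<open>t\<close>. A tangent line to ln of slope \<open>\<kappa>\<close> bounds this
    power by \<open>exp (c0 - \<eta> * t)\<close>, which spends half of the available exponent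
    \<open>\<alpha> * l = 2 * \<eta>\<close>.\<close>
  define \<kappa> where "\<kappa> = \<alpha> * l / (2 * (1 + \<alpha>))"
  have \<kappa>: "\<kappa> > 0" "(1 + \<alpha>) * \<kappa> = \<eta>"
    unfolding \<kappa>_def \<eta>_def using \<alpha>_pos l_pos by (auto simp: field_simps)
  define c0 where "c0 = \<eta> * (C + d) - (1 + \<alpha>) * (1 + ln \<kappa>)"
  define q where "q = K' * exp c0 / m"
  have q: "q > 0" "q * m = K' * exp c0" unfolding q_def using K'_pos m by auto
  have bd: "p * exp (- (l * d)) * d = - (c - 2 * l)"
    using assms unfolding cf'_def by (simp add: algebra_simps)
  have s_eq: "conj_op (\<lambda>t. D - t) (\<lambda>_. - 1) (\<lambda>_. 0) t = 0" for D t
  proof -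
    have "conj_op (\<lambda>t. D - t) (\<lambda>_. - 1) (\<lambda>_. 0) t =
        (c - 2 * l) + p * exp (- (l * d)) * d" by algebra
    then show ?thesis unfolding bd by simp
  qed
  let ?f = "\<lambda>t. - t - q + q * exp (\<eta> * t)"
  let ?f1 = "\<lambda>t. - 1 + q * (\<eta> * exp (\<eta> * t))"
  let ?f2 = "\<lambda>t. q * (\<eta>\<^sup>2 * exp (\<eta> * t))"
  show ?thesis
  proof (rule profile_from_barriers[where s = "\<lambda>t. C - t" and ?s1.0 = "\<lambda>_. - 1" and ?s2.0 = "\<lambda>_. 0" and
        f = ?f and ?f1.0 = ?f1 and
        ?f2.0 = ?f2 and R = R and R' = 0 and ?R0.0 = "- q"])
    fix t
    show "((\<lambda>t. C - t) has_real_derivative - 1) (at t)" by (auto intro!: derivative_eq_intros)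
    show "(?f has_real_derivative - 1 + q * (\<eta> * exp (\<eta> * t))) (at t)"
      by (auto intro!: derivative_eq_intros)
    show "(?f1 has_real_derivative q * (\<eta>\<^sup>2 * exp (\<eta> * t))) (at t)"
      by (auto intro!: derivative_eq_intros simp: power2_eq_square)
    show "conj_op (\<lambda>t. C - t) (\<lambda>_. - 1) (\<lambda>_. 0) t = 0"
      by (rule s_eq)
    show "- t - q + q * exp (\<eta> * t) > 0" if "t \<le> - q"
    proof -
      have "q * exp (\<eta> * t) > 0" using q by simp
      then show ?thesis using that by linarith
    qed
    show "- t - q + q * exp (\<eta> * t) \<le> C - t" if "t \<le> 0"
    proof -
      have "q * exp (\<eta> * t) \<le> q * 1" using q that \<eta> by (intro mult_left_mono) (auto simp: mult_nonneg_nonpos)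
      then show ?thesis using C by simp
    qed
    show "C - t \<ge> 0" if "t \<le> 0" using that C by simp
    show "conj_op ?f ?f1 ?f2 t \<ge>
        K' * ((C - (t - d)) * exp (l * (t - d))) powr (1 + \<alpha>) * exp (- (l * t))" if "t < 0"
    proof -
      define y where "y = C - (t - d)"
      have y: "y > 0" unfolding y_def using C that d_nonneg by simp
      have "ln (\<kappa> * y) \<le> \<kappa> * y - 1" using \<kappa> y by (intro ln_le_minus_one) simp
      then have "ln y \<le> \<kappa> * y - 1 - ln \<kappa>" using \<kappa> y by (simp add: ln_mult)
      then have "(1 + \<alpha>) * ln y \<le> (1 + \<alpha>) * (\<kappa> * y - 1 - ln \<kappa>)"
        using \<alpha>_pos by (intro mult_left_mono) auto
      also have "\<dots> = (1 + \<alpha>) * \<kappa> * y - (1 + \<alpha>) * (1 + ln \<kappa>)" by (simp add: algebra_simps)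
      also have "\<dots> = c0 - \<eta> * t" unfolding \<kappa>(2) c0_def y_def by (simp add: algebra_simps)
      finally have ln_y: "(1 + \<alpha>) * ln y \<le> c0 - \<eta> * t" .
      have "(y * exp (l * (t - d))) powr (1 + \<alpha>) * exp (- (l * t)) =
          exp ((1 + \<alpha>) * ln y + (1 + \<alpha>) * (l * (t - d)) - l * t)"
        using y by (simp add: powr_def ln_mult exp_add[symmetric] algebra_simps)
      also have "(1 + \<alpha>) * ln y + (1 + \<alpha>) * (l * (t - d)) - l * t \<le> c0 + \<eta> * t"
      proof -
        have "(1 + \<alpha>) * (l * (t - d)) - l * t = 2 * \<eta> * t - (1 + \<alpha>) * (l * d)"
          unfolding \<eta>_def by (simp add: algebra_simps)
        moreover have "(1 + \<alpha>) * (l * d) \<ge> 0" using \<alpha>_pos l_pos d_nonneg by simp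
        ultimately show ?thesis using ln_y by linarith
      qed
      finally have "(y * exp (l * (t - d))) powr (1 + \<alpha>) * exp (- (l * t)) \<le> exp (c0 + \<eta> * t)" by simp
      then have "K' * ((y * exp (l * (t - d))) powr (1 + \<alpha>) * exp (- (l * t))) \<le> K' * exp (c0 + \<eta> * t)"
        using K'_pos by (intro mult_left_mono) auto
      also have "\<dots> = q * (m * exp (\<eta> * t))" using q(2) by (simp add: exp_add mult.assoc[symmetric])
      also have "\<dots> = (conj_op (\<lambda>t. - q - t) (\<lambda>_. - 1) (\<lambda>_. 0) t) +
          q * (conj_op (\<lambda>t. exp (\<eta> * t)) (\<lambda>t. \<eta> * exp (\<eta> * t)) (\<lambda>t. \<eta>\<^sup>2 * exp (\<eta> * t)) t)"
        unfolding s_eq conjugated_exp m_def by simp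
      also have "\<dots> = conj_op ?f ?f1 ?f2 t"
        by algebra
      finally show ?thesis unfolding y_def by (simp add: mult.assoc)
    qed
  next
    show "((\<lambda>t. (C - t) * exp (l * t)) \<longlongrightarrow> 0) at_bot" using l_pos by real_asymp
  qed (use MR \<open>R \<ge> 0\<close> in auto)
qed

lemma profile_exists: "\<exists>\<phi> \<phi>1 \<phi>2. profile \<phi> \<phi>1 \<phi>2"
  using profile_exists_critical profile_exists_noncritical cf'_l by fastforce

end

section \<open>Transfer to the original hypotheses and to semi-wavefronts\<close>

theorem corollary4:
  fixes g :: "real \<Rightarrow> real" and g'0 \<kappa> h c :: real
  assumes nonneg: "\<And>x. x \<ge> 0 \<Longrightarrow> g x \<ge> 0"
    and bdd: "bounded (g ` {0..})"
    and unimodal: "unimodal g"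
    and lipschitz: "\<exists>L. L-lipschitz_on {0..} (\<lambda>x. - x + g x)"
    and zeros: "\<kappa> > 0" "{x. x \<ge> 0 \<and> - x + g x = 0} = {0, \<kappa>}"
    and pos: "\<And>x. 0 < x \<Longrightarrow> x < \<kappa> \<Longrightarrow> - x + g x > 0"
    and deriv0: "(g has_real_derivative g'0) (at 0 within {0..})"
    and smooth0: "\<exists>\<alpha> \<delta> K. \<alpha> > 0 \<and> \<delta> > 0 \<and> K > 0 \<and>
      (\<forall>x\<in>{0..<\<delta>}. \<forall>y\<in>{0..<\<delta>}.
         \<bar>g y - g x - g'0 * (y - x)\<bar> \<le> K * \<bar>y - x\<bar> * (\<bar>x\<bar> powr \<alpha> + \<bar>y\<bar> powr \<alpha>))"
    and slope: "g'0 > 1"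
    and sublinear: "\<And>x1 x2. 0 \<le> x1 \<Longrightarrow> x1 < x2 \<Longrightarrow> g x2 - g x1 \<le> g'0 * (x2 - x1)"
    and h: "h \<ge> 0"
    and c: "c \<ge> c_star g'0 h"
  shows "(\<exists>\<phi>. semi_wavefront_profile g h c \<phi>) \<and>
    (\<forall>\<phi> \<psi>. semi_wavefront_profile g h c \<phi> \<longrightarrow> semi_wavefront_profile g h c \<psi> \<longrightarrow>
       (\<exists>t'. \<forall>t. \<phi> (t + t') = \<psi> t))"
proof -
  obtain z0 where z0: "c > 0" "z0 > 0" "cf g'0 (c * h) c z0 \<le> 0"
    using c_star_le_imp[OF slope h c] by blast
  obtain l where l: "0 < l" "cf g'0 (c * h) c l = 0" "\<And>z. 0 \<le> z \<Longrightarrow> z < l \<Longrightarrow> cf g'0 (c * h) c z > 0"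
    "cf' g'0 (c * h) c l \<le> 0"
    using cf_least_zero[OF slope z0(2,3)] by metis
  obtain B where B: "\<And>x. x \<ge> 0 \<Longrightarrow> \<bar>g x\<bar> \<le> B"
    using bdd unfolding bounded_iff by auto
  obtain L where L: "L-lipschitz_on {0..} (\<lambda>x. - x + g x)" using lipschitz by blast
  obtain \<alpha> \<delta> K where K: "\<alpha> > 0" "\<delta> > 0" "K > 0"
    "\<And>x y. x \<in> {0..<\<delta>} \<Longrightarrow> y \<in> {0..<\<delta>} \<Longrightarrow>
      \<bar>g y - g x - g'0 * (y - x)\<bar> \<le> K * \<bar>y - x\<bar> * (\<bar>x\<bar> powr \<alpha> + \<bar>y\<bar> powr \<alpha>)"
    using smooth0 by blast
  have "0 \<in> {x. x \<ge> 0 \<and> - x + g x = 0}" unfolding zeros by simp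
  then have g0: "g 0 = 0" by simp
  \<comment> \<open>The maximum with 1 normalises the bound of \<open>g\<close>, and adding the
    identity back to \<open>- x + g x\<close> raises the Lipschitz constant by 1.\<close>
  interpret delayed_wave g g'0 c "c * h" l "max 1 B" "L + 1" \<alpha> \<delta> K
  proof
    show "g x \<le> max 1 B" if "x \<ge> 0" for x using B[OF that] by simp
    show "\<bar>g x - g y\<bar> \<le> (L + 1) * \<bar>x - y\<bar>" if "x \<ge> 0" "y \<ge> 0" for x y
    proof -
      have "\<bar>(- x + g x) - (- y + g y)\<bar> \<le> L * \<bar>x - y\<bar>"
        using lipschitz_onD[OF L, of x y] that by (simp add: dist_real_def)
      then show ?thesis by (simp add: algebra_simps abs_le_iff) linarith
    qed
    show "L + 1 \<ge> 0" using lipschitz_on_nonneg[OF L] by simp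
    show "g y - g x \<le> g'0 * (y - x)" if "0 \<le> x" "x \<le> y" for x y
      using sublinear[of x y] that by (cases "x = y") auto
    show "\<bar>g y - g x - g'0 * (y - x)\<bar> \<le> K * \<bar>y - x\<bar> * (x powr \<alpha> + y powr \<alpha>)"
      if "0 \<le> x" "x < \<delta>" "0 \<le> y" "y < \<delta>" for x y
      using K(4)[of x y] that by simp
  qed (use slope z0 h g0 nonneg K l in auto)
  have iff: "semi_wavefront_profile g h c \<phi> \<longleftrightarrow> (\<exists>\<phi>1 \<phi>2. profile \<phi> \<phi>1 \<phi>2)" for \<phi>
  proof
    assume "semi_wavefront_profile g h c \<phi>"
    then have pos: "\<And>s. \<phi> s > 0" and bdd: "bounded (range \<phi>)" and lim: "(\<phi> \<longlongrightarrow> 0) at_bot"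
      and "\<exists>\<phi>1 \<phi>2. (\<forall>s. (\<phi> has_real_derivative \<phi>1 s) (at s)) \<and>
        (\<forall>s. (\<phi>1 has_real_derivative \<phi>2 s) (at s)) \<and> continuous_on UNIV \<phi>2 \<and>
        (\<forall>s. \<phi>2 s - c * \<phi>1 s - \<phi> s + g (\<phi> (s - c * h)) = 0)"
      unfolding semi_wavefront_profile_iff by blast+
    then obtain \<phi>1 \<phi>2 where "\<And>s. (\<phi> has_real_derivative \<phi>1 s) (at s)"
      "\<And>s. (\<phi>1 has_real_derivative \<phi>2 s) (at s)" "\<And>s. \<phi>2 s - c * \<phi>1 s - \<phi> s + g (\<phi> (s - c * h)) = 0"
      by blast
    moreover have "\<exists>B. \<forall>t. \<phi> t \<le> B"
      using bdd unfolding bounded_iff by (metis abs_le_D1 rangeI real_norm_def)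
    ultimately have "profile \<phi> \<phi>1 \<phi>2" unfolding profile_def using pos lim by blast
    then show "\<exists>\<phi>1 \<phi>2. profile \<phi> \<phi>1 \<phi>2" by blast
  next
    assume "\<exists>\<phi>1 \<phi>2. profile \<phi> \<phi>1 \<phi>2"
    then obtain \<phi>1 \<phi>2 where \<phi>: "profile \<phi> \<phi>1 \<phi>2" by blast
    obtain B where B: "\<And>t. \<phi> t \<le> B" using \<phi> unfolding profile_def by blast
    have c0: "continuous_on UNIV \<phi>" by (rule continuous_of_DERIV[OF DERIV_profile[OF \<phi>]])
    have c1: "continuous_on UNIV \<phi>1" by (rule continuous_of_DERIV[OF DERIV_profile1[OF \<phi>]])
    have "continuous_on UNIV (\<lambda>t. \<phi> (t - c * h))"
      by (rule continuous_on_compose2[OF c0]) (auto intro!: continuous_intros)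
    then have "continuous_on UNIV (\<lambda>t. g (\<phi> (t - c * h)))"
      using g_max_cont[of "\<lambda>t. \<phi> (t - c * h)"] profile_pos[OF \<phi>] by (simp add: max_absorb1 less_imp_le)
    then have "continuous_on UNIV \<phi>2"
      unfolding profile_eq[OF \<phi>, abs_def] by (intro continuous_intros c0 c1)
    moreover have "bounded (range \<phi>)"
      unfolding bounded_iff using B profile_pos[OF \<phi>] by (auto intro!: exI[of _ B] simp: abs_of_pos)
    ultimately show "semi_wavefront_profile g h c \<phi>"
      unfolding semi_wavefront_profile_iff using \<phi> unfolding profile_def by blast
  qed
  show ?thesis unfolding iff using profile_exists profile_uniqueness by blast
qed

end
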